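(* Let $p>2$ be a prime, let $k$ be an algebraically closed field of characteristic $p$, let $n\ge 1$, and let $n_1,\dots,n_n\ge 0$ be integers. Let $A_n=k\langle x_1,\dots,x_n\rangle$ be the free associative unital $k$-algebra on $n$ generators, let $f_1,\dots,f_m\in A_n$ be noncommutative polynomials in $x_1^{p^{n_1}},\dots,x_n^{p^{n_n}}$ (i.e. elements of the unital $k$-subalgebra of $A_n$ generated by these powers), and let $A=A_n/(f_1,\dots,f_m)$ be the quotient by the two-sided ideal they generate. Then for every $i\ge 1$ the algebra $\bigotimes_{j=1}^{n}W_{n_j}(k)$ acts on $N_i(A)$; that is, $N_i(A)$ carries the structure of a (unital, left) $\bigotimes_{j=1}^{n}W_{n_j}(k)$-module.
   Context: For an associative algebra $A$, define $L_1(A)=A$ and $L_{i+1}(A)=[A,L_i(A)]$ (the linear span of all commutators $[a,l]=al-la$ with $a\in A$, $l\in L_i(A)$), $M_i(A)=A\,L_i(A)\,A$ (the two-sided ideal generated by $L_i(A)$), and $N_i(A)=M_i(A)/M_{i+1}(A)$. The Weyl algebra with divided powers over $\mathbb{Z}$, $W(\mathbb{Z})$, is the algebra of operators on $\mathbb{Z}[x]$ of the form $\sum_{i,j}a_{ij}x^iD_j$ (finite sums, $a_{ij}\in\mathbb{Z}$), where $D=\partial/\partial x$ and $D_j=D^j/j!$. For a commutative ring $R$, $W(R)=W(\mathbb{Z})\otimes_{\mathbb Z} R$. For a field $k$ of characteristic $p$ and $r\ge 0$, $W_r(k)$ is the subalgebra of $W(k)$ generated by $x$ and all $D_j$ with $j<p^r$.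 Tensor products are over $k$, with product $(a\otimes b)(a'\otimes b')=aa'\otimes bb'$. *)

theory Defs
  imports "HOL-Algebra.Algebra" "HOL-Computational_Algebra.Polynomial"
begin

text \<open>
  An associative unital algebra over a commutative ring \<open>k\<close> is a record of type
  \<^typ>\<open>('k, 'a) module\<close>: a (not necessarily commutative) ring together with a scalar multiplication.
\<close>

section \<open>Subalgebras and quotients\<close>

definition linear_span ::
  "('k, 'x) ring_scheme \<Rightarrow> ('k, 'a, 'y) module_scheme \<Rightarrow> 'a set \<Rightarrow> 'a set"
  where "linear_span k A S = \<Inter>{V. submodule V k A \<and> S \<subseteq> V}"

definition generated_subalgebra ::
  "('k, 'x) ring_scheme \<Rightarrow> ('k, 'a, 'y) module_scheme \<Rightarrow> 'a set \<Rightarrow> 'a set"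
  where "generated_subalgebra k A S = \<Inter>{B. subring B A \<and> submodule B k A \<and> S \<subseteq> B}"

definition quotient_algebra :: "('k, 'a, 'y) module_scheme \<Rightarrow> 'a set \<Rightarrow> ('k, 'a set) module"
  where "quotient_algebra A I =
    ring.extend (A Quot I) (module.fields (\<lambda>c Y. \<Union>a\<in>Y. I +>\<^bsub>A\<^esub> (c \<odot>\<^bsub>A\<^esub> a)))"


section \<open>Monoid algebras and free algebras\<close>

text \<open>Elements of the monoid algebra \<open>k[M]\<close> are the finitely supported functions \<open>M \<rightarrow> k\<close>,
  extended by zero outside the carrier of \<open>M\<close>.\<close>

definition monoid_algebra ::
  "('k, 'x) ring_scheme \<Rightarrow> ('m, 'y) monoid_scheme \<Rightarrow> ('k, 'm \<Rightarrow> 'k) module"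
  where "monoid_algebra k M =
    \<lparr>carrier = {f. (\<forall>m. f m \<in> carrier k) \<and> {m. f m \<noteq> \<zero>\<^bsub>k\<^esub>} \<subseteq> carrier M \<and> finite {m. f m \<noteq> \<zero>\<^bsub>k\<^esub>}},
     monoid.mult = (\<lambda>f g m. \<Oplus>\<^bsub>k\<^esub>u\<in>{u. f u \<noteq> \<zero>\<^bsub>k\<^esub>}. \<Oplus>\<^bsub>k\<^esub>v\<in>{v. g v \<noteq> \<zero>\<^bsub>k\<^esub>}.
              if u \<otimes>\<^bsub>M\<^esub> v = m then f u \<otimes>\<^bsub>k\<^esub> g v else \<zero>\<^bsub>k\<^esub>),
     monoid.one = (\<lambda>m. if m = \<one>\<^bsub>M\<^esub> then \<one>\<^bsub>k\<^esub> else \<zero>\<^bsub>k\<^esub>),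
     ring.zero = (\<lambda>m. \<zero>\<^bsub>k\<^esub>),
     ring.add = (\<lambda>f g m. f m \<oplus>\<^bsub>k\<^esub> g m),
     module.smult = (\<lambda>c f m. c \<otimes>\<^bsub>k\<^esub> f m)\<rparr>"

definition basis_elem :: "('k, 'x) ring_scheme \<Rightarrow> 'm \<Rightarrow> 'm \<Rightarrow> 'k"
  where "basis_elem k u = (\<lambda>m. if m = u then \<one>\<^bsub>k\<^esub> else \<zero>\<^bsub>k\<^esub>)"

definition free_monoid :: "'s set \<Rightarrow> 's list monoid"
  where "free_monoid S = \<lparr>carrier = lists S, monoid.mult = (@), monoid.one = []\<rparr>"

definition free_algebra :: "('k, 'x) ring_scheme \<Rightarrow> 's set \<Rightarrow> ('k, 's list \<Rightarrow> 'k) module"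
  where "free_algebra k S = monoid_algebra k (free_monoid S)"

abbreviation generator :: "('k, 'x) ring_scheme \<Rightarrow> 's \<Rightarrow> 's list \<Rightarrow> 'k"
  where "generator k s \<equiv> basis_elem k [s]"


section \<open>Tensor products\<close>

text \<open>
  The tensor product of the \<open>k\<close>-algebras \<open>B j\<close> (\<open>j \<in> I\<close>, \<open>I\<close> finite) is the free \<open>k\<close>-module on
  \<open>\<Pi>\<^sub>j B j\<close> modulo the multilinearity relations.  The free module is taken as the monoid algebra of
  the multiplicative monoid \<open>\<Pi>\<^sub>j B j\<close>, so that the product of the quotient is
  \<open>(\<Otimes>\<^sub>j b\<^sub>j) (\<Otimes>\<^sub>j b'\<^sub>j) = \<Otimes>\<^sub>j b\<^sub>j b'\<^sub>j\<close>; the span of the relations is already an ideal.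
\<close>

definition multilinear_relations ::
  "('k, 'x) ring_scheme \<Rightarrow> 'i set \<Rightarrow> ('i \<Rightarrow> ('k, 'b, 'y) module_scheme) \<Rightarrow> (('i \<Rightarrow> 'b) \<Rightarrow> 'k) set"
  where "multilinear_relations k I B =
    (let F = monoid_algebra k (product_group I B) in
      {basis_elem k (f(j := b \<oplus>\<^bsub>B j\<^esub> b'))
          \<ominus>\<^bsub>F\<^esub> (basis_elem k (f(j := b)) \<oplus>\<^bsub>F\<^esub> basis_elem k (f(j := b')))
        | f j b b'. f \<in> carrier (product_group I B) \<and> j \<in> I \<and> b \<in> carrier (B j) \<and> b' \<in> carrier (B j)}
    \<union> {basis_elem k (f(j := c \<odot>\<^bsub>B j\<^esub> b)) \<ominus>\<^bsub>F\<^esub> c \<odot>\<^bsub>F\<^esub> basis_elem k (f(j := b))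
        | f j b c. f \<in> carrier (product_group I B) \<and> j \<in> I \<and> b \<in> carrier (B j) \<and> c \<in> carrier k})"

definition tensor_algebra ::
  "('k, 'x) ring_scheme \<Rightarrow> 'i set \<Rightarrow> ('i \<Rightarrow> ('k, 'b, 'y) module_scheme) \<Rightarrow>
   ('k, (('i \<Rightarrow> 'b) \<Rightarrow> 'k) set) module"
  where "tensor_algebra k I B =
    (let F = monoid_algebra k (product_group I B)
     in quotient_algebra F (Idl\<^bsub>F\<^esub> (multilinear_relations k I B)))"

text \<open>Likewise \<open>A \<otimes>\<^sub>\<int> R\<close> for a ring \<open>A\<close> and a commutative ring \<open>R\<close>, as an \<open>R\<close>-algebra
  via \<open>c t = (1 \<otimes> c) t\<close>.\<close>

definition biadditive_relations ::
  "('a, 'x) ring_scheme \<Rightarrow> ('r, 'y) ring_scheme \<Rightarrow> ('a \<times> 'r \<Rightarrow> int) set"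
  where "biadditive_relations A R =
    (let F = monoid_algebra \<Z> (A \<times>\<times> R) in
      {basis_elem \<Z> (a \<oplus>\<^bsub>A\<^esub> a', r) \<ominus>\<^bsub>F\<^esub> (basis_elem \<Z> (a, r) \<oplus>\<^bsub>F\<^esub> basis_elem \<Z> (a', r))
        | a a' r. a \<in> carrier A \<and> a' \<in> carrier A \<and> r \<in> carrier R}
    \<union> {basis_elem \<Z> (a, r \<oplus>\<^bsub>R\<^esub> r') \<ominus>\<^bsub>F\<^esub> (basis_elem \<Z> (a, r) \<oplus>\<^bsub>F\<^esub> basis_elem \<Z> (a, r'))
        | a r r'. a \<in> carrier A \<and> r \<in> carrier R \<and> r' \<in> carrier R})"

definition pure_tensor_int ::
  "('a, 'x) ring_scheme \<Rightarrow> ('r, 'y) ring_scheme \<Rightarrow> 'a \<Rightarrow> 'r \<Rightarrow> ('a \<times> 'r \<Rightarrow> int) set"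
  where "pure_tensor_int A R a r =
    (let F = monoid_algebra \<Z> (A \<times>\<times> R)
     in (Idl\<^bsub>F\<^esub> (biadditive_relations A R)) +>\<^bsub>F\<^esub> basis_elem \<Z> (a, r))"

definition base_change ::
  "('a, 'x) ring_scheme \<Rightarrow> ('r, 'y) ring_scheme \<Rightarrow> ('r, ('a \<times> 'r \<Rightarrow> int) set) module"
  where "base_change A R =
    (let F = monoid_algebra \<Z> (A \<times>\<times> R);
         T = F Quot (Idl\<^bsub>F\<^esub> (biadditive_relations A R))
     in ring.extend T (module.fields (\<lambda>c t. pure_tensor_int A R \<one>\<^bsub>A\<^esub> c \<otimes>\<^bsub>T\<^esub> t)))"


section \<open>The Weyl algebra with divided powers\<close>

text \<open>\<open>D\<^sub>j = D\<^sup>j / j!\<close>; the division by \<open>j!\<close> in \<open>\<int>[x]\<close> is exact, see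
  \<open>fact_mult_divided_deriv\<close> below.\<close>

definition divided_deriv :: "nat \<Rightarrow> int poly \<Rightarrow> int poly"
  where "divided_deriv j f = (pderiv ^^ j) f div fact j"

definition mult_x :: "int poly \<Rightarrow> int poly"
  where "mult_x f = monom 1 1 * f"

definition weyl_int :: "(int poly \<Rightarrow> int poly) ring"
  where "weyl_int =
    \<lparr>carrier = {T. \<exists>S a. finite S \<and>
        T = (\<lambda>f. \<Sum>(i, j)\<in>S. smult (a i j) ((mult_x ^^ i) (divided_deriv j f)))},
     monoid.mult = (\<circ>),
     monoid.one = id,
     ring.zero = (\<lambda>f. 0),
     ring.add = (\<lambda>S T f. S f + T f)\<rparr>"

definition weyl ::
  "('r, 'x) ring_scheme \<Rightarrow> ('r, ((int poly \<Rightarrow> int poly) \<times> 'r \<Rightarrow> int) set) module"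
  where "weyl R = base_change weyl_int R"

text \<open>The subalgebra \<open>W\<^sub>r(k)\<close> of \<open>W(k)\<close>, where \<open>p\<close> is the characteristic of \<open>k\<close>.\<close>

definition weyl_sub ::
  "nat \<Rightarrow> ('k, 'x) ring_scheme \<Rightarrow> nat \<Rightarrow> ('k, ((int poly \<Rightarrow> int poly) \<times> 'k \<Rightarrow> int) set) module"
  where "weyl_sub p k r = (weyl k)\<lparr>carrier := generated_subalgebra k (weyl k)
    ({pure_tensor_int weyl_int k mult_x \<one>\<^bsub>k\<^esub>} \<union>
     {pure_tensor_int weyl_int k (divided_deriv j) \<one>\<^bsub>k\<^esub> | j. j < p ^ r})\<rparr>"


section \<open>The lower central series and its quotients\<close>

text \<open>Indexing starts at \<open>1\<close>; the value at \<open>0\<close> is irrelevant.\<close>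

fun lower_central ::
  "('k, 'x) ring_scheme \<Rightarrow> ('k, 'a, 'y) module_scheme \<Rightarrow> nat \<Rightarrow> 'a set"
  where
    "lower_central k A 0 = carrier A"
  | "lower_central k A (Suc 0) = carrier A"
  | "lower_central k A (Suc (Suc i)) = linear_span k A
      {a \<otimes>\<^bsub>A\<^esub> l \<ominus>\<^bsub>A\<^esub> l \<otimes>\<^bsub>A\<^esub> a | a l. a \<in> carrier A \<and> l \<in> lower_central k A (Suc i)}"

definition lcs_ideal :: "('k, 'x) ring_scheme \<Rightarrow> ('k, 'a, 'y) module_scheme \<Rightarrow> nat \<Rightarrow> 'a set"
  where "lcs_ideal k A i = Idl\<^bsub>A\<^esub> (lower_central k A i)"

text \<open>\<open>N\<^sub>i(A) = M\<^sub>i(A) / M\<^sub>i\<^sub>+\<^sub>1(A)\<close>.  Only its \<open>k\<close>-module structure is meaningful: the \<open>one\<close> field of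
  this record need not belong to its carrier.\<close>

definition lcs_quotient ::
  "('k, 'x) ring_scheme \<Rightarrow> ('k, 'a, 'y) module_scheme \<Rightarrow> nat \<Rightarrow> ('k, 'a set) module"
  where "lcs_quotient k A i = quotient_algebra (A\<lparr>carrier := lcs_ideal k A i\<rparr>) (lcs_ideal k A (Suc i))"


section \<open>Representations of algebras\<close>

text \<open>A unital left module over a \<open>k\<close>-algebra \<open>B\<close>, whose underlying \<open>k\<close>-module is \<open>V\<close>.\<close>

locale algebra_module = module k V
  for k :: "('k, 'x) ring_scheme" (structure)
    and B :: "('k, 'b, 'y) module_scheme"
    and V :: "('k, 'v, 'z) module_scheme"
    and act :: "'b \<Rightarrow> 'v \<Rightarrow> 'v" +
  assumes act_closed: "\<lbrakk>b \<in> carrier B; v \<in> carrier V\<rbrakk> \<Longrightarrow> act b v \<in> carrier V"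
    and act_add: "\<lbrakk>b \<in> carrier B; v \<in> carrier V; w \<in> carrier V\<rbrakk> \<Longrightarrow>
      act b (v \<oplus>\<^bsub>V\<^esub> w) = act b v \<oplus>\<^bsub>V\<^esub> act b w"
    and act_smult: "\<lbrakk>b \<in> carrier B; c \<in> carrier k; v \<in> carrier V\<rbrakk> \<Longrightarrow>
      act b (c \<odot>\<^bsub>V\<^esub> v) = c \<odot>\<^bsub>V\<^esub> act b v"
    and add_act: "\<lbrakk>b \<in> carrier B; b' \<in> carrier B; v \<in> carrier V\<rbrakk> \<Longrightarrow>
      act (b \<oplus>\<^bsub>B\<^esub> b') v = act b v \<oplus>\<^bsub>V\<^esub> act b' v"
    and smult_act: "\<lbrakk>c \<in> carrier k; b \<in> carrier B; v \<in> carrier V\<rbrakk> \<Longrightarrow>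
      act (c \<odot>\<^bsub>B\<^esub> b) v = c \<odot>\<^bsub>V\<^esub> act b v"
    and mult_act: "\<lbrakk>b \<in> carrier B; b' \<in> carrier B; v \<in> carrier V\<rbrakk> \<Longrightarrow>
      act (b \<otimes>\<^bsub>B\<^esub> b') v = act b (act b' v)"
    and one_act: "v \<in> carrier V \<Longrightarrow> act \<one>\<^bsub>B\<^esub> v = v"


section \<open>Exactness of the divided powers\<close>

lemma pochhammer_choose: "pochhammer (int (Suc n)) j = fact j * int ((n + j) choose j)"
proof -
  have "fact n * pochhammer (int (Suc n)) j = fact n * (fact j * int ((n + j) choose j))"
  proof -
    have "fact n * pochhammer (int (Suc n)) j = fact (n + j)"
      using pochhammer_product'[of "1::int" n j] by (simp add: pochhammer_fact add.commute)
    also have "\<dots> = int (fact j * fact (n + j - j) * ((n + j) choose j))"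
      by (subst binomial_fact_lemma) auto
    finally show ?thesis by (simp add: mult_ac)
  qed
  then show ?thesis by simp
qed

lemma coeff_fact_mult: "coeff (fact j * g :: int poly) n = fact j * coeff g n"
proof -
  have "(fact j :: int poly) = [:fact j:]"
    by (metis of_nat_fact of_nat_poly)
  then show ?thesis
    by simp
qed

lemma fact_mult_divided_deriv: "fact j * divided_deriv j f = (pderiv ^^ j) f"
proof -
  have "fact j dvd (pderiv ^^ j) f"
  proof -
    have "[:fact j:] dvd (pderiv ^^ j) f"
      by (simp only: const_poly_dvd_iff coeff_higher_pderiv pochhammer_choose mult.assoc) simp
    moreover have "(fact j :: int poly) = [:fact j:]"
      by (metis of_nat_fact of_nat_poly)
    ultimately show ?thesis by simp
  qed
  then show ?thesis
    by (simp add: divided_deriv_def)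
qed

lemma coeff_divided_deriv: "coeff (divided_deriv j f) n = int ((n + j) choose j) * coeff f (n + j)"
proof -
  have "fact j * coeff (divided_deriv j f) n = fact j * (int ((n + j) choose j) * coeff f (n + j))"
    by (simp only: coeff_fact_mult[symmetric] fact_mult_divided_deriv coeff_higher_pderiv pochhammer_choose mult.assoc)
  then show ?thesis by simp
qed

end

theory Submission
  imports Defs
begin

text \<open>
  The algebra \<open>W\<^sub>r\<close> is spanned by \<open>x\<^sup>i D\<^sub>j\<close> with \<open>j < p\<^sup>r\<close>, so a module over the tensor product is a vector
  space with commuting operators \<open>X\<^sub>j\<close> and commuting divided powers \<open>D\<^sub>j\<^sub>,\<^sub>s\<close>, \<open>s < p\<^bsup>n\<^sub>j\<^esup>\<close>, subject to the
  Heisenberg relations.  The \<open>D\<^sub>j\<^sub>,\<^sub>s\<close> are the coefficients of \<open>t\<^sup>s\<close> in the shift \<open>x\<^sub>j \<mapsto> x\<^sub>j + t\<close> of the free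
  algebra.  Modulo \<open>t\<^bsup>q\<^esup>\<close> with \<open>q = p\<^bsup>n\<^sub>j\<^esup>\<close> the shift fixes \<open>x\<^sub>j\<^sup>q\<close>, hence it fixes all relations; being
  a homomorphism, it preserves every \<open>L\<^sub>i\<close> and \<open>M\<^sub>i\<close>.  The operator \<open>X\<^sub>j\<close> is \<open>v \<mapsto> (x\<^sub>j v + v x\<^sub>j) / 2\<close>, which is
  where \<open>p > 2\<close> enters: \<open>[X\<^sub>j, X\<^sub>l]\<close> is a quarter of \<open>v \<mapsto> [[x\<^sub>j, x\<^sub>l], v]\<close>, and this vanishes on \<open>N\<^sub>i\<close>
  because \<open>M\<^sub>3 M\<^sub>i + M\<^sub>i M\<^sub>3 \<subseteq> M\<^sub>i\<^sub>+\<^sub>1\<close>.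
\<close>

section \<open>Algebras and linear maps\<close>

text \<open>No presentation of W_r(k) is available: it is a generated subalgebra of a base change,
  itself a quotient of a monoid algebra. So the universal property of the base change is used to
  define a bilinear map from W(k) x V to V that sends x^i D_s to X^i D_s for s < q and discards the
  terms with s >= q. In general this is no action of W(k): D_q is sent to 0, while D_q x = x D_q +
  D_(q-1) is sent to D_(q-1). But the b in W(k) for which b w acts as b after w, for every w in
  W(k), form a subalgebra; it contains x and the D_s with s < q, hence W_r(k). Truncation is
  compatible with D_s D_t = C(s+t, s) D_(s+t) because p divides C(s+t, s) whenever s, t < q <= s+t.
  The inclusions for M_3 rest on one observation: for l in L_i, the product [l,a][b,c] is
  alternating in a, b, c modulo M_(i+2). If c is itself a commutator, alternation moves it next to
  l, and the Jacobi identity puts [l,c] into L_(i+2).\<close>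

lemma ring_cong:
  assumes "ring R" "carrier S = carrier R" "ring.add S = ring.add R" "monoid.mult S = monoid.mult R"
    "monoid.one S = monoid.one R" "ring.zero S = ring.zero R"
  shows "ring S"
proof -
  interpret ring R by fact
  show ?thesis
    by (rule ringI; (rule abelian_groupI monoidI)?; (unfold assms(2-6))?)
      (auto simp: a_assoc m_assoc l_distr r_distr intro: a_comm l_neg)
qed

text \<open>The algebras are noncommutative, so compatibility with scalars has to be required in
  each factor separately.\<close>

locale assoc_algebra = module k A + A: ring A
  for k :: "('k, 'x) ring_scheme" and A :: "('k, 'a, 'y) module_scheme" (structure) +
  assumes smult_mult_left: "\<lbrakk>c \<in> carrier k; a \<in> carrier A; b \<in> carrier A\<rbrakk> \<Longrightarrow>
      (c \<odot> a) \<otimes> b = c \<odot> (a \<otimes> b)"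
    and smult_mult_right: "\<lbrakk>c \<in> carrier k; a \<in> carrier A; b \<in> carrier A\<rbrakk> \<Longrightarrow>
      a \<otimes> (c \<odot> b) = c \<odot> (a \<otimes> b)"

text \<open>Nothing is required outside the carrier, so such maps are compared on carrier elements
  only.\<close>

definition linear_maps ::
  "('k, 'x) ring_scheme \<Rightarrow> ('k, 'a, 'y) module_scheme \<Rightarrow> ('k, 'b, 'z) module_scheme \<Rightarrow> ('a \<Rightarrow> 'b) set"
  where "linear_maps k M N = {T. (\<forall>x\<in>carrier M. T x \<in> carrier N) \<and>
    (\<forall>x\<in>carrier M. \<forall>y\<in>carrier M. T (x \<oplus>\<^bsub>M\<^esub> y) = T x \<oplus>\<^bsub>N\<^esub> T y) \<and>
    (\<forall>c\<in>carrier k. \<forall>x\<in>carrier M. T (c \<odot>\<^bsub>M\<^esub> x) = c \<odot>\<^bsub>N\<^esub> T x)}"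

lemma linear_mapsI:
  assumes "\<And>x. x \<in> carrier M \<Longrightarrow> T x \<in> carrier N"
    and "\<And>x y. \<lbrakk>x \<in> carrier M; y \<in> carrier M\<rbrakk> \<Longrightarrow> T (x \<oplus>\<^bsub>M\<^esub> y) = T x \<oplus>\<^bsub>N\<^esub> T y"
    and "\<And>c x. \<lbrakk>c \<in> carrier k; x \<in> carrier M\<rbrakk> \<Longrightarrow> T (c \<odot>\<^bsub>M\<^esub> x) = c \<odot>\<^bsub>N\<^esub> T x"
  shows "T \<in> linear_maps k M N"
  using assms by (auto simp: linear_maps_def)

lemma linear_mapsD:
  assumes "T \<in> linear_maps k M N"
  shows linear_maps_closed: "\<And>x. x \<in> carrier M \<Longrightarrow> T x \<in> carrier N"
    and linear_maps_add: "\<And>x y. \<lbrakk>x \<in> carrier M; y \<in> carrier M\<rbrakk> \<Longrightarrow> T (x \<oplus>\<^bsub>M\<^esub> y) = T x \<oplus>\<^bsub>N\<^esub> T y"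
    and linear_maps_smult: "\<And>c x. \<lbrakk>c \<in> carrier k; x \<in> carrier M\<rbrakk> \<Longrightarrow> T (c \<odot>\<^bsub>M\<^esub> x) = c \<odot>\<^bsub>N\<^esub> T x"
  using assms by (auto simp: linear_maps_def)

lemma linear_maps_zero:
  assumes "module k M" "module k N" "T \<in> linear_maps k M N"
  shows "T \<zero>\<^bsub>M\<^esub> = \<zero>\<^bsub>N\<^esub>"
proof -
  interpret M: module k M by fact
  interpret N: module k N by fact
  show ?thesis
    using linear_maps_add[OF assms(3), of "\<zero>\<^bsub>M\<^esub>" "\<zero>\<^bsub>M\<^esub>"]
      linear_maps_closed[OF assms(3), of "\<zero>\<^bsub>M\<^esub>"] by (simp add: N.add.l_cancel_one')
qed

lemma linear_maps_minus:
  assumes "module k M" "module k N" "T \<in> linear_maps k M N" "x \<in> carrier M"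
  shows "T (\<ominus>\<^bsub>M\<^esub> x) = \<ominus>\<^bsub>N\<^esub> T x"
proof -
  interpret M: module k M by fact
  interpret N: module k N by fact
  have "T (\<ominus>\<^bsub>M\<^esub> x) \<oplus>\<^bsub>N\<^esub> T x = \<zero>\<^bsub>N\<^esub>"
    using assms(4) linear_maps_zero[OF assms(1-3)]
    by (metis M.l_neg M.a_inv_closed linear_maps_add[OF assms(3)])
  then show ?thesis
    using assms(4) linear_maps_closed[OF assms(3)] by (metis M.a_inv_closed N.minus_equality)
qed

lemma linear_maps_diff:
  assumes "module k M" "module k N" "T \<in> linear_maps k M N" "x \<in> carrier M" "y \<in> carrier M"
  shows "T (x \<ominus>\<^bsub>M\<^esub> y) = T x \<ominus>\<^bsub>N\<^esub> T y"
proof -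
  interpret M: module k M by fact
  interpret N: module k N by fact
  show ?thesis
    using assms(4,5) by (simp add: a_minus_def linear_maps_add[OF assms(3)] linear_maps_minus[OF assms(1-3)])
qed

lemma linear_maps_finsum:
  assumes "module k M" "module k N" "T \<in> linear_maps k M N" "finite S" "\<And>s. s \<in> S \<Longrightarrow> g s \<in> carrier M"
  shows "T (finsum M g S) = finsum N (\<lambda>s. T (g s)) S"
proof -
  interpret M: module k M by fact
  interpret N: module k N by fact
  show ?thesis
    using assms(4,5)
  proof (induction S rule: finite_induct)
    case empty
    then show ?case by (simp add: linear_maps_zero[OF assms(1-3)])
  next
    case (insert a S)
    then show ?case
      by (subst M.finsum_insert; (subst N.finsum_insert)?)
        (auto simp: linear_mapsD[OF assms(3)] Pi_def)
  qed
qed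

lemma linear_maps_comp:
  assumes "S \<in> linear_maps k N P" "T \<in> linear_maps k M N"
  shows "(\<lambda>x. S (T x)) \<in> linear_maps k M P"
  using assms by (auto simp: linear_maps_def)

section \<open>Quotients\<close>

lemma quotient_algebra_simps:
  "carrier (quotient_algebra A I) = {I +>\<^bsub>A\<^esub> a | a. a \<in> carrier A}"
  "ring.add (quotient_algebra A I) = set_add A"
  "monoid.mult (quotient_algebra A I) = rcoset_mult A I"
  "monoid.one (quotient_algebra A I) = I +>\<^bsub>A\<^esub> \<one>\<^bsub>A\<^esub>"
  "ring.zero (quotient_algebra A I) = I"
  "module.smult (quotient_algebra A I) = (\<lambda>c Y. \<Union>a\<in>Y. I +>\<^bsub>A\<^esub> (c \<odot>\<^bsub>A\<^esub> a))"
  by (auto simp: quotient_algebra_def ring.extend_def module.fields_def FactRing_def A_RCOSETS_def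
    RCOSETS_def a_r_coset_def)

text \<open>A representative is chosen; \<open>induced_map_coset\<close> shows that the choice does
  not matter when \<open>T\<close> is linear and maps \<open>I\<close> into itself.\<close>

definition induced_map :: "('a, 'y) ring_scheme \<Rightarrow> 'a set \<Rightarrow> ('a \<Rightarrow> 'a) \<Rightarrow> 'a set \<Rightarrow> 'a set"
  where "induced_map N I T Y = I +>\<^bsub>N\<^esub> T (SOME y. y \<in> Y)"

text \<open>\<open>N_i\<close> is a quotient of the ideal \<open>M_i\<close>, which need not contain
  the unit. Cosets are therefore treated for modules, and quotient algebras are built on top of
  that.\<close>

locale module_with_submodule = module k N + submodule I k N
  for k (structure) and N (structure) and I
begin

sublocale abelian_subgroup I N
  by (rule abelian_subgroupI3)
    (auto simp: additive_subgroup_def subgroup_axioms abelian_group_axioms)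

lemma coset_eq_iff:
  assumes "a \<in> carrier N" "b \<in> carrier N"
  shows "I +>\<^bsub>N\<^esub> a = I +>\<^bsub>N\<^esub> b \<longleftrightarrow> a \<ominus>\<^bsub>N\<^esub> b \<in> I"
proof -
  have "I +>\<^bsub>N\<^esub> a = I +>\<^bsub>N\<^esub> b \<longleftrightarrow> a \<in> I +>\<^bsub>N\<^esub> b"
    using assms a_rcos_self a_repr_independence a_subgroup by metis
  also have "\<dots> \<longleftrightarrow> a \<ominus>\<^bsub>N\<^esub> b \<in> I"
    using assms by (simp add: a_minus_def a_rcos_module)
  finally show ?thesis .
qed

lemma coset_smult:
  assumes "c \<in> carrier k" "a \<in> carrier N"
  shows "c \<odot>\<^bsub>quotient_algebra N I\<^esub> (I +>\<^bsub>N\<^esub> a) = I +>\<^bsub>N\<^esub> (c \<odot>\<^bsub>N\<^esub> a)"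
proof -
  have "I +>\<^bsub>N\<^esub> (c \<odot>\<^bsub>N\<^esub> b) = I +>\<^bsub>N\<^esub> (c \<odot>\<^bsub>N\<^esub> a)" if b: "b \<in> I +>\<^bsub>N\<^esub> a" for b
  proof -
    have bc: "b \<in> carrier N" using b assms(2) a_r_coset_subset_G a_subset by blast
    have "b \<ominus>\<^bsub>N\<^esub> a \<in> I" using b bc assms(2) by (simp add: a_minus_def a_rcos_module)
    then have "c \<odot>\<^bsub>N\<^esub> (b \<ominus>\<^bsub>N\<^esub> a) \<in> I" using assms(1) by simp
    moreover have "c \<odot>\<^bsub>N\<^esub> (b \<ominus>\<^bsub>N\<^esub> a) = c \<odot>\<^bsub>N\<^esub> b \<ominus>\<^bsub>N\<^esub> c \<odot>\<^bsub>N\<^esub> a"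
      using assms bc by (simp add: a_minus_def smult_r_distr smult_r_minus)
    ultimately show ?thesis using assms bc by (simp add: coset_eq_iff)
  qed
  moreover have "a \<in> I +>\<^bsub>N\<^esub> a" using assms(2) by (simp add: a_rcos_self)
  ultimately show ?thesis unfolding quotient_algebra_simps by blast
qed

lemma coset_add:
  assumes "a \<in> carrier N" "b \<in> carrier N"
  shows "(I +>\<^bsub>N\<^esub> a) \<oplus>\<^bsub>quotient_algebra N I\<^esub> (I +>\<^bsub>N\<^esub> b) = I +>\<^bsub>N\<^esub> (a \<oplus>\<^bsub>N\<^esub> b)"
  using assms by (simp add: quotient_algebra_simps a_rcos_sum)

lemma coset_zero: "\<zero>\<^bsub>quotient_algebra N I\<^esub> = I +>\<^bsub>N\<^esub> \<zero>\<^bsub>N\<^esub>"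
  by (metis a_rcos_const quotient_algebra_simps(5) additive_subgroup.zero_closed is_additive_subgroup)

lemma coset_in_quotient: "a \<in> carrier N \<Longrightarrow> I +>\<^bsub>N\<^esub> a \<in> carrier (quotient_algebra N I)"
  by (auto simp: quotient_algebra_simps)

lemma quotient_cases:
  assumes "Y \<in> carrier (quotient_algebra N I)"
  obtains a where "a \<in> carrier N" "Y = I +>\<^bsub>N\<^esub> a"
  using assms by (auto simp: quotient_algebra_simps)

lemmas coset_simps = coset_add coset_zero coset_smult coset_in_quotient

lemma quotient_abelian_group: "abelian_group (quotient_algebra N I)"
proof (rule abelian_groupI)
  fix x assume "x \<in> carrier (quotient_algebra N I)"
  then obtain a where a: "a \<in> carrier N" "x = I +>\<^bsub>N\<^esub> a" by (rule quotient_cases)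
  show "\<exists>y\<in>carrier (quotient_algebra N I). y \<oplus>\<^bsub>quotient_algebra N I\<^esub> x = \<zero>\<^bsub>quotient_algebra N I\<^esub>"
    by (rule bexI[of _ "I +>\<^bsub>N\<^esub> (\<ominus>\<^bsub>N\<^esub> a)"]) (use a in \<open>auto simp: coset_simps l_neg\<close>)
qed (auto elim!: quotient_cases simp: coset_simps M.a_ac)

lemma quotient_module: "module k (quotient_algebra N I)"
  by (rule moduleI[OF R.is_cring quotient_abelian_group])
    (auto elim!: quotient_cases simp: coset_simps smult_l_distr smult_r_distr smult_assoc1)

lemma induced_map_coset:
  assumes "T \<in> linear_maps k N N" "\<And>x. x \<in> I \<Longrightarrow> T x \<in> I" "a \<in> carrier N"
  shows "induced_map N I T (I +>\<^bsub>N\<^esub> a) = I +>\<^bsub>N\<^esub> T a"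
proof -
  define b where "b = (SOME y. y \<in> I +>\<^bsub>N\<^esub> a)"
  have b: "b \<in> I +>\<^bsub>N\<^esub> a" unfolding b_def using a_rcos_self[OF assms(3)] by (rule someI)
  have bc: "b \<in> carrier N" using b assms(3) a_r_coset_subset_G a_subset by blast
  have "T (b \<ominus>\<^bsub>N\<^esub> a) \<in> I" using b bc assms(2,3) by (simp add: a_minus_def a_rcos_module)
  then have "T b \<ominus>\<^bsub>N\<^esub> T a \<in> I"
    using bc assms(3) by (simp add: linear_maps_diff[OF module_axioms module_axioms assms(1)])
  then show ?thesis
    using bc assms(3) by (simp add: induced_map_def b_def[symmetric] coset_eq_iff linear_maps_closed[OF assms(1)])
qed

lemma induced_map_linear:
  assumes "T \<in> linear_maps k N N" "\<And>x. x \<in> I \<Longrightarrow> T x \<in> I"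
  shows "induced_map N I T \<in> linear_maps k (quotient_algebra N I) (quotient_algebra N I)"
  by (rule linear_mapsI)
    (auto elim!: quotient_cases simp: coset_simps induced_map_coset[OF assms] linear_mapsD[OF assms(1)])

end

text \<open>The unit turns a scalar \<open>c\<close> into the algebra element
  \<open>c \<odot> \<one>\<close>, so absorbing products implies absorbing scalars.\<close>

lemma (in assoc_algebra) ideal_submodule:
  assumes "ideal I A"
  shows "submodule I k A"
proof -
  interpret ideal I A by fact
  have "c \<odot> x \<in> I" if "c \<in> carrier k" "x \<in> I" for c x
  proof -
    have "c \<odot> x = (c \<odot> \<one>) \<otimes> x"
      using that by (simp add: smult_mult_left)
    then show ?thesis using that I_l_closed by simp
  qed
  then show ?thesis
    by (simp add: submodule_def submodule_axioms_def a_subgroup)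
qed

lemma (in assoc_algebra) ideal_module_with_submodule:
  "ideal I A \<Longrightarrow> module_with_submodule k A I"
  by (simp add: module_with_submodule_def module_axioms ideal_submodule)

lemma (in assoc_algebra) quotient_assoc_algebra:
  assumes "ideal I A"
  shows "assoc_algebra k (quotient_algebra A I)"
proof -
  interpret I: ideal I A by fact
  interpret module_with_submodule k A I by (rule ideal_module_with_submodule) fact
  have r: "ring (quotient_algebra A I)"
    by (rule ring_cong[OF I.quotient_is_ring])
      (auto simp: quotient_algebra_simps FactRing_def A_RCOSETS_def RCOSETS_def a_r_coset_def)
  have m: "(I +> a) \<otimes>\<^bsub>quotient_algebra A I\<^esub> (I +> b) = I +> (a \<otimes> b)"
    if "a \<in> carrier A" "b \<in> carrier A" for a b
    using that by (simp add: quotient_algebra_simps I.rcoset_mult_add)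
  show ?thesis
    unfolding assoc_algebra_def assoc_algebra_axioms_def
    using r quotient_module by (auto elim!: quotient_cases simp: coset_simps m smult_mult_left smult_mult_right)
qed

lemma (in assoc_algebra) coset_mult:
  assumes "ideal I A" "a \<in> carrier A" "b \<in> carrier A"
  shows "(I +> a) \<otimes>\<^bsub>quotient_algebra A I\<^esub> (I +> b) = I +> (a \<otimes> b)"
proof -
  interpret I: ideal I A by fact
  show ?thesis using assms by (simp add: quotient_algebra_simps I.rcoset_mult_add)
qed

section \<open>Monoid algebras\<close>

text \<open>A monomial together with its coefficient. Every element is a finite sum of these, so
  \<open>F_induct\<close> needs one additive step and no separate scaling step.\<close>

definition single :: "('k, 'x) ring_scheme \<Rightarrow> 'm \<Rightarrow> 'k \<Rightarrow> 'm \<Rightarrow> 'k"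
  where "single k u c = (\<lambda>m. if m = u then c else \<zero>\<^bsub>k\<^esub>)"

lemma basis_elem_single: "basis_elem k u = single k u \<one>\<^bsub>k\<^esub>"
  by (simp add: basis_elem_def single_def)

definition linear_extension ::
  "('k, 'x) ring_scheme \<Rightarrow> ('k, 'a, 'y) module_scheme \<Rightarrow> ('m \<Rightarrow> 'a) \<Rightarrow> ('m \<Rightarrow> 'k) \<Rightarrow> 'a"
  where "linear_extension k N \<beta> f = (\<Oplus>\<^bsub>N\<^esub>u\<in>{u. f u \<noteq> \<zero>\<^bsub>k\<^esub>}. f u \<odot>\<^bsub>N\<^esub> \<beta> u)"

text \<open>Sums over the supports of different functions become comparable once they run over a
  common finite set, the extra terms being zero.\<close>

lemma (in abelian_monoid) finsum_superset:
  assumes "finite S" "A \<subseteq> S" "\<And>u. u \<in> S - A \<Longrightarrow> g u = \<zero>" "\<And>u. u \<in> A \<Longrightarrow> g u \<in> carrier G"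
  shows "finsum G g A = finsum G g S"
proof -
  have "g u \<in> carrier G" if "u \<in> S" for u
    using that assms(3,4) by (cases "u \<in> A") auto
  then show ?thesis
    using assms(1-3) by (intro add.finprod_mono_neutral_cong_left) auto
qed

lemma (in abelian_monoid) finsum_single:
  assumes "finite S" "a \<in> S" "\<And>u. u \<in> S \<Longrightarrow> u \<noteq> a \<Longrightarrow> g u = \<zero>" "g a \<in> carrier G"
  shows "finsum G g S = g a"
proof -
  have "finsum G g S = finsum G g {a}"
    using assms by (intro finsum_superset[symmetric]) auto
  then show ?thesis using assms(4) by simp
qed

lemma (in abelian_monoid) finsum_finsum_add:
  assumes "\<And>u v. \<lbrakk>u \<in> S; v \<in> T\<rbrakk> \<Longrightarrow> g u v \<in> carrier G" "\<And>u v. \<lbrakk>u \<in> S; v \<in> T\<rbrakk> \<Longrightarrow> h u v \<in> carrier G"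
    and "\<And>u v. \<lbrakk>u \<in> S; v \<in> T\<rbrakk> \<Longrightarrow> k u v = g u v \<oplus> h u v"
  shows "(\<Oplus>u\<in>S. \<Oplus>v\<in>T. k u v) = (\<Oplus>u\<in>S. \<Oplus>v\<in>T. g u v) \<oplus> (\<Oplus>u\<in>S. \<Oplus>v\<in>T. h u v)"
proof -
  have "(\<Oplus>v\<in>T. k u v) = (\<Oplus>v\<in>T. g u v) \<oplus> (\<Oplus>v\<in>T. h u v)" if "u \<in> S" for u
  proof -
    have "(\<Oplus>v\<in>T. k u v) = (\<Oplus>v\<in>T. g u v \<oplus> h u v)"
      using assms that by (intro finsum_cong') auto
    then show ?thesis
      using assms that by (simp add: finsum_addf Pi_def)
  qed
  then have "(\<Oplus>u\<in>S. \<Oplus>v\<in>T. k u v) = (\<Oplus>u\<in>S. (\<Oplus>v\<in>T. g u v) \<oplus> (\<Oplus>v\<in>T. h u v))"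
    using assms by (intro finsum_cong') (auto intro!: finsum_closed)
  then show ?thesis
    using assms by (simp add: finsum_addf Pi_def finsum_closed)
qed

text \<open>The free algebra, the tensor product and the base change are all monoid algebras or
  quotients of them, over \<open>k\<close> or over the integers.\<close>

locale monoid_alg = R?: cring k + Mon: monoid M
  for k :: "('k, 'x) ring_scheme" (structure) and M :: "('m, 'z) monoid_scheme"
begin

abbreviation "F \<equiv> monoid_algebra k M"
abbreviation supp :: "('m \<Rightarrow> 'k) \<Rightarrow> 'm set" where "supp f \<equiv> {m. f m \<noteq> \<zero>}"

lemma F_simps:
  "ring.add F = (\<lambda>f g m. f m \<oplus> g m)" "ring.zero F = (\<lambda>m. \<zero>)"
  "module.smult F = (\<lambda>c f m. c \<otimes> f m)" "monoid.one F = single k \<one>\<^bsub>M\<^esub> \<one>"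
  by (simp_all add: monoid_algebra_def single_def)

lemma F_carrier:
  "f \<in> carrier F \<longleftrightarrow> (\<forall>m. f m \<in> carrier k) \<and> supp f \<subseteq> carrier M \<and> finite (supp f)"
  by (simp add: monoid_algebra_def)

lemma F_D:
  assumes "f \<in> carrier F"
  shows F_value: "f m \<in> carrier k" and F_supp: "supp f \<subseteq> carrier M" and F_finite: "finite (supp f)"
  using assms by (auto simp: F_carrier)

lemma F_add_closed:
  assumes "f \<in> carrier F" "g \<in> carrier F"
  shows "f \<oplus>\<^bsub>F\<^esub> g \<in> carrier F"
proof -
  have "supp (\<lambda>m. f m \<oplus> g m) \<subseteq> supp f \<union> supp g" by auto
  moreover have "supp f \<union> supp g \<subseteq> carrier M" "finite (supp f \<union> supp g)"
    using F_D[OF assms(1)] F_D[OF assms(2)] by auto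
  moreover have "f m \<oplus> g m \<in> carrier k" for m
    using F_D[OF assms(1)] F_D[OF assms(2)] by simp
  ultimately show ?thesis
    unfolding F_carrier F_simps by (meson finite_subset order_trans)
qed

lemma F_smult_closed: "\<lbrakk>c \<in> carrier k; f \<in> carrier F\<rbrakk> \<Longrightarrow> c \<odot>\<^bsub>F\<^esub> f \<in> carrier F"
  unfolding F_carrier F_simps
  by (auto intro: finite_subset[where B = "supp f"])

lemma single_closed [simp, intro]: "\<lbrakk>u \<in> carrier M; c \<in> carrier k\<rbrakk> \<Longrightarrow> single k u c \<in> carrier F"
  unfolding F_carrier by (auto simp: single_def intro: finite_subset[where B = "{u}"])

lemma F_zero_closed: "\<zero>\<^bsub>F\<^esub> \<in> carrier F"
  unfolding F_carrier F_simps by auto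

lemma F_abelian_group: "abelian_group F"
proof (rule abelian_groupI)
  fix f assume f: "f \<in> carrier F"
  have "(\<lambda>m. \<ominus> f m) \<in> carrier F"
    using f unfolding F_carrier
    by (auto intro: finite_subset[where B = "supp f"])
  moreover have "(\<lambda>m. \<ominus> f m) \<oplus>\<^bsub>F\<^esub> f = \<zero>\<^bsub>F\<^esub>"
    using f by (auto simp: F_simps F_value l_neg)
  ultimately show "\<exists>g\<in>carrier F. g \<oplus>\<^bsub>F\<^esub> f = \<zero>\<^bsub>F\<^esub>" by blast
  fix g h assume g: "g \<in> carrier F" and h: "h \<in> carrier F"
  show "f \<oplus>\<^bsub>F\<^esub> g \<oplus>\<^bsub>F\<^esub> h = f \<oplus>\<^bsub>F\<^esub> (g \<oplus>\<^bsub>F\<^esub> h)" "f \<oplus>\<^bsub>F\<^esub> g = g \<oplus>\<^bsub>F\<^esub> f" "\<zero>\<^bsub>F\<^esub> \<oplus>\<^bsub>F\<^esub> f = f"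
    using f g h by (simp_all add: F_simps F_value a_ac)
qed (simp_all add: F_add_closed F_zero_closed)

lemma F_module: "module k F"
  by (rule moduleI[OF is_cring F_abelian_group F_smult_closed])
    (auto simp: F_simps F_value l_distr r_distr m_assoc)

interpretation F: module k F by (rule F_module)

text \<open>Removing one point of the support lowers its size. With distributivity this reduces
  multiplicative identities to monomials, so that double sums need not be rearranged.\<close>

lemma F_induct [consumes 1, case_names zero add]:
  assumes "f \<in> carrier F" "P \<zero>\<^bsub>F\<^esub>"
    "\<And>f u c. \<lbrakk>f \<in> carrier F; u \<in> carrier M; c \<in> carrier k; P f\<rbrakk> \<Longrightarrow> P (single k u c \<oplus>\<^bsub>F\<^esub> f)"
  shows "P f"
  using assms(1)
proof (induction "card (supp f)" arbitrary: f rule: less_induct)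
  case less
  show ?case
  proof (cases "supp f = {}")
    case True
    then have "f m = \<zero>" for m by blast
    then have "f = \<zero>\<^bsub>F\<^esub>" unfolding F_simps by (rule ext)
    then show ?thesis using assms(2) by simp
  next
    case False
    then obtain u where u: "u \<in> supp f" by blast
    define g where "g = f(u := \<zero>)"
    have sg: "supp g = supp f - {u}" by (auto simp: g_def)
    have g: "g \<in> carrier F"
      unfolding F_carrier sg using F_D[OF less.prems] by (auto simp: g_def)
    have "card (supp g) < card (supp f)"
      using u F_finite[OF less.prems] unfolding sg by (rule card_Diff1_less[rotated])
    then have "P g" using less.hyps g by blast
    moreover have "f = single k u (f u) \<oplus>\<^bsub>F\<^esub> g"
      using F_value[OF less.prems] by (auto simp: F_simps single_def g_def)
    ultimately show ?thesis
      using assms(3)[OF g, of u "f u"] u F_supp[OF less.prems] F_value[OF less.prems] by auto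
  qed
qed

text \<open>The product is defined by sums over exact supports, which change under cancellation in a
  sum; distributivity needs sums over a fixed finite superset.\<close>

lemma mult_eq:
  assumes "f \<in> carrier F" "g \<in> carrier F" "finite S" "supp f \<subseteq> S" "finite T" "supp g \<subseteq> T"
  shows "(f \<otimes>\<^bsub>F\<^esub> g) m = (\<Oplus>u\<in>S. \<Oplus>v\<in>T. if u \<otimes>\<^bsub>M\<^esub> v = m then f u \<otimes> g v else \<zero>)"
proof -
  let ?h = "\<lambda>u v. if u \<otimes>\<^bsub>M\<^esub> v = m then f u \<otimes> g v else \<zero>"
  have inner: "(\<Oplus>v\<in>supp g. ?h u v) = (\<Oplus>v\<in>T. ?h u v)" for u
    using assms by (intro finsum_superset) (auto simp: F_value)
  have "(f \<otimes>\<^bsub>F\<^esub> g) m = (\<Oplus>u\<in>supp f. \<Oplus>v\<in>supp g. ?h u v)"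
    by (simp add: monoid_algebra_def)
  also have "\<dots> = (\<Oplus>u\<in>supp f. \<Oplus>v\<in>T. ?h u v)"
    by (simp add: inner)
  also have "\<dots> = (\<Oplus>u\<in>S. \<Oplus>v\<in>T. ?h u v)"
    using assms by (intro finsum_superset finsum_closed) (auto simp: F_value intro!: add.finprod_one_eqI)
  finally show ?thesis .
qed

lemma F_mult_closed:
  assumes "f \<in> carrier F" "g \<in> carrier F"
  shows "f \<otimes>\<^bsub>F\<^esub> g \<in> carrier F"
proof -
  have v: "(f \<otimes>\<^bsub>F\<^esub> g) m = (\<Oplus>u\<in>supp f. \<Oplus>v\<in>supp g. if u \<otimes>\<^bsub>M\<^esub> v = m then f u \<otimes> g v else \<zero>)" for m
    using assms by (intro mult_eq) (auto simp: F_finite)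
  have "(f \<otimes>\<^bsub>F\<^esub> g) m \<in> carrier k" for m
    unfolding v using assms by (auto intro!: finsum_closed simp: F_value)
  moreover have "supp (f \<otimes>\<^bsub>F\<^esub> g) \<subseteq> (\<lambda>(u, v). u \<otimes>\<^bsub>M\<^esub> v) ` (supp f \<times> supp g)"
  proof (rule ccontr)
    assume "\<not> ?thesis"
    then obtain m where m: "(f \<otimes>\<^bsub>F\<^esub> g) m \<noteq> \<zero>" "m \<notin> (\<lambda>(u, v). u \<otimes>\<^bsub>M\<^esub> v) ` (supp f \<times> supp g)" by blast
    have "(f \<otimes>\<^bsub>F\<^esub> g) m = \<zero>"
      unfolding v using m(2) by (intro add.finprod_one_eqI) (force intro!: add.finprod_one_eqI)
    with m(1) show False by simp
  qed
  moreover have "(\<lambda>(u, v). u \<otimes>\<^bsub>M\<^esub> v) ` (supp f \<times> supp g) \<subseteq> carrier M"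
    using assms F_supp by fast
  moreover have "finite ((\<lambda>(u, v). u \<otimes>\<^bsub>M\<^esub> v) ` (supp f \<times> supp g))"
    using assms F_finite by simp
  ultimately show ?thesis unfolding F_carrier by (meson finite_subset order_trans)
qed

lemma F_l_distr:
  assumes "f \<in> carrier F" "f' \<in> carrier F" "g \<in> carrier F"
  shows "(f \<oplus>\<^bsub>F\<^esub> f') \<otimes>\<^bsub>F\<^esub> g = f \<otimes>\<^bsub>F\<^esub> g \<oplus>\<^bsub>F\<^esub> f' \<otimes>\<^bsub>F\<^esub> g"
proof
  fix m
  let ?S = "supp f \<union> supp f'" and ?T = "supp g"
  have fin: "finite ?S" "finite ?T" using assms F_finite by auto
  have "((f \<oplus>\<^bsub>F\<^esub> f') \<otimes>\<^bsub>F\<^esub> g) m =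
      (\<Oplus>u\<in>?S. \<Oplus>v\<in>?T. if u \<otimes>\<^bsub>M\<^esub> v = m then (f \<oplus>\<^bsub>F\<^esub> f') u \<otimes> g v else \<zero>)"
    using assms fin by (intro mult_eq) (auto simp: F_add_closed, auto simp: F_simps)
  also have "\<dots> = (f \<otimes>\<^bsub>F\<^esub> g) m \<oplus> (f' \<otimes>\<^bsub>F\<^esub> g) m"
    using assms fin
    by (subst finsum_finsum_add[where g = "\<lambda>u v. if u \<otimes>\<^bsub>M\<^esub> v = m then f u \<otimes> g v else \<zero>" and h = "\<lambda>u v. if u \<otimes>\<^bsub>M\<^esub> v = m then f' u \<otimes> g v else \<zero>"]) (auto simp: F_simps F_value l_distr mult_eq[where S = ?S and T = ?T])
  finally show "((f \<oplus>\<^bsub>F\<^esub> f') \<otimes>\<^bsub>F\<^esub> g) m = (f \<otimes>\<^bsub>F\<^esub> g \<oplus>\<^bsub>F\<^esub> f' \<otimes>\<^bsub>F\<^esub> g) m"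
    by (simp add: F_simps)
qed

lemma F_r_distr:
  assumes "f \<in> carrier F" "f' \<in> carrier F" "g \<in> carrier F"
  shows "g \<otimes>\<^bsub>F\<^esub> (f \<oplus>\<^bsub>F\<^esub> f') = g \<otimes>\<^bsub>F\<^esub> f \<oplus>\<^bsub>F\<^esub> g \<otimes>\<^bsub>F\<^esub> f'"
proof
  fix m
  let ?S = "supp f \<union> supp f'" and ?T = "supp g"
  have fin: "finite ?S" "finite ?T" using assms F_finite by auto
  have "(g \<otimes>\<^bsub>F\<^esub> (f \<oplus>\<^bsub>F\<^esub> f')) m =
      (\<Oplus>u\<in>?T. \<Oplus>v\<in>?S. if u \<otimes>\<^bsub>M\<^esub> v = m then g u \<otimes> (f \<oplus>\<^bsub>F\<^esub> f') v else \<zero>)"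
    using assms fin by (intro mult_eq) (auto simp: F_add_closed, auto simp: F_simps)
  also have "\<dots> = (g \<otimes>\<^bsub>F\<^esub> f) m \<oplus> (g \<otimes>\<^bsub>F\<^esub> f') m"
    using assms fin
    by (subst finsum_finsum_add[where g = "\<lambda>u v. if u \<otimes>\<^bsub>M\<^esub> v = m then g u \<otimes> f v else \<zero>" and h = "\<lambda>u v. if u \<otimes>\<^bsub>M\<^esub> v = m then g u \<otimes> f' v else \<zero>"]) (auto simp: F_simps F_value r_distr mult_eq[where S = ?T and T = ?S])
  finally show "(g \<otimes>\<^bsub>F\<^esub> (f \<oplus>\<^bsub>F\<^esub> f')) m = (g \<otimes>\<^bsub>F\<^esub> f \<oplus>\<^bsub>F\<^esub> g \<otimes>\<^bsub>F\<^esub> f') m"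
    by (simp add: F_simps)
qed

lemma F_l_null: "g \<in> carrier F \<Longrightarrow> \<zero>\<^bsub>F\<^esub> \<otimes>\<^bsub>F\<^esub> g = \<zero>\<^bsub>F\<^esub>"
  by (rule ext, subst mult_eq[where S = "{}" and T = "supp g"])
    (auto simp: F_finite, auto simp: F_simps)

lemma F_r_null: "g \<in> carrier F \<Longrightarrow> g \<otimes>\<^bsub>F\<^esub> \<zero>\<^bsub>F\<^esub> = \<zero>\<^bsub>F\<^esub>"
  by (rule ext, subst mult_eq[where T = "{}" and S = "supp g"])
    (auto simp: F_finite, auto simp: F_simps)

lemma single_smult: "c \<in> carrier k \<Longrightarrow> c \<odot>\<^bsub>F\<^esub> single k u d = single k u (c \<otimes> d)"
  by (auto simp: F_simps single_def)

lemma single_mult: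
  assumes "u \<in> carrier M" "v \<in> carrier M" "c \<in> carrier k" "d \<in> carrier k"
  shows "single k u c \<otimes>\<^bsub>F\<^esub> single k v d = single k (u \<otimes>\<^bsub>M\<^esub> v) (c \<otimes> d)"
proof
  fix m
  have "(single k u c \<otimes>\<^bsub>F\<^esub> single k v d) m =
      (\<Oplus>u'\<in>{u}. \<Oplus>v'\<in>{v}. if u' \<otimes>\<^bsub>M\<^esub> v' = m then single k u c u' \<otimes> single k v d v' else \<zero>)"
    using assms by (intro mult_eq) (auto, auto simp: single_def split: if_splits)
  also have "\<dots> = single k (u \<otimes>\<^bsub>M\<^esub> v) (c \<otimes> d) m"
    using assms by (simp add: single_def)
  finally show "(single k u c \<otimes>\<^bsub>F\<^esub> single k v d) m = single k (u \<otimes>\<^bsub>M\<^esub> v) (c \<otimes> d) m" .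
qed

text \<open>Distributivity reduces the claim to monomials, where it is associativity in
  \<open>M\<close> and in \<open>k\<close>. The factors are decomposed one at a time, beginning with
  \<open>h\<close>.\<close>

lemma F_assoc:
  assumes "f \<in> carrier F" "g \<in> carrier F" "h \<in> carrier F"
  shows "f \<otimes>\<^bsub>F\<^esub> g \<otimes>\<^bsub>F\<^esub> h = f \<otimes>\<^bsub>F\<^esub> (g \<otimes>\<^bsub>F\<^esub> h)"
proof -
  have 1: "single k u a \<otimes>\<^bsub>F\<^esub> single k v b \<otimes>\<^bsub>F\<^esub> h = single k u a \<otimes>\<^bsub>F\<^esub> (single k v b \<otimes>\<^bsub>F\<^esub> h)"
    if "u \<in> carrier M" "a \<in> carrier k" "v \<in> carrier M" "b \<in> carrier k" for u v a b
    using assms(3)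
  proof (induction rule: F_induct)
    case zero
    then show ?case using that by (simp add: F_r_null F_mult_closed)
  next
    case (add h w c)
    then show ?case using that
      by (simp add: F_r_distr F_mult_closed single_mult m_assoc Mon.m_assoc)
  qed
  have 2: "single k u a \<otimes>\<^bsub>F\<^esub> g \<otimes>\<^bsub>F\<^esub> h = single k u a \<otimes>\<^bsub>F\<^esub> (g \<otimes>\<^bsub>F\<^esub> h)"
    if "u \<in> carrier M" "a \<in> carrier k" for u a
    using assms(2)
  proof (induction rule: F_induct)
    case zero
    then show ?case using that assms by (simp add: F_r_null F_l_null F_mult_closed)
  next
    case (add g w c)
    then show ?case using that assms
      by (simp add: F_r_distr F_l_distr F_mult_closed 1)
  qed
  show ?thesis using assms(1)
  proof (induction rule: F_induct)
    case zero
    then show ?case using assms by (simp add: F_l_null F_mult_closed)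
  next
    case (add g w c)
    then show ?case using assms
      by (simp add: F_r_distr F_l_distr F_mult_closed 2)
  qed
qed

lemma F_l_one: "f \<in> carrier F \<Longrightarrow> \<one>\<^bsub>F\<^esub> \<otimes>\<^bsub>F\<^esub> f = f"
proof (induction rule: F_induct)
  case zero
  then show ?case by (simp add: F_r_null F_simps(4))
next
  case (add f u c)
  then show ?case by (simp add: F_r_distr F_simps(4) single_mult)
qed

lemma F_r_one: "f \<in> carrier F \<Longrightarrow> f \<otimes>\<^bsub>F\<^esub> \<one>\<^bsub>F\<^esub> = f"
proof (induction rule: F_induct)
  case zero
  then show ?case by (simp add: F_l_null F_simps(4))
next
  case (add f u c)
  then show ?case by (simp add: F_l_distr F_simps(4) single_mult)
qed

lemma F_ring: "ring F"
proof (rule ringI[OF F_abelian_group])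
  show "Group.monoid F"
    by (rule monoidI) (simp_all add: F_mult_closed F_assoc F_l_one F_r_one, simp add: F_simps)
qed (simp_all add: F_l_distr F_r_distr)

text \<open>Scalars are multiples of the unit monomial and commute with everything; compatibility of
  scalars with the product thereby becomes associativity.\<close>

lemma smult_via_single:
  assumes "c \<in> carrier k" "f \<in> carrier F"
  shows "c \<odot>\<^bsub>F\<^esub> f = single k \<one>\<^bsub>M\<^esub> c \<otimes>\<^bsub>F\<^esub> f" "c \<odot>\<^bsub>F\<^esub> f = f \<otimes>\<^bsub>F\<^esub> single k \<one>\<^bsub>M\<^esub> c"
  using assms(2,1)
  by (induction rule: F_induct)
    (auto simp: F_l_null F_r_null F_l_distr F_r_distr F.smult_r_distr single_mult single_smult m_comm)

lemma F_assoc_algebra: "assoc_algebra k F"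
  unfolding assoc_algebra_def assoc_algebra_axioms_def
proof (intro conjI allI impI F_module F_ring)
  fix c f g assume a: "c \<in> carrier k" "f \<in> carrier F" "g \<in> carrier F"
  show "(c \<odot>\<^bsub>F\<^esub> f) \<otimes>\<^bsub>F\<^esub> g = c \<odot>\<^bsub>F\<^esub> (f \<otimes>\<^bsub>F\<^esub> g)"
    using a by (simp add: smult_via_single(1) F_assoc F_mult_closed)
  show "f \<otimes>\<^bsub>F\<^esub> (c \<odot>\<^bsub>F\<^esub> g) = c \<odot>\<^bsub>F\<^esub> (f \<otimes>\<^bsub>F\<^esub> g)"
    using a by (simp add: smult_via_single(2) F_assoc[symmetric] F_mult_closed)
qed

lemma linear_extension_linear:
  assumes "module k N" "\<And>u. u \<in> carrier M \<Longrightarrow> \<beta> u \<in> carrier N"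
  shows "linear_extension k N \<beta> \<in> linear_maps k F N"
proof -
  interpret N: module k N by fact
  have eq: "linear_extension k N \<beta> f = (\<Oplus>\<^bsub>N\<^esub>u\<in>S. f u \<odot>\<^bsub>N\<^esub> \<beta> u)"
    if "f \<in> carrier F" "finite S" "supp f \<subseteq> S" "S \<subseteq> carrier M" for f S
    unfolding linear_extension_def
    using that assms(2) by (intro N.finsum_superset) (auto simp: F_value)
  show ?thesis
  proof (rule linear_mapsI)
    fix f assume f: "f \<in> carrier F"
    show "linear_extension k N \<beta> f \<in> carrier N"
      using f F_supp[OF f] assms(2) unfolding linear_extension_def
      by (intro N.finsum_closed) (auto simp: F_value)
    fix g assume g: "g \<in> carrier F"
    let ?S = "supp f \<union> supp g"
    have S: "finite ?S" "?S \<subseteq> carrier M" using f g F_supp F_finite by auto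
    have "linear_extension k N \<beta> (f \<oplus>\<^bsub>F\<^esub> g) = (\<Oplus>\<^bsub>N\<^esub>u\<in>?S. (f \<oplus>\<^bsub>F\<^esub> g) u \<odot>\<^bsub>N\<^esub> \<beta> u)"
      using f g S by (intro eq F_add_closed) (auto simp: F_simps)
    also have "\<dots> = (\<Oplus>\<^bsub>N\<^esub>u\<in>?S. f u \<odot>\<^bsub>N\<^esub> \<beta> u \<oplus>\<^bsub>N\<^esub> g u \<odot>\<^bsub>N\<^esub> \<beta> u)"
      using S f g assms(2) by (intro N.finsum_cong') (auto simp: F_simps F_value N.smult_l_distr)
    also have "\<dots> = linear_extension k N \<beta> f \<oplus>\<^bsub>N\<^esub> linear_extension k N \<beta> g"
      using S f g assms(2) by (subst N.finsum_addf) (auto simp: F_value eq[of _ ?S])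
    finally show "linear_extension k N \<beta> (f \<oplus>\<^bsub>F\<^esub> g) = linear_extension k N \<beta> f \<oplus>\<^bsub>N\<^esub> linear_extension k N \<beta> g" .
  next
    fix c f assume c: "c \<in> carrier k" and f: "f \<in> carrier F"
    have S: "finite (supp f)" "supp f \<subseteq> carrier M" using f F_supp F_finite by auto
    have "linear_extension k N \<beta> (c \<odot>\<^bsub>F\<^esub> f) = (\<Oplus>\<^bsub>N\<^esub>u\<in>supp f. (c \<odot>\<^bsub>F\<^esub> f) u \<odot>\<^bsub>N\<^esub> \<beta> u)"
      using c f S by (intro eq F_smult_closed) (auto simp: F_simps)
    also have "\<dots> = (\<Oplus>\<^bsub>N\<^esub>u\<in>supp f. c \<odot>\<^bsub>N\<^esub> (f u \<odot>\<^bsub>N\<^esub> \<beta> u))"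
      using S c f assms(2) by (intro N.finsum_cong') (auto simp: F_simps F_value N.smult_assoc1)
    also have "\<dots> = c \<odot>\<^bsub>N\<^esub> linear_extension k N \<beta> f"
      using S c f assms(2) unfolding linear_extension_def
      by (subst N.finsum_smult_ldistr) (auto simp: F_value)
    finally show "linear_extension k N \<beta> (c \<odot>\<^bsub>F\<^esub> f) = c \<odot>\<^bsub>N\<^esub> linear_extension k N \<beta> f" .
  qed
qed

lemma linear_extension_single:
  assumes "module k N" "\<beta> u \<in> carrier N" "c \<in> carrier k"
  shows "linear_extension k N \<beta> (single k u c) = c \<odot>\<^bsub>N\<^esub> \<beta> u"
proof -
  interpret N: module k N by fact
  have "linear_extension k N \<beta> (single k u c) = (\<Oplus>\<^bsub>N\<^esub>v\<in>{u}. single k u c v \<odot>\<^bsub>N\<^esub> \<beta> v)"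
    unfolding linear_extension_def
    using assms by (intro N.finsum_superset) (auto simp: single_def split: if_splits)
  then show ?thesis using assms by (simp add: single_def)
qed

lemma additive_eqI:
  assumes "f \<in> carrier F" "G \<zero>\<^bsub>F\<^esub> = H \<zero>\<^bsub>F\<^esub>"
    and "\<And>f g. \<lbrakk>f \<in> carrier F; g \<in> carrier F\<rbrakk> \<Longrightarrow> G (f \<oplus>\<^bsub>F\<^esub> g) = G f \<oplus>\<^bsub>N\<^esub> G g"
    and "\<And>f g. \<lbrakk>f \<in> carrier F; g \<in> carrier F\<rbrakk> \<Longrightarrow> H (f \<oplus>\<^bsub>F\<^esub> g) = H f \<oplus>\<^bsub>N\<^esub> H g"
    and "\<And>u c. \<lbrakk>u \<in> carrier M; c \<in> carrier k\<rbrakk> \<Longrightarrow> G (single k u c) = H (single k u c)"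
  shows "G f = H f"
  using assms(1) by (induction rule: F_induct) (simp_all add: assms(2-5))

lemma linear_eqI:
  assumes "module k N" "G \<in> linear_maps k F N" "H \<in> linear_maps k F N"
    and "\<And>u. u \<in> carrier M \<Longrightarrow> G (basis_elem k u) = H (basis_elem k u)" "f \<in> carrier F"
  shows "G f = H f"
proof (rule additive_eqI[where N = N])
  fix u c assume uc: "u \<in> carrier M" "c \<in> carrier k"
  have "single k u c = c \<odot>\<^bsub>F\<^esub> basis_elem k u"
    using uc by (simp add: basis_elem_single single_smult)
  then show "G (single k u c) = H (single k u c)"
    using uc assms(4) by (simp add: linear_maps_smult[OF assms(2)] linear_maps_smult[OF assms(3)]
        basis_elem_single)
qed (use assms linear_maps_zero[OF F_module assms(1,2)] linear_maps_zero[OF F_module assms(1,3)] linear_mapsD[OF assms(2)] linear_mapsD[OF assms(3)] in auto)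

end

section \<open>The integral Weyl algebra\<close>

lemma mult_x_pCons: "mult_x f = pCons 0 f"
  by (simp add: mult_x_def monom_Suc[where n = 0, simplified] monom_0)

lemma mult_x_add: "mult_x (f + g) = mult_x f + mult_x g"
  by (simp add: mult_x_def algebra_simps)

lemma mult_x_smult: "mult_x (smult c f) = smult c (mult_x f)"
  by (simp add: mult_x_def)

lemma divided_deriv_add: "divided_deriv j (f + g) = divided_deriv j f + divided_deriv j g"
  by (rule poly_eqI) (simp add: coeff_divided_deriv algebra_simps)

lemma divided_deriv_smult: "divided_deriv j (smult c f) = smult c (divided_deriv j f)"
  by (rule poly_eqI) (simp add: coeff_divided_deriv algebra_simps)

lemma divided_deriv_0: "divided_deriv 0 = id"
  by (rule ext, rule poly_eqI) (simp add: coeff_divided_deriv)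

lemma divided_deriv_0_right: "divided_deriv j 0 = 0"
  by (rule poly_eqI) (simp add: coeff_divided_deriv)

text \<open>On coefficients this is Pascal's rule. It is the Heisenberg relation by which
  derivatives are moved past \<open>x\<close>.\<close>

lemma divided_deriv_Suc_mult_x:
  "divided_deriv (Suc m) (mult_x f) = mult_x (divided_deriv (Suc m) f) + divided_deriv m f"
proof (rule poly_eqI)
  fix n
  show "coeff (divided_deriv (Suc m) (mult_x f)) n =
      coeff (mult_x (divided_deriv (Suc m) f) + divided_deriv m f) n"
    by (cases n) (simp_all add: mult_x_pCons coeff_divided_deriv algebra_simps)
qed

lemma divided_deriv_divided_deriv:
  "divided_deriv m (divided_deriv j f) = smult (int ((m + j) choose j)) (divided_deriv (m + j) f)"
proof (rule poly_eqI)
  fix n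
  \<comment> \<open>Both sides are the multinomial coefficient (n+m+j)! / (n! m! j!).\<close>
  have "((n + m + j) choose (m + j)) * ((m + j) choose j) = ((n + m + j) choose j) * ((n + m) choose m)"
    by (subst choose_mult) auto
  then have "int ((n + m) choose m) * int ((n + m + j) choose j) =
      int ((m + j) choose j) * int ((n + m + j) choose (m + j))"
    by (metis mult.commute of_nat_mult)
  then show "coeff (divided_deriv m (divided_deriv j f)) n =
      coeff (smult (int ((m + j) choose j)) (divided_deriv (m + j) f)) n"
    by (simp add: coeff_divided_deriv add.assoc mult.assoc[symmetric])
qed

definition weyl_monomial :: "nat \<Rightarrow> nat \<Rightarrow> int poly \<Rightarrow> int poly"
  where "weyl_monomial i j f = (mult_x ^^ i) (divided_deriv j f)"

lemma weyl_monomial_add: "weyl_monomial i j (f + g) = weyl_monomial i j f + weyl_monomial i j g"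
  unfolding weyl_monomial_def by (induction i) (simp_all add: divided_deriv_add mult_x_add)

lemma weyl_int_carrier:
  "carrier weyl_int = {T. \<exists>S a. finite S \<and> T = (\<lambda>f. \<Sum>(i, j)\<in>S. smult (a i j) (weyl_monomial i j f))}"
  by (simp add: weyl_int_def weyl_monomial_def)

lemma weyl_int_simps:
  "T \<otimes>\<^bsub>weyl_int\<^esub> S = (\<lambda>f. T (S f))" "\<one>\<^bsub>weyl_int\<^esub> = id" "\<zero>\<^bsub>weyl_int\<^esub> = (\<lambda>f. 0)"
  "T \<oplus>\<^bsub>weyl_int\<^esub> S = (\<lambda>f. T f + S f)"
  by (auto simp: weyl_int_def)

lemma weyl_int_zero: "(\<lambda>f. 0) \<in> carrier weyl_int"
  unfolding weyl_int_carrier by (auto intro: exI[of _ "{}"])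

lemma weyl_int_add_monomial:
  assumes "T \<in> carrier weyl_int"
  shows "(\<lambda>f. smult c (weyl_monomial i j f) + T f) \<in> carrier weyl_int"
proof -
  obtain S a where S: "finite S" "T = (\<lambda>f. \<Sum>(i, j)\<in>S. smult (a i j) (weyl_monomial i j f))"
    using assms by (auto simp: weyl_int_carrier)
  \<comment> \<open>The pair \<open>(i, j)\<close> may already occur in \<open>S\<close>, in which
    case \<open>c\<close> is added to its coefficient.\<close>
  define b where "b = (\<lambda>i' j'. (if (i', j') = (i, j) then c else 0) + (if (i', j') \<in> S then a i' j' else 0))"
  have "(\<Sum>(i', j')\<in>insert (i, j) S. smult (b i' j') (weyl_monomial i' j' f)) =
      smult c (weyl_monomial i j f) + T f" for f
  proof -
    have "(\<Sum>(i', j')\<in>insert (i, j) S. smult (b i' j') (weyl_monomial i' j' f)) =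
      (\<Sum>x\<in>insert (i, j) S. (if x = (i, j) then smult c (weyl_monomial i j f) else 0) +
         (if x \<in> S then case x of (i, j) \<Rightarrow> smult (a i j) (weyl_monomial i j f) else 0))"
      by (rule sum.cong) (auto simp: b_def smult_add_left split: if_splits)
    also have "\<dots> = smult c (weyl_monomial i j f) + T f"
      using S(1) by (simp add: sum.distrib S(2) sum.inter_restrict[symmetric] Int_absorb1 subset_insertI)
    finally show ?thesis .
  qed
  then show ?thesis
    using S(1) unfolding weyl_int_carrier by (intro CollectI exI[of _ "insert (i, j) S"] exI[of _ b]) simp
qed

lemma weyl_int_induct [consumes 1, case_names zero add]:
  assumes "T \<in> carrier weyl_int" "P (\<lambda>f. 0)"
    "\<And>T c i j. \<lbrakk>T \<in> carrier weyl_int; P T\<rbrakk> \<Longrightarrow> P (\<lambda>f. smult c (weyl_monomial i j f) + T f)"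
  shows "P T"
proof -
  obtain S a where S: "finite S" "T = (\<lambda>f. \<Sum>(i, j)\<in>S. smult (a i j) (weyl_monomial i j f))"
    using assms by (auto simp: weyl_int_carrier)
  have "P (\<lambda>f. \<Sum>(i, j)\<in>S. smult (a i j) (weyl_monomial i j f))"
    using S(1)
  proof (induction S rule: finite_induct)
    case empty
    then show ?case using assms(2) by simp
  next
    case (insert x S)
    obtain i j where x: "x = (i, j)" by (cases x)
    have "(\<lambda>f. \<Sum>(i, j)\<in>S. smult (a i j) (weyl_monomial i j f)) \<in> carrier weyl_int"
      using insert unfolding weyl_int_carrier by auto
    from assms(3)[OF this insert.IH, of "a i j" i j] show ?case
      using insert x by simp
  qed
  then show ?thesis using S(2) by simp
qed

lemma weyl_int_monomial: "(\<lambda>f. smult c (weyl_monomial i j f)) \<in> carrier weyl_int"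
  using weyl_int_add_monomial[OF weyl_int_zero] by simp

lemma weyl_int_add:
  assumes "T \<in> carrier weyl_int" "S \<in> carrier weyl_int"
  shows "(\<lambda>f. T f + S f) \<in> carrier weyl_int"
  using assms(1)
proof (induction rule: weyl_int_induct)
  case zero
  then show ?case using assms(2) by simp
next
  case (add T c i j)
  then show ?case
    using weyl_int_add_monomial[of "\<lambda>f. T f + S f" c i j] by (simp add: add.assoc)
qed

lemma weyl_int_smult:
  assumes "T \<in> carrier weyl_int"
  shows "(\<lambda>f. smult d (T f)) \<in> carrier weyl_int"
  using assms
proof (induction rule: weyl_int_induct)
  case zero
  then show ?case using weyl_int_zero by simp
next
  case (add T c i j)
  then show ?case
    using weyl_int_add_monomial[of "\<lambda>f. smult d (T f)" "d * c" i j] by (simp add: smult_add_right)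
qed

lemma weyl_int_additive:
  assumes "T \<in> carrier weyl_int"
  shows "T (f + g) = T f + T g"
  using assms by (induction rule: weyl_int_induct) (simp_all add: weyl_monomial_add smult_add_right)

lemma weyl_int_mult_x:
  assumes "T \<in> carrier weyl_int"
  shows "(\<lambda>f. mult_x (T f)) \<in> carrier weyl_int"
  using assms
proof (induction rule: weyl_int_induct)
  case zero
  then show ?case using weyl_int_zero by (simp add: mult_x_def)
next
  case (add T c i j)
  then show ?case
    using weyl_int_add_monomial[of "\<lambda>f. mult_x (T f)" c "Suc i" j]
    by (simp add: mult_x_add mult_x_smult weyl_monomial_def)
qed

text \<open>Normal ordering: the derivative is moved past the factors x one at a time. Each move
  leaves a second term with \<open>m\<close> lowered by one, so the induction on \<open>i\<close>
  keeps \<open>m\<close> arbitrary; at \<open>i = 0\<close> two divided derivatives merge into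
  one.\<close>

lemma weyl_int_divided_deriv:
  assumes "T \<in> carrier weyl_int"
  shows "(\<lambda>f. divided_deriv m (T f)) \<in> carrier weyl_int"
proof -
  have mon: "(\<lambda>f. divided_deriv m (weyl_monomial i j f)) \<in> carrier weyl_int" for m i j
  proof (induction i arbitrary: m)
    case 0
    then show ?case
      using weyl_int_monomial[of "int ((m + j) choose j)" 0 "m + j"]
      by (simp add: weyl_monomial_def divided_deriv_divided_deriv)
  next
    case (Suc i)
    show ?case
    proof (cases m)
      case 0
      then show ?thesis
        using weyl_int_monomial[of 1 "Suc i" j] by (simp add: divided_deriv_0)
    next
      case m: (Suc m')
      have "divided_deriv m (weyl_monomial (Suc i) j f) =
          mult_x (divided_deriv m (weyl_monomial i j f)) + divided_deriv m' (weyl_monomial i j f)" for f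
        by (simp add: weyl_monomial_def m divided_deriv_Suc_mult_x)
      then show ?thesis
        using weyl_int_add[OF weyl_int_mult_x[OF Suc.IH] Suc.IH] by simp
    qed
  qed
  show ?thesis using assms
  proof (induction rule: weyl_int_induct)
    case zero
    then show ?case using weyl_int_zero by (simp add: divided_deriv_0_right)
  next
    case (add T c i j)
    then show ?case
      using weyl_int_add[OF weyl_int_smult[OF mon]] by (simp add: divided_deriv_add divided_deriv_smult)
  qed
qed

lemma weyl_int_comp:
  assumes "T \<in> carrier weyl_int" "S \<in> carrier weyl_int"
  shows "(\<lambda>f. T (S f)) \<in> carrier weyl_int"
proof -
  have mon: "(\<lambda>f. weyl_monomial i j (S f)) \<in> carrier weyl_int" for i j
    unfolding weyl_monomial_def
    by (induction i) (simp_all add: weyl_int_divided_deriv[OF assms(2)] weyl_int_mult_x)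
  show ?thesis using assms(1)
  proof (induction rule: weyl_int_induct)
    case zero
    then show ?case using weyl_int_zero by simp
  next
    case (add T c i j)
    then show ?case using weyl_int_add[OF weyl_int_smult[OF mon]] by simp
  qed
qed

lemma weyl_int_id: "id \<in> carrier weyl_int"
  using weyl_int_monomial[of 1 0 0] by (simp add: weyl_monomial_def divided_deriv_0 id_def)

lemma weyl_int_gens: "mult_x \<in> carrier weyl_int" "divided_deriv j \<in> carrier weyl_int"
  using weyl_int_mult_x[OF weyl_int_id] weyl_int_divided_deriv[OF weyl_int_id] by simp_all

lemma weyl_int_ring: "ring weyl_int"
proof (rule ringI)
  show "abelian_group weyl_int"
  proof (rule abelian_groupI)
    fix T assume T: "T \<in> carrier weyl_int"
    show "\<exists>S\<in>carrier weyl_int. S \<oplus>\<^bsub>weyl_int\<^esub> T = \<zero>\<^bsub>weyl_int\<^esub>"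
      using weyl_int_smult[OF T, of "-1"] by (intro bexI[of _ "\<lambda>f. smult (-1) (T f)"]) (auto simp: weyl_int_simps)
  qed (auto simp: weyl_int_simps weyl_int_add weyl_int_zero add_ac)
  show "Group.monoid weyl_int"
    by (rule monoidI) (auto simp: weyl_int_simps weyl_int_comp weyl_int_id)
qed (auto simp: weyl_int_simps weyl_int_additive)

section \<open>Extension of scalars\<close>

text \<open>An integer multiple is an iterated sum, so additivity alone suffices, by induction
  upwards and downwards from 0.\<close>

lemma additive_int_linear:
  assumes "module \<Z> M" "module \<Z> N" "\<And>x. x \<in> carrier M \<Longrightarrow> T x \<in> carrier N"
    and "\<And>x y. \<lbrakk>x \<in> carrier M; y \<in> carrier M\<rbrakk> \<Longrightarrow> T (x \<oplus>\<^bsub>M\<^esub> y) = T x \<oplus>\<^bsub>N\<^esub> T y"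
  shows "T \<in> linear_maps \<Z> M N"
proof (rule linear_mapsI)
  interpret M: module \<Z> M by fact
  interpret N: module \<Z> N by fact
  have zero: "T \<zero>\<^bsub>M\<^esub> = \<zero>\<^bsub>N\<^esub>"
    using assms(3)[of "\<zero>\<^bsub>M\<^esub>"] assms(4)[of "\<zero>\<^bsub>M\<^esub>" "\<zero>\<^bsub>M\<^esub>"] by (simp add: N.add.l_cancel_one')
  fix c :: int and x assume x: "x \<in> carrier M"
  have Mc: "c \<odot>\<^bsub>M\<^esub> x \<in> carrier M" and Nc: "c \<odot>\<^bsub>N\<^esub> T x \<in> carrier N" for c
    using M.smult_closed[of c x] N.smult_closed[of c "T x"] x assms(3) by auto
  have M1: "(c + 1) \<odot>\<^bsub>M\<^esub> x = c \<odot>\<^bsub>M\<^esub> x \<oplus>\<^bsub>M\<^esub> x" and N1: "(c + 1) \<odot>\<^bsub>N\<^esub> T x = c \<odot>\<^bsub>N\<^esub> T x \<oplus>\<^bsub>N\<^esub> T x" for c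
    using M.smult_l_distr[of c 1 x] N.smult_l_distr[of c 1 "T x"] M.smult_one[of x] N.smult_one[of "T x"] x assms(3)
    by auto
  have step: "T ((c + 1) \<odot>\<^bsub>M\<^esub> x) = (c + 1) \<odot>\<^bsub>N\<^esub> T x \<longleftrightarrow> T (c \<odot>\<^bsub>M\<^esub> x) = c \<odot>\<^bsub>N\<^esub> T x" for c
    unfolding M1 N1 using x Mc Nc assms(3) by (simp add: assms(4) N.add.right_cancel)
  show "T (c \<odot>\<^bsub>M\<^esub> x) = c \<odot>\<^bsub>N\<^esub> T x"
  proof (induction c rule: int_induct[where k = 0])
    case base
    then show ?case
      using M.smult_l_null[of x] N.smult_l_null[of "T x"] x assms(3) zero by simp
  next
    case (step1 c)
    then show ?case using step by blast
  next
    case (step2 c)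
    then show ?case using step[of "c - 1"] by simp
  qed
qed (use assms in auto)

text \<open>Lets the monoid algebra over the integers map into an arbitrary abelian group, as the
  universal property of the base change requires.\<close>

definition int_module :: "('a, 'y) ring_scheme \<Rightarrow> (int, 'a) module"
  where "int_module N = \<lparr>carrier = carrier N, monoid.mult = monoid.mult N, monoid.one = monoid.one N,
    ring.zero = ring.zero N, ring.add = ring.add N, module.smult = (\<lambda>c x. [c] \<cdot>\<^bsub>N\<^esub> x)\<rparr>"

lemma int_module_simps [simp]:
  "carrier (int_module N) = carrier N" "ring.zero (int_module N) = ring.zero N"
  "ring.add (int_module N) = ring.add N" "c \<odot>\<^bsub>int_module N\<^esub> x = [c] \<cdot>\<^bsub>N\<^esub> x"
  by (simp_all add: int_module_def)

lemma int_module: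
  assumes "abelian_group N"
  shows "module \<Z> (int_module N)"
proof -
  interpret N: abelian_group N by fact
  have "abelian_group (int_module N)"
  proof (rule abelian_groupI)
    fix x assume "x \<in> carrier (int_module N)"
    then show "\<exists>y\<in>carrier (int_module N). y \<oplus>\<^bsub>int_module N\<^esub> x = \<zero>\<^bsub>int_module N\<^esub>"
      by (intro bexI[of _ "\<ominus>\<^bsub>N\<^esub> x"]) (auto simp: N.l_neg)
  qed (auto simp: N.a_ac)
  then show ?thesis
    by (intro moduleI[OF int_is_cring])
      (auto simp: N.add.int_pow_mult N.add.int_pow_distrib N.add.int_pow_pow mult.commute)
qed

locale base_change_rings = A: ring A + R: cring R
  for A :: "('a, 'x) ring_scheme" and R :: "('r, 'y) ring_scheme"
begin

sublocale MA: monoid_alg \<Z> "A \<times>\<times> R"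
  by (simp add: monoid_alg_def int_is_cring DirProd_monoid A.monoid_axioms R.monoid_axioms)

abbreviation "J \<equiv> Idl\<^bsub>MA.F\<^esub> (biadditive_relations A R)"
abbreviation "T \<equiv> base_change A R"
abbreviation "pure \<equiv> pure_tensor_int A R"

lemma basis_closed: "\<lbrakk>a \<in> carrier A; r \<in> carrier R\<rbrakk> \<Longrightarrow> basis_elem \<Z> (a, r) \<in> carrier MA.F"
  unfolding basis_elem_single by (rule MA.single_closed) auto

sublocale F: assoc_algebra \<Z> MA.F
  by (rule MA.F_assoc_algebra)

lemma relations_closed: "biadditive_relations A R \<subseteq> carrier MA.F"
  unfolding biadditive_relations_def Let_def
  by (auto intro!: F.M.minus_closed F.M.a_closed basis_closed)

sublocale J: ideal J MA.F
  by (rule F.A.genideal_ideal[OF relations_closed])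

sublocale MJ: module_with_submodule \<Z> MA.F J
  by (rule F.ideal_module_with_submodule[OF J.ideal_axioms])

lemma T_simps:
  "carrier T = {J +>\<^bsub>MA.F\<^esub> f | f. f \<in> carrier MA.F}"
  "ring.add T = ring.add (quotient_algebra MA.F J)"
  "monoid.mult T = monoid.mult (quotient_algebra MA.F J)"
  "ring.zero T = ring.zero (quotient_algebra MA.F J)"
  "monoid.one T = J +>\<^bsub>MA.F\<^esub> \<one>\<^bsub>MA.F\<^esub>"
  "module.smult T = (\<lambda>c t. pure \<one>\<^bsub>A\<^esub> c \<otimes>\<^bsub>T\<^esub> t)"
  by (auto simp: base_change_def Let_def ring.extend_def module.fields_def quotient_algebra_simps
    FactRing_def A_RCOSETS_def RCOSETS_def a_r_coset_def)

lemma carrier_T: "carrier T = carrier (quotient_algebra MA.F J)"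
  by (simp add: T_simps quotient_algebra_simps)

lemma one_T: "monoid.one T = monoid.one (quotient_algebra MA.F J)"
  by (simp add: T_simps quotient_algebra_simps)

lemma T_ring: "ring T"
proof -
  interpret Q: assoc_algebra \<Z> "quotient_algebra MA.F J"
    by (rule F.quotient_assoc_algebra[OF J.ideal_axioms])
  show ?thesis
    by (rule ring_cong[OF Q.A.ring_axioms]) (rule carrier_T one_T T_simps)+
qed

sublocale T: ring T by (rule T_ring)

lemma pure_coset: "pure a r = J +>\<^bsub>MA.F\<^esub> basis_elem \<Z> (a, r)"
  by (simp add: pure_tensor_int_def Let_def)

lemma pure_closed [simp, intro]: "\<lbrakk>a \<in> carrier A; r \<in> carrier R\<rbrakk> \<Longrightarrow> pure a r \<in> carrier T"
  using basis_closed by (auto simp: T_simps pure_coset)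

lemma pure_mult:
  assumes "a \<in> carrier A" "r \<in> carrier R" "b \<in> carrier A" "s \<in> carrier R"
  shows "pure a r \<otimes>\<^bsub>T\<^esub> pure b s = pure (a \<otimes>\<^bsub>A\<^esub> b) (r \<otimes>\<^bsub>R\<^esub> s)"
proof -
  have "basis_elem \<Z> (a, r) \<otimes>\<^bsub>MA.F\<^esub> basis_elem \<Z> (b, s) = basis_elem \<Z> (a \<otimes>\<^bsub>A\<^esub> b, r \<otimes>\<^bsub>R\<^esub> s)"
    unfolding basis_elem_single using assms by (subst MA.single_mult) auto
  then show ?thesis
    using assms by (simp add: T_simps pure_coset F.coset_mult[OF J.ideal_axioms] basis_closed)
qed

lemma pure_one: "pure \<one>\<^bsub>A\<^esub> \<one>\<^bsub>R\<^esub> = \<one>\<^bsub>T\<^esub>"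
  by (simp add: T_simps pure_coset basis_elem_single MA.F_simps(4))

lemma T_smult: "c \<odot>\<^bsub>T\<^esub> t = pure \<one>\<^bsub>A\<^esub> c \<otimes>\<^bsub>T\<^esub> t"
  by (simp add: T_simps)

lemma carrier_subring: "subring (carrier T) T"
  by (rule T.subringI) auto

lemma carrier_submodule: "submodule (carrier T) R T"
  unfolding submodule_def submodule_axioms_def
  using T.add.subgroup_self by (auto simp: T_smult)

text \<open>Composition with the quotient map gives additive maps on the free abelian group over
  pairs, which are determined by their values on the basis.\<close>

lemma additive_eqI:
  assumes N: "abelian_group N" and w: "w \<in> carrier T"
    and G: "\<And>x. x \<in> carrier T \<Longrightarrow> G x \<in> carrier N"
      "\<And>x y. \<lbrakk>x \<in> carrier T; y \<in> carrier T\<rbrakk> \<Longrightarrow> G (x \<oplus>\<^bsub>T\<^esub> y) = G x \<oplus>\<^bsub>N\<^esub> G y"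
    and H: "\<And>x. x \<in> carrier T \<Longrightarrow> H x \<in> carrier N"
      "\<And>x y. \<lbrakk>x \<in> carrier T; y \<in> carrier T\<rbrakk> \<Longrightarrow> H (x \<oplus>\<^bsub>T\<^esub> y) = H x \<oplus>\<^bsub>N\<^esub> H y"
    and eq: "\<And>a r. \<lbrakk>a \<in> carrier A; r \<in> carrier R\<rbrakk> \<Longrightarrow> G (pure a r) = H (pure a r)"
  shows "G w = H w"
proof -
  have lin: "(\<lambda>f. G (J +>\<^bsub>MA.F\<^esub> f)) \<in> linear_maps \<Z> MA.F (int_module N)"
    if "\<And>x. x \<in> carrier T \<Longrightarrow> G x \<in> carrier N"
      "\<And>x y. \<lbrakk>x \<in> carrier T; y \<in> carrier T\<rbrakk> \<Longrightarrow> G (x \<oplus>\<^bsub>T\<^esub> y) = G x \<oplus>\<^bsub>N\<^esub> G y" for G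
    using that
    by (intro additive_int_linear MA.F_module int_module[OF N])
      (auto simp: carrier_T MJ.coset_in_quotient MJ.coset_add[symmetric] T_simps(2))
  obtain f where f: "f \<in> carrier MA.F" "w = J +>\<^bsub>MA.F\<^esub> f"
    using w by (auto simp: T_simps)
  have "G (J +>\<^bsub>MA.F\<^esub> f) = H (J +>\<^bsub>MA.F\<^esub> f)"
    by (rule MA.linear_eqI[OF int_module[OF N] lin lin _ f(1)])
      (use G H eq in \<open>auto simp: pure_coset\<close>)
  then show ?thesis by (simp add: f)
qed

section \<open>Universal property of the tensor product over the integers\<close>

definition biadditive :: "('b, 'z) ring_scheme \<Rightarrow> ('a \<Rightarrow> 'r \<Rightarrow> 'b) \<Rightarrow> bool"
  where "biadditive N \<beta> \<longleftrightarrow> (\<forall>a\<in>carrier A. \<forall>r\<in>carrier R. \<beta> a r \<in> carrier N) \<and>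
    (\<forall>a\<in>carrier A. \<forall>a'\<in>carrier A. \<forall>r\<in>carrier R. \<beta> (a \<oplus>\<^bsub>A\<^esub> a') r = \<beta> a r \<oplus>\<^bsub>N\<^esub> \<beta> a' r) \<and>
    (\<forall>a\<in>carrier A. \<forall>r\<in>carrier R. \<forall>r'\<in>carrier R. \<beta> a (r \<oplus>\<^bsub>R\<^esub> r') = \<beta> a r \<oplus>\<^bsub>N\<^esub> \<beta> a r')"

definition extend :: "('b, 'z) ring_scheme \<Rightarrow> ('a \<Rightarrow> 'r \<Rightarrow> 'b) \<Rightarrow> ('a \<times> 'r \<Rightarrow> int) \<Rightarrow> 'b"
  where "extend N \<beta> = linear_extension \<Z> (int_module N) (\<lambda>(a, r). \<beta> a r)"

lemma extend_linear:
  assumes "abelian_group N" "biadditive N \<beta>"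
  shows "extend N \<beta> \<in> linear_maps \<Z> MA.F (int_module N)"
  unfolding extend_def
  by (rule MA.linear_extension_linear[OF int_module[OF assms(1)]]) (use assms(2) in \<open>auto simp: biadditive_def\<close>)

lemma extend_single:
  assumes "abelian_group N" "biadditive N \<beta>" "a \<in> carrier A" "r \<in> carrier R"
  shows "extend N \<beta> (single \<Z> (a, r) c) = [c] \<cdot>\<^bsub>N\<^esub> \<beta> a r"
proof -
  have "\<beta> a r \<in> carrier (int_module N)"
    using assms(2-4) by (auto simp: biadditive_def)
  then show ?thesis
    unfolding extend_def by (subst MA.linear_extension_single[OF int_module[OF assms(1)]]) auto
qed

lemma extend_basis:
  assumes "abelian_group N" "biadditive N \<beta>" "a \<in> carrier A" "r \<in> carrier R"
  shows "extend N \<beta> (basis_elem \<Z> (a, r)) = \<beta> a r"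
proof -
  interpret N: abelian_group N by fact
  have "\<beta> a r \<in> carrier N" using assms by (auto simp: biadditive_def)
  then show ?thesis
    using extend_single[OF assms, of 1] N.add.int_pow_1 by (simp add: basis_elem_single)
qed

lemma biadditive_translate:
  assumes "biadditive N \<beta>" "a \<in> carrier A" "r \<in> carrier R"
  shows "biadditive N (\<lambda>b s. \<beta> (a \<otimes>\<^bsub>A\<^esub> b) (r \<otimes>\<^bsub>R\<^esub> s))" "biadditive N (\<lambda>b s. \<beta> (b \<otimes>\<^bsub>A\<^esub> a) (s \<otimes>\<^bsub>R\<^esub> r))"
  using assms by (auto simp: biadditive_def A.r_distr A.l_distr R.r_distr R.l_distr)

text \<open>The common kernel of all biadditive maps is an ideal, because translating a biadditive map by
  a basis element yields a biadditive map; hence it contains the ideal generated by the relations.\<close>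

lemma extend_kernel_ideal:
  assumes N: "abelian_group N"
  shows "ideal {f \<in> carrier MA.F. \<forall>\<beta>. biadditive N \<beta> \<longrightarrow> extend N \<beta> f = \<zero>\<^bsub>N\<^esub>} MA.F" (is "ideal ?K _")
proof -
  interpret N: abelian_group N by fact
  interpret ZN: module \<Z> "int_module N" by (rule int_module[OF N])
  note lin = extend_linear[OF N]
  note add = linear_maps_add[OF lin] and clo = linear_maps_closed[OF lin]
    and zero = linear_maps_zero[OF MA.F_module ZN.module_axioms lin]
  have K_add: "f \<oplus>\<^bsub>MA.F\<^esub> g \<in> ?K" if "f \<in> ?K" "g \<in> ?K" for f g
    using that by (auto simp: add)
  have K_zero: "\<zero>\<^bsub>MA.F\<^esub> \<in> ?K"
    using zero by auto
  have trans: "extend N \<beta> (single \<Z> (a, r) c \<otimes>\<^bsub>MA.F\<^esub> f) =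
        [c] \<cdot>\<^bsub>N\<^esub> extend N (\<lambda>b s. \<beta> (a \<otimes>\<^bsub>A\<^esub> b) (r \<otimes>\<^bsub>R\<^esub> s)) f"
      "extend N \<beta> (f \<otimes>\<^bsub>MA.F\<^esub> single \<Z> (a, r) c) =
        [c] \<cdot>\<^bsub>N\<^esub> extend N (\<lambda>b s. \<beta> (b \<otimes>\<^bsub>A\<^esub> a) (s \<otimes>\<^bsub>R\<^esub> r)) f"
    if \<beta>: "biadditive N \<beta>" and ar: "a \<in> carrier A" "r \<in> carrier R" and f: "f \<in> carrier MA.F" for \<beta> a r f and c :: int
  proof -
    note tl = biadditive_translate[OF \<beta> ar]
    have s: "single \<Z> (a, r) c \<in> carrier MA.F"
      using ar by (intro MA.single_closed) auto
    have scal: "(\<lambda>f. [c] \<cdot>\<^bsub>N\<^esub> extend N \<gamma> f) \<in> linear_maps \<Z> MA.F (int_module N)" if "biadditive N \<gamma>" for \<gamma>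
      using clo[OF that]
      by (intro additive_int_linear MA.F_module int_module[OF N])
        (simp_all add: linear_maps_add[OF lin[OF that]] N.add.int_pow_distrib)
    have val: "\<beta> b t \<in> carrier N" if "b \<in> carrier A" "t \<in> carrier R" for b t
      using \<beta> that by (auto simp: biadditive_def)
    have 1: "single \<Z> (a, r) c \<otimes>\<^bsub>MA.F\<^esub> basis_elem \<Z> (b, t) = single \<Z> (a \<otimes>\<^bsub>A\<^esub> b, r \<otimes>\<^bsub>R\<^esub> t) c"
      and 2: "basis_elem \<Z> (b, t) \<otimes>\<^bsub>MA.F\<^esub> single \<Z> (a, r) c = single \<Z> (b \<otimes>\<^bsub>A\<^esub> a, t \<otimes>\<^bsub>R\<^esub> r) c"
      if "b \<in> carrier A" "t \<in> carrier R" for b t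
      using that ar unfolding basis_elem_single by (subst MA.single_mult; auto)+
    have 3: "(\<lambda>f. single \<Z> (a, r) c \<otimes>\<^bsub>MA.F\<^esub> f) \<in> linear_maps \<Z> MA.F MA.F"
      "(\<lambda>f. f \<otimes>\<^bsub>MA.F\<^esub> single \<Z> (a, r) c) \<in> linear_maps \<Z> MA.F MA.F"
      using s by (auto intro!: linear_mapsI simp: F.A.r_distr F.A.l_distr F.smult_mult_right F.smult_mult_left)
    show "extend N \<beta> (single \<Z> (a, r) c \<otimes>\<^bsub>MA.F\<^esub> f) =
        [c] \<cdot>\<^bsub>N\<^esub> extend N (\<lambda>b s. \<beta> (a \<otimes>\<^bsub>A\<^esub> b) (r \<otimes>\<^bsub>R\<^esub> s)) f"
      by (rule MA.linear_eqI[OF int_module[OF N] linear_maps_comp[OF lin[OF \<beta>] 3(1)] scal[OF tl(1)] _ f])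
        (use ar in \<open>auto simp: 1 extend_single[OF N \<beta>] extend_basis[OF N tl(1)]\<close>)
    show "extend N \<beta> (f \<otimes>\<^bsub>MA.F\<^esub> single \<Z> (a, r) c) =
        [c] \<cdot>\<^bsub>N\<^esub> extend N (\<lambda>b s. \<beta> (b \<otimes>\<^bsub>A\<^esub> a) (s \<otimes>\<^bsub>R\<^esub> r)) f"
      by (rule MA.linear_eqI[OF int_module[OF N] linear_maps_comp[OF lin[OF \<beta>] 3(2)] scal[OF tl(2)] _ f])
        (use ar in \<open>auto simp: 2 extend_single[OF N \<beta>] extend_basis[OF N tl(2)]\<close>)
  qed
  show ?thesis
  proof (rule idealI[OF F.A.ring_axioms])
    show "subgroup ?K (add_monoid MA.F)"
    proof (rule F.M.add.subgroupI)
      have "\<ominus>\<^bsub>int_module N\<^esub> \<zero>\<^bsub>N\<^esub> = \<zero>\<^bsub>N\<^esub>"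
        using ZN.M.minus_equality[of "\<zero>\<^bsub>N\<^esub>" "\<zero>\<^bsub>N\<^esub>"] by simp
      moreover fix f assume "f \<in> ?K"
      ultimately show "\<ominus>\<^bsub>MA.F\<^esub> f \<in> ?K"
        using linear_maps_minus[OF MA.F_module ZN.module_axioms lin] by auto
    qed (use K_add K_zero in auto)
  next
    fix f x assume f: "f \<in> ?K" and x: "x \<in> carrier MA.F"
    have fc: "f \<in> carrier MA.F" using f by simp
    have f0: "extend N \<gamma> f = \<zero>\<^bsub>N\<^esub>" if "biadditive N \<gamma>" for \<gamma>
      using f that by auto
    show "x \<otimes>\<^bsub>MA.F\<^esub> f \<in> ?K"
      using x
    proof (induction rule: MA.F_induct)
      case zero
      then show ?case using K_zero fc by simp
    next
      case (add g u c)
      obtain a r where u: "u = (a, r)" "a \<in> carrier A" "r \<in> carrier R" using add(2) by (cases u) auto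
      have "single \<Z> u c \<otimes>\<^bsub>MA.F\<^esub> f \<in> ?K"
        unfolding u using u(2,3) fc
        by (auto simp: trans(1) f0 biadditive_translate N.add.int_pow_one intro!: MA.F_mult_closed MA.single_closed)
      then show ?case
        using K_add add fc by (simp only: F.A.l_distr MA.single_closed)
    qed
    show "f \<otimes>\<^bsub>MA.F\<^esub> x \<in> ?K"
      using x
    proof (induction rule: MA.F_induct)
      case zero
      then show ?case using K_zero fc by simp
    next
      case (add g u c)
      obtain a r where u: "u = (a, r)" "a \<in> carrier A" "r \<in> carrier R" using add(2) by (cases u) auto
      have "f \<otimes>\<^bsub>MA.F\<^esub> single \<Z> u c \<in> ?K"
        unfolding u using u(2,3) fc
        by (auto simp: trans(2) f0 biadditive_translate N.add.int_pow_one intro!: MA.F_mult_closed MA.single_closed)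
      then show ?case
        using K_add add fc by (simp only: F.A.r_distr MA.single_closed)
    qed
  qed
qed

lemma extend_J:
  assumes N: "abelian_group N" and \<beta>: "biadditive N \<beta>" and f: "f \<in> J"
  shows "extend N \<beta> f = \<zero>\<^bsub>N\<^esub>"
proof -
  interpret N: abelian_group N by fact
  interpret ZN: module \<Z> "int_module N" by (rule int_module[OF N])
  let ?K = "{f \<in> carrier MA.F. \<forall>\<beta>. biadditive N \<beta> \<longrightarrow> extend N \<beta> f = \<zero>\<^bsub>N\<^esub>}"
  have diff: "extend N \<gamma> (x \<ominus>\<^bsub>MA.F\<^esub> y) = \<zero>\<^bsub>N\<^esub>"
    if "biadditive N \<gamma>" "x \<in> carrier MA.F" "y \<in> carrier MA.F" "extend N \<gamma> x = extend N \<gamma> y" for \<gamma> x y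
    using linear_maps_diff[OF MA.F_module ZN.module_axioms extend_linear[OF N that(1)] that(2,3)] that(4)
      linear_maps_closed[OF extend_linear[OF N that(1)] that(3)] ZN.M.r_neg
    by (simp add: a_minus_def)
  have "biadditive_relations A R \<subseteq> ?K"
    unfolding biadditive_relations_def Let_def
    by (auto intro!: diff simp: basis_closed F.M.a_closed linear_maps_add[OF extend_linear[OF N]] extend_basis[OF N])
      (auto simp: biadditive_def)
  then have "J \<subseteq> ?K"
    by (rule F.A.genideal_minimal[OF extend_kernel_ideal[OF N]])
  then show ?thesis using f \<beta> by blast
qed

definition lift :: "('b, 'z) ring_scheme \<Rightarrow> ('a \<Rightarrow> 'r \<Rightarrow> 'b) \<Rightarrow> ('a \<times> 'r \<Rightarrow> int) set \<Rightarrow> 'b"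
  where "lift N \<beta> Y = extend N \<beta> (SOME f. f \<in> Y)"

lemma lift_coset:
  assumes N: "abelian_group N" and \<beta>: "biadditive N \<beta>" and f: "f \<in> carrier MA.F"
  shows "lift N \<beta> (J +>\<^bsub>MA.F\<^esub> f) = extend N \<beta> f"
proof -
  interpret N: abelian_group N by fact
  define g where "g = (SOME g. g \<in> J +>\<^bsub>MA.F\<^esub> f)"
  have "g \<in> J +>\<^bsub>MA.F\<^esub> f"
    unfolding g_def by (rule someI[of "\<lambda>g. g \<in> J +>\<^bsub>MA.F\<^esub> f", OF J.a_rcos_self[OF f]])
  then obtain h where h: "h \<in> J" "g = h \<oplus>\<^bsub>MA.F\<^esub> f"
    by (auto simp: a_r_coset_def')
  have "extend N \<beta> g = extend N \<beta> h \<oplus>\<^bsub>N\<^esub> extend N \<beta> f"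
    using linear_maps_add[OF extend_linear[OF N \<beta>], of h f] h f J.Icarr by simp
  then show ?thesis
    using extend_J[OF N \<beta> h(1)] linear_maps_closed[OF extend_linear[OF N \<beta>] f]
    by (simp add: lift_def g_def[symmetric])
qed

lemma
  assumes N: "abelian_group N" and \<beta>: "biadditive N \<beta>"
  shows lift_closed: "x \<in> carrier T \<Longrightarrow> lift N \<beta> x \<in> carrier N"
    and lift_add: "\<lbrakk>x \<in> carrier T; y \<in> carrier T\<rbrakk> \<Longrightarrow> lift N \<beta> (x \<oplus>\<^bsub>T\<^esub> y) = lift N \<beta> x \<oplus>\<^bsub>N\<^esub> lift N \<beta> y"
    and lift_pure: "\<lbrakk>a \<in> carrier A; r \<in> carrier R\<rbrakk> \<Longrightarrow> lift N \<beta> (pure a r) = \<beta> a r"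
  using linear_mapsD[OF extend_linear[OF N \<beta>]]
  by (auto simp: carrier_T T_simps(2) MJ.coset_add lift_coset[OF N \<beta>] pure_coset basis_closed
      extend_basis[OF N \<beta>] elim!: MJ.quotient_cases)

end

section \<open>Representations of the Weyl algebra\<close>

text \<open>Binomial coefficients become scalars of \<open>k\<close> through this map, which is
  where the characteristic enters.\<close>

definition (in ring) of_int :: "int \<Rightarrow> 'a"
  where "of_int z = [z] \<cdot> \<one>"

context ring
begin

lemma of_int_closed [simp, intro]: "of_int z \<in> carrier R"
  by (simp add: of_int_def)

lemma of_int_add: "of_int (y + z) = of_int y \<oplus> of_int z"
  by (simp add: of_int_def add.int_pow_mult)

lemma of_int_0 [simp]: "of_int 0 = \<zero>"
  by (simp add: of_int_def add_pow_def)

lemma of_int_1 [simp]: "of_int 1 = \<one>"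
  using add.int_pow_1 by (simp add: of_int_def)

lemma of_int_mult: "of_int (y * z) = of_int y \<otimes> of_int z"
  by (simp add: of_int_def add_pow_ldistr_int add_pow_rdistr_int add.int_pow_pow mult.commute)

end

section \<open>Pointwise operations on linear operators\<close>

lemma linear_maps_id: "(\<lambda>v. v) \<in> linear_maps k V V"
  by (rule linear_mapsI) auto

context module
begin

lemma linear_maps_cong:
  assumes "S \<in> linear_maps R M M" "\<And>v. v \<in> carrier M \<Longrightarrow> S v = T v"
  shows "T \<in> linear_maps R M M"
  using assms(1) assms(2)[symmetric] by (simp add: linear_maps_def)

lemma linear_maps_const_zero: "(\<lambda>v. \<zero>\<^bsub>M\<^esub>) \<in> linear_maps R M M"
  by (rule linear_mapsI) auto

lemma linear_maps_plus:
  assumes "S \<in> linear_maps R M M" "T \<in> linear_maps R M M"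
  shows "(\<lambda>v. S v \<oplus>\<^bsub>M\<^esub> T v) \<in> linear_maps R M M"
  by (rule linear_mapsI)
    (simp_all add: linear_mapsD[OF assms(1)] linear_mapsD[OF assms(2)] M.a_ac smult_r_distr)

lemma linear_maps_scale:
  assumes "T \<in> linear_maps R M M" "c \<in> carrier R"
  shows "(\<lambda>v. c \<odot>\<^bsub>M\<^esub> T v) \<in> linear_maps R M M"
  by (rule linear_mapsI)
    (simp_all add: linear_mapsD[OF assms(1)] assms(2) smult_r_distr smult_assoc1[symmetric] R.m_comm)

lemma linear_maps_finsum_pointwise:
  assumes "finite S" "\<And>s. s \<in> S \<Longrightarrow> T s \<in> linear_maps R M M"
  shows "(\<lambda>v. \<Oplus>\<^bsub>M\<^esub>s\<in>S. T s v) \<in> linear_maps R M M"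
  using assms
proof (induction S rule: finite_induct)
  case empty
  then show ?case by (simp add: linear_maps_const_zero)
next
  case (insert a S)
  have cl: "T s v \<in> carrier M" if "s \<in> insert a S" "v \<in> carrier M" for s v
    using linear_maps_closed[OF insert(4)[OF that(1)] that(2)] .
  have "(\<lambda>v. T a v \<oplus>\<^bsub>M\<^esub> (\<Oplus>\<^bsub>M\<^esub>s\<in>S. T s v)) \<in> linear_maps R M M"
    by (rule linear_maps_plus[of "T a"]) (use insert in auto)
  then show ?case
  proof (rule linear_maps_cong)
    fix v assume "v \<in> carrier M"
    then show "T a v \<oplus>\<^bsub>M\<^esub> (\<Oplus>\<^bsub>M\<^esub>s\<in>S. T s v) = (\<Oplus>\<^bsub>M\<^esub>s\<in>insert a S. T s v)"
      using insert(1,2) cl by (intro M.finsum_insert[symmetric]) auto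
  qed
qed

end

text \<open>The coefficients of \<open>T = \<Sum>\<^sub>j c\<^sub>j(x) D\<^sub>j\<close> are \<open>c\<^sub>j = (R\<^sup>j T)(1)\<close> for the inner derivation
  \<open>R T = T x - x T\<close>, since \<open>R D\<^sub>j = D\<^sub>j\<^sub>-\<^sub>1\<close>.\<close>

definition x_bracket :: "(int poly \<Rightarrow> int poly) \<Rightarrow> int poly \<Rightarrow> int poly"
  where "x_bracket T = (\<lambda>f. T (mult_x f) - mult_x (T f))"

definition weyl_coeff :: "nat \<Rightarrow> (int poly \<Rightarrow> int poly) \<Rightarrow> int poly"
  where "weyl_coeff j T = (x_bracket ^^ j) T 1"

lemma x_bracket_add: "(x_bracket ^^ j) (\<lambda>f. T f + S f) = (\<lambda>f. (x_bracket ^^ j) T f + (x_bracket ^^ j) S f)"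
  by (induction j) (auto simp: x_bracket_def mult_x_add)

lemma x_bracket_smult: "(x_bracket ^^ j) (\<lambda>f. smult c (T f)) = (\<lambda>f. smult c ((x_bracket ^^ j) T f))"
  by (induction j) (auto simp: x_bracket_def mult_x_smult smult_diff_right)

text \<open>Left multiplication by x commutes with the bracket because x commutes with itself; on
  coefficients it therefore becomes multiplication by x.\<close>

lemma x_bracket_mult_x: "(x_bracket ^^ j) (\<lambda>f. mult_x (T f)) = (\<lambda>f. mult_x ((x_bracket ^^ j) T f))"
  by (induction j) (auto simp: x_bracket_def mult_x_def algebra_simps)

lemma x_bracket_zero: "(x_bracket ^^ j) (\<lambda>f. 0) = (\<lambda>f. 0)"
  by (induction j) (auto simp: x_bracket_def mult_x_def)

lemma x_bracket_divided_deriv: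
  "(x_bracket ^^ l) (divided_deriv j) = (if l \<le> j then divided_deriv (j - l) else (\<lambda>f. 0))"
proof (induction l)
  case (Suc l)
  have "x_bracket (divided_deriv 0) = (\<lambda>f. 0)"
    by (simp add: x_bracket_def divided_deriv_0)
  moreover have "x_bracket (divided_deriv (Suc m)) = divided_deriv m" for m
    by (rule ext) (simp add: x_bracket_def divided_deriv_Suc_mult_x)
  moreover have "x_bracket (\<lambda>f. 0) = (\<lambda>f. 0)"
    by (simp add: x_bracket_def mult_x_def)
  ultimately show ?case
    using Suc.IH by (cases "j - l") (auto simp: Suc_diff_Suc not_less_eq_eq, metis Suc_diff_Suc diff_is_0_eq diff_Suc_Suc le_less_linear less_eq_Suc_le nat.inject)
qed simp

lemma weyl_coeff_add: "weyl_coeff j (\<lambda>f. T f + S f) = weyl_coeff j T + weyl_coeff j S"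
  by (simp add: weyl_coeff_def x_bracket_add)

lemma weyl_coeff_smult: "weyl_coeff j (\<lambda>f. smult c (T f)) = smult c (weyl_coeff j T)"
  by (simp add: weyl_coeff_def x_bracket_smult)

lemma weyl_coeff_zero: "weyl_coeff j (\<lambda>f. 0) = 0"
  by (simp add: weyl_coeff_def x_bracket_zero)

lemma weyl_coeff_mult_x: "weyl_coeff j (\<lambda>f. mult_x (T f)) = pCons 0 (weyl_coeff j T)"
  by (simp add: weyl_coeff_def x_bracket_mult_x) (simp add: mult_x_pCons)

text \<open>After \<open>l\<close> brackets \<open>D_(j-l)\<close> is left if
  \<open>l \<le> j\<close>, and 0 otherwise; applied to the constant 1 this survives only for
  \<open>l = j\<close>.\<close>

lemma weyl_coeff_divided_deriv: "weyl_coeff l (divided_deriv j) = (if l = j then 1 else 0)"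
proof -
  have "divided_deriv n 1 = (if n = 0 then 1 else 0)" for n
    by (rule poly_eqI) (auto simp: coeff_divided_deriv coeff_1)
  then show ?thesis
    by (auto simp: weyl_coeff_def x_bracket_divided_deriv)
qed

text \<open>The bound in \<open>D_X\<close> is forced by the truncation \<open>D_ge\<close>: for
  \<open>Suc m = q\<close> the relation would read \<open>D (q - 1) v = \<zero>\<close>. In
  \<open>D_D\<close> the sum \<open>m + j\<close> may reach \<open>q\<close>, and then the right
  side is zero.\<close>

locale weyl_operators = module k V
  for k :: "('k, 'x) ring_scheme" (structure) and V :: "('k, 'v, 'z) module_scheme" +
  fixes q :: nat and xop :: "'v \<Rightarrow> 'v" and D :: "nat \<Rightarrow> 'v \<Rightarrow> 'v"
  assumes q_pos: "q > 0"
    and X_linear: "xop \<in> linear_maps k V V"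
    and D_linear: "D m \<in> linear_maps k V V"
    and D_0: "v \<in> carrier V \<Longrightarrow> D 0 v = v"
    and D_ge: "\<lbrakk>m \<ge> q; v \<in> carrier V\<rbrakk> \<Longrightarrow> D m v = \<zero>\<^bsub>V\<^esub>"
    and D_X: "\<lbrakk>Suc m < q; v \<in> carrier V\<rbrakk> \<Longrightarrow> D (Suc m) (xop v) = xop (D (Suc m) v) \<oplus>\<^bsub>V\<^esub> D m v"
    and D_D: "\<lbrakk>m < q; j < q; v \<in> carrier V\<rbrakk> \<Longrightarrow>
      D m (D j v) = of_int (int ((m + j) choose j)) \<odot>\<^bsub>V\<^esub> D (m + j) v"
begin

text \<open>The operator g(X) applied to \<open>v\<close>, by Horner's scheme.\<close>

definition eval :: "int poly \<Rightarrow> 'v \<Rightarrow> 'v"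
  where "eval g v = fold_coeffs (\<lambda>a w. of_int a \<odot>\<^bsub>V\<^esub> v \<oplus>\<^bsub>V\<^esub> xop w) g \<zero>\<^bsub>V\<^esub>"

lemma X_zero: "xop \<zero>\<^bsub>V\<^esub> = \<zero>\<^bsub>V\<^esub>"
  by (rule linear_maps_zero[OF module_axioms module_axioms X_linear])

lemma eval_0: "eval 0 v = \<zero>\<^bsub>V\<^esub>"
  by (simp add: eval_def)

lemma eval_pCons:
  assumes "v \<in> carrier V"
  shows "eval (pCons a g) v = of_int a \<odot>\<^bsub>V\<^esub> v \<oplus>\<^bsub>V\<^esub> xop (eval g v)"
  using assms by (cases "g = 0 \<and> a = 0") (auto simp: eval_def X_zero)

lemma eval_linear: "eval g \<in> linear_maps k V V"
proof (induction g)
  case 0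
  have "eval 0 = (\<lambda>v. \<zero>\<^bsub>V\<^esub>)" by (simp add: eval_0 fun_eq_iff)
  then show ?case by (simp add: linear_maps_const_zero)
next
  case (pCons a g)
  have "(\<lambda>v. of_int a \<odot>\<^bsub>V\<^esub> v \<oplus>\<^bsub>V\<^esub> xop (eval g v)) \<in> linear_maps k V V"
    by (intro linear_maps_plus linear_maps_scale linear_maps_id linear_maps_comp[OF X_linear pCons.IH]) auto
  then show ?case by (simp add: linear_maps_def eval_pCons)
qed

lemmas eval_closed = linear_maps_closed[OF eval_linear]
lemmas X_D = linear_mapsD[OF X_linear]
lemmas D_D' = linear_mapsD[OF D_linear]

lemma eval_add:
  assumes "v \<in> carrier V"
  shows "eval (g + h) v = eval g v \<oplus>\<^bsub>V\<^esub> eval h v"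
proof (induction g h rule: poly_induct2)
  case (pCons a g b h)
  then show ?case
    using assms by (simp add: eval_pCons eval_closed X_D of_int_add smult_l_distr M.a_ac)
qed (simp add: eval_0)

lemma eval_smult:
  assumes "v \<in> carrier V"
  shows "eval (smult c g) v = of_int c \<odot>\<^bsub>V\<^esub> eval g v"
  by (induction g) (use assms in \<open>simp_all add: eval_0 eval_pCons eval_closed X_D of_int_mult
    smult_assoc1 smult_r_distr\<close>)

text \<open>An expansion of \<open>T\<close> into monomials is only known to exist. Reading the
  coefficients off \<open>T\<close> itself makes the action independent of any expansion, so linear
  independence of the monomials is never proved.\<close>

definition act_int :: "(int poly \<Rightarrow> int poly) \<Rightarrow> 'v \<Rightarrow> 'v"
  where "act_int T v = (\<Oplus>\<^bsub>V\<^esub>j\<in>{..<q}. eval (weyl_coeff j T) (D j v))"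

lemma act_int_linear: "act_int T \<in> linear_maps k V V"
  unfolding act_int_def
  by (intro linear_maps_finsum_pointwise linear_maps_comp[OF eval_linear D_linear]) auto

lemmas act_int_closed = linear_maps_closed[OF act_int_linear]

lemma act_int_add:
  assumes "v \<in> carrier V"
  shows "act_int (\<lambda>f. T f + S f) v = act_int T v \<oplus>\<^bsub>V\<^esub> act_int S v"
  using assms unfolding act_int_def
  by (subst M.finsum_addf[symmetric]) (auto simp: weyl_coeff_add eval_add D_D' eval_closed intro!: M.finsum_cong')

lemma act_int_smult:
  assumes "v \<in> carrier V"
  shows "act_int (\<lambda>f. smult c (T f)) v = of_int c \<odot>\<^bsub>V\<^esub> act_int T v"
  using assms unfolding act_int_def
  by (subst finsum_smult_ldistr) (auto simp: weyl_coeff_smult eval_smult D_D' eval_closed intro!: M.finsum_cong')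

lemma act_int_zero: "act_int (\<lambda>f. 0) v = \<zero>\<^bsub>V\<^esub>"
  by (simp add: act_int_def weyl_coeff_zero eval_0)

lemma act_int_mult_x:
  assumes "v \<in> carrier V"
  shows "act_int (\<lambda>f. mult_x (T f)) v = xop (act_int T v)"
proof -
  have "xop (act_int T v) = (\<Oplus>\<^bsub>V\<^esub>j\<in>{..<q}. xop (eval (weyl_coeff j T) (D j v)))"
    unfolding act_int_def using assms
    by (intro linear_maps_finsum[OF module_axioms module_axioms X_linear]) (auto simp: eval_closed D_D')
  then show ?thesis
    using assms unfolding act_int_def
    by (auto simp: weyl_coeff_mult_x eval_pCons D_D' eval_closed X_D intro!: M.finsum_cong')
qed

lemma act_int_divided_deriv:
  assumes "v \<in> carrier V"
  shows "act_int (divided_deriv j) v = D j v"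
proof -
  have 1: "eval 1 w = w" if "w \<in> carrier V" for w
    using that by (simp add: one_pCons eval_pCons eval_0 X_zero)
  show ?thesis
  proof (cases "j < q")
    case True
    then have "act_int (divided_deriv j) v = eval (weyl_coeff j (divided_deriv j)) (D j v)"
      unfolding act_int_def using assms
      by (intro M.finsum_single) (auto simp: weyl_coeff_divided_deriv eval_0 eval_closed D_D')
    then show ?thesis using assms by (simp add: weyl_coeff_divided_deriv 1 D_D')
  next
    case False
    then have "act_int (divided_deriv j) v = \<zero>\<^bsub>V\<^esub>"
      unfolding act_int_def by (intro M.add.finprod_one_eqI) (auto simp: weyl_coeff_divided_deriv eval_0)
    then show ?thesis using False assms by (simp add: D_ge)
  qed
qed

lemma act_int_id: "v \<in> carrier V \<Longrightarrow> act_int id v = v"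
  using act_int_divided_deriv[of v 0] by (simp add: divided_deriv_0 D_0)

text \<open>Left multiplication by \<open>D\<^sub>m\<close> with \<open>m < q\<close> preserves the left ideal spanned by all \<open>x\<^sup>i D\<^sub>j\<close> with
  \<open>j \<ge> q\<close>, which is what \<^term>\<open>act_int\<close> discards; therefore \<open>T\<close> is arbitrary here.\<close>

lemma act_int_divided_deriv_comp:
  assumes "T \<in> carrier weyl_int" "m < q" "v \<in> carrier V"
  shows "act_int (\<lambda>f. divided_deriv m (T f)) v = D m (act_int T v)"
proof -
  have mon: "act_int (\<lambda>f. divided_deriv m (weyl_monomial i j f)) v = D m (act_int (weyl_monomial i j) v)"
    if "m < q" for m i j
    using that
  proof (induction i arbitrary: m)
    case 0
    have "act_int (\<lambda>f. divided_deriv m (weyl_monomial 0 j f)) v =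
        of_int (int ((m + j) choose j)) \<odot>\<^bsub>V\<^esub> D (m + j) v"
      using assms by (simp add: weyl_monomial_def divided_deriv_divided_deriv act_int_smult act_int_divided_deriv)
    also have "\<dots> = D m (D j v)"
    proof (cases "j < q")
      case False
      then show ?thesis
        using assms(3) linear_maps_zero[OF module_axioms module_axioms D_linear] by (simp add: D_ge)
    qed (simp add: D_D 0 assms)
    finally show ?case
      using act_int_divided_deriv[OF assms(3), of j] by (simp add: weyl_monomial_def)
  next
    case (Suc i)
    have w: "act_int (weyl_monomial (Suc i) j) v = xop (act_int (weyl_monomial i j) v)"
      using act_int_mult_x[OF assms(3), of "weyl_monomial i j"] by (simp add: weyl_monomial_def[abs_def])
    show ?case
    proof (cases m)
      case 0
      then show ?thesis using assms by (simp add: divided_deriv_0 D_0 act_int_closed)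
    next
      case m: (Suc m')
      \<comment> \<open>Normal ordering as for operators on polynomials. Both \<open>m\<close> and
        \<open>m'\<close> are below \<open>q\<close>, so the induction hypothesis covers both terms,
        and \<open>D_X\<close> reassembles them.\<close>
      have "(\<lambda>f. divided_deriv m (weyl_monomial (Suc i) j f)) = (\<lambda>f.
          mult_x (divided_deriv m (weyl_monomial i j f)) + divided_deriv m' (weyl_monomial i j f))"
        by (simp add: weyl_monomial_def m divided_deriv_Suc_mult_x)
      then have "act_int (\<lambda>f. divided_deriv m (weyl_monomial (Suc i) j f)) v =
          xop (D m (act_int (weyl_monomial i j) v)) \<oplus>\<^bsub>V\<^esub> D m' (act_int (weyl_monomial i j) v)"
        using Suc.prems m assms(3) by (simp add: act_int_add act_int_mult_x Suc.IH)
      also have "\<dots> = D m (xop (act_int (weyl_monomial i j) v))"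
        using Suc.prems m assms(3) by (simp add: D_X act_int_closed)
      finally show ?thesis by (simp add: w)
    qed
  qed
  show ?thesis using assms(1)
  proof (induction rule: weyl_int_induct)
    case zero
    then show ?case
      using linear_maps_zero[OF module_axioms module_axioms D_linear]
      by (simp add: divided_deriv_0_right act_int_zero)
  next
    case (add T c i j)
    then show ?case
      using assms(2,3)
      by (simp add: divided_deriv_add divided_deriv_smult act_int_add act_int_smult mon D_D' act_int_closed)
  qed
qed

text \<open>The action is assembled from \<open>xop\<close> and the \<open>D m\<close>, so whatever
  commutes with these commutes with it. Later \<open>Z\<close> comes from another tensor
  factor.\<close>

lemma act_int_commutes:
  assumes Z: "Z \<in> linear_maps k V V" and ZX: "\<And>v. v \<in> carrier V \<Longrightarrow> Z (xop v) = xop (Z v)"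
    and ZD: "\<And>m v. v \<in> carrier V \<Longrightarrow> Z (D m v) = D m (Z v)" and v: "v \<in> carrier V"
  shows "Z (act_int T v) = act_int T (Z v)"
proof -
  note Zl = linear_mapsD[OF Z]
  have ev: "Z (eval g w) = eval g (Z w)" if "w \<in> carrier V" for g w
    using that linear_maps_zero[OF module_axioms module_axioms Z]
    by (induction g) (auto simp: eval_0 eval_pCons Zl eval_closed X_D ZX)
  have "Z (act_int T v) = (\<Oplus>\<^bsub>V\<^esub>j\<in>{..<q}. Z (eval (weyl_coeff j T) (D j v)))"
    unfolding act_int_def using v
    by (intro linear_maps_finsum[OF module_axioms module_axioms Z]) (auto simp: eval_closed D_D')
  also have "\<dots> = act_int T (Z v)"
    unfolding act_int_def using v by (intro M.finsum_cong') (auto simp: ev ZD D_D' Zl eval_closed)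
  finally show ?thesis .
qed

sublocale W: base_change_rings weyl_int k
  by (simp add: base_change_rings_def weyl_int_ring R.is_cring)

lemma biadditive_act: "v \<in> carrier V \<Longrightarrow> W.biadditive V (\<lambda>T c. c \<odot>\<^bsub>V\<^esub> act_int T v)"
  by (simp add: W.biadditive_def act_int_closed weyl_int_simps act_int_add smult_r_distr smult_l_distr)

text \<open>Defined on all of W(k), where it is additive; compatibility with products is established
  only for left factors in \<open>multiplicative_part\<close>.\<close>

definition weyl_act :: "((int poly \<Rightarrow> int poly) \<times> 'k \<Rightarrow> int) set \<Rightarrow> 'v \<Rightarrow> 'v"
  where "weyl_act w v = W.lift V (\<lambda>T c. c \<odot>\<^bsub>V\<^esub> act_int T v) w"

context
  fixes v assumes v: "v \<in> carrier V"
begin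

lemma weyl_act_closed: "w \<in> carrier (weyl k) \<Longrightarrow> weyl_act w v \<in> carrier V"
  unfolding weyl_act_def weyl_def by (rule W.lift_closed[OF M.abelian_group_axioms biadditive_act[OF v]])

lemma weyl_act_add:
  "\<lbrakk>w \<in> carrier (weyl k); w' \<in> carrier (weyl k)\<rbrakk> \<Longrightarrow>
    weyl_act (w \<oplus>\<^bsub>weyl k\<^esub> w') v = weyl_act w v \<oplus>\<^bsub>V\<^esub> weyl_act w' v"
  unfolding weyl_act_def weyl_def by (rule W.lift_add[OF M.abelian_group_axioms biadditive_act[OF v]])

lemma weyl_act_pure:
  "\<lbrakk>T \<in> carrier weyl_int; c \<in> carrier k\<rbrakk> \<Longrightarrow> weyl_act (W.pure T c) v = c \<odot>\<^bsub>V\<^esub> act_int T v"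
  unfolding weyl_act_def weyl_def by (rule W.lift_pure[OF M.abelian_group_axioms biadditive_act[OF v]])

end

lemma weyl_act_linear:
  assumes w: "w \<in> carrier (weyl k)"
  shows "weyl_act w \<in> linear_maps k V V"
proof -
  note eqI = W.additive_eqI[OF M.abelian_group_axioms w[unfolded weyl_def], folded weyl_def]
  note cl = weyl_act_closed and add = weyl_act_add and pure = weyl_act_pure
  show ?thesis
  proof (rule linear_mapsI)
    fix v v' assume v: "v \<in> carrier V" "v' \<in> carrier V"
    show "weyl_act w (v \<oplus>\<^bsub>V\<^esub> v') = weyl_act w v \<oplus>\<^bsub>V\<^esub> weyl_act w v'"
      by (rule eqI)
        (use v in \<open>simp_all add: cl add pure linear_mapsD[OF act_int_linear] smult_r_distr M.a_ac\<close>)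
  next
    fix c v assume v: "c \<in> carrier k" "v \<in> carrier V"
    show "weyl_act w (c \<odot>\<^bsub>V\<^esub> v) = c \<odot>\<^bsub>V\<^esub> weyl_act w v"
      by (rule eqI)
        (use v in \<open>simp_all add: cl add pure linear_mapsD[OF act_int_linear] smult_r_distr
          smult_assoc1[symmetric] R.m_comm\<close>)
  qed (use weyl_act_closed w in auto)
qed

lemma weyl_act_commutes:
  assumes Z: "Z \<in> linear_maps k V V" and ZX: "\<And>v. v \<in> carrier V \<Longrightarrow> Z (xop v) = xop (Z v)"
    and ZD: "\<And>m v. v \<in> carrier V \<Longrightarrow> Z (D m v) = D m (Z v)"
    and v: "v \<in> carrier V" and w: "w \<in> carrier (weyl k)"
  shows "Z (weyl_act w v) = weyl_act w (Z v)"
  by (rule W.additive_eqI[OF M.abelian_group_axioms w[unfolded weyl_def], folded weyl_def])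
    (use v in \<open>simp_all add: weyl_act_closed weyl_act_add weyl_act_pure linear_mapsD[OF Z] act_int_closed
      act_int_commutes[OF Z ZX ZD]\<close>)

text \<open>Both sides are additive in \<open>w\<close>, so \<open>w\<close> may be taken to be a
  pure tensor; what remains is the assumption \<open>comp\<close> about integral operators.\<close>

lemma weyl_act_pure_mult:
  assumes T: "T \<in> carrier weyl_int" and c: "c \<in> carrier k" and v: "v \<in> carrier V"
    and w: "w \<in> carrier (weyl k)"
    and comp: "\<And>S. S \<in> carrier weyl_int \<Longrightarrow> act_int (\<lambda>f. T (S f)) v = act_int T (act_int S v)"
  shows "weyl_act (W.pure T c \<otimes>\<^bsub>weyl k\<^esub> w) v = weyl_act (W.pure T c) (weyl_act w v)"
proof -
  have p: "W.pure T c \<in> carrier (weyl k)" using T c unfolding weyl_def by (rule W.pure_closed)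
  interpret T: ring "weyl k" unfolding weyl_def by (rule W.T_ring)
  note cl = weyl_act_closed and add = weyl_act_add and pure = weyl_act_pure
  show ?thesis
  proof (rule W.additive_eqI[OF M.abelian_group_axioms w[unfolded weyl_def], folded weyl_def])
    fix S d assume S: "S \<in> carrier weyl_int" and d: "d \<in> carrier k"
    have "W.pure T c \<otimes>\<^bsub>weyl k\<^esub> W.pure S d = W.pure (\<lambda>f. T (S f)) (c \<otimes> d)"
      using W.pure_mult[OF T c S d] by (simp add: weyl_def weyl_int_simps)
    then show "weyl_act (W.pure T c \<otimes>\<^bsub>weyl k\<^esub> W.pure S d) v =
        weyl_act (W.pure T c) (weyl_act (W.pure S d) v)"
      using T c S d v by (simp add: pure weyl_int_comp comp linear_mapsD[OF act_int_linear] smult_assoc1)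
  qed (use v p in \<open>simp_all add: cl add T.r_distr linear_mapsD[OF weyl_act_linear[OF p]]\<close>)
qed

end

text \<open>The first three assumptions say that the carrier is one of the subalgebras being
  intersected, which bounds the intersection from above.\<close>

lemma (in ring)
  assumes "subring (carrier A) A" "submodule (carrier A) k A" "S \<subseteq> carrier A"
  shows generated_subalgebra_subset: "generated_subalgebra k A S \<subseteq> carrier A"
    and generated_subalgebra_mult: "\<lbrakk>x \<in> generated_subalgebra k A S; y \<in> generated_subalgebra k A S\<rbrakk> \<Longrightarrow>
      x \<otimes>\<^bsub>A\<^esub> y \<in> generated_subalgebra k A S"
    and generated_subalgebra_add: "\<lbrakk>x \<in> generated_subalgebra k A S; y \<in> generated_subalgebra k A S\<rbrakk> \<Longrightarrow>
      x \<oplus>\<^bsub>A\<^esub> y \<in> generated_subalgebra k A S"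
    and generated_subalgebra_smult: "\<lbrakk>c \<in> carrier k; y \<in> generated_subalgebra k A S\<rbrakk> \<Longrightarrow>
      c \<odot>\<^bsub>A\<^esub> y \<in> generated_subalgebra k A S"
    and generated_subalgebra_one: "\<one>\<^bsub>A\<^esub> \<in> generated_subalgebra k A S"
  using assms unfolding generated_subalgebra_def
  by (auto simp: subring_def submodule_def submodule_axioms_def
      intro: submonoid.m_closed submonoid.one_closed dest: subgroup.m_closed)

section \<open>Restriction of the action to W_r(k)\<close>

context weyl_operators
begin

sublocale WR: ring "weyl k"
  unfolding weyl_def by (rule W.T_ring)

lemma pure_in_weyl: "\<lbrakk>T \<in> carrier weyl_int; c \<in> carrier k\<rbrakk> \<Longrightarrow> W.pure T c \<in> carrier (weyl k)"
  unfolding weyl_def by (rule W.pure_closed)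

lemma weyl_smult: "c \<odot>\<^bsub>weyl k\<^esub> w = W.pure id c \<otimes>\<^bsub>weyl k\<^esub> w"
  using W.T_smult by (simp add: weyl_def weyl_int_simps)

lemma weyl_smult_closed: "\<lbrakk>c \<in> carrier k; w \<in> carrier (weyl k)\<rbrakk> \<Longrightarrow> c \<odot>\<^bsub>weyl k\<^esub> w \<in> carrier (weyl k)"
  by (simp add: weyl_smult pure_in_weyl weyl_int_id)

lemma weyl_act_one: "v \<in> carrier V \<Longrightarrow> weyl_act \<one>\<^bsub>weyl k\<^esub> v = v"
  using weyl_act_pure[of v id \<one>] W.pure_one
  by (simp add: weyl_def weyl_int_simps weyl_int_id act_int_id)

lemma weyl_act_smult:
  assumes "c \<in> carrier k" "w \<in> carrier (weyl k)" "v \<in> carrier V"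
  shows "weyl_act (c \<odot>\<^bsub>weyl k\<^esub> w) v = c \<odot>\<^bsub>V\<^esub> weyl_act w v"
  unfolding weyl_smult using assms
  by (subst weyl_act_pure_mult)
    (auto simp: weyl_int_id act_int_id act_int_closed weyl_act_pure weyl_act_closed)

lemma weyl_act_zero: "v \<in> carrier V \<Longrightarrow> weyl_act \<zero>\<^bsub>weyl k\<^esub> v = \<zero>\<^bsub>V\<^esub>"
  using weyl_act_add[of v "\<zero>\<^bsub>weyl k\<^esub>" "\<zero>\<^bsub>weyl k\<^esub>"] weyl_act_closed[of v "\<zero>\<^bsub>weyl k\<^esub>"]
  by (simp add: M.add.l_cancel_one')

lemma weyl_act_minus:
  assumes "v \<in> carrier V" "w \<in> carrier (weyl k)"
  shows "weyl_act (\<ominus>\<^bsub>weyl k\<^esub> w) v = \<ominus>\<^bsub>V\<^esub> weyl_act w v"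
proof -
  have "weyl_act (\<ominus>\<^bsub>weyl k\<^esub> w) v \<oplus>\<^bsub>V\<^esub> weyl_act w v = \<zero>\<^bsub>V\<^esub>"
    using assms weyl_act_add[of v "\<ominus>\<^bsub>weyl k\<^esub> w" w] by (simp add: WR.l_neg weyl_act_zero)
  then show ?thesis using assms weyl_act_closed by (metis M.minus_equality WR.a_inv_closed)
qed

text \<open>The right factor \<open>w\<close> ranges over all of W(k), not just over W_r(k). This
  makes the set closed under products: in (a b) w = a (b w) the element b w is again an admissible
  right factor.\<close>

definition multiplicative_part :: "((int poly \<Rightarrow> int poly) \<times> 'k \<Rightarrow> int) set set"
  where "multiplicative_part = {b \<in> carrier (weyl k). \<forall>w\<in>carrier (weyl k). \<forall>v\<in>carrier V.
    weyl_act (b \<otimes>\<^bsub>weyl k\<^esub> w) v = weyl_act b (weyl_act w v)}"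

lemma multiplicative_part_subring: "subring multiplicative_part (weyl k)"
proof (rule WR.subringI)
  show "\<And>a b. \<lbrakk>a \<in> multiplicative_part; b \<in> multiplicative_part\<rbrakk> \<Longrightarrow>
      a \<otimes>\<^bsub>weyl k\<^esub> b \<in> multiplicative_part"
    by (auto simp: multiplicative_part_def WR.m_assoc weyl_act_closed)
  show "\<And>a b. \<lbrakk>a \<in> multiplicative_part; b \<in> multiplicative_part\<rbrakk> \<Longrightarrow>
      a \<oplus>\<^bsub>weyl k\<^esub> b \<in> multiplicative_part"
    by (auto simp: multiplicative_part_def WR.l_distr weyl_act_add weyl_act_closed)
  show "\<And>a. a \<in> multiplicative_part \<Longrightarrow> \<ominus>\<^bsub>weyl k\<^esub> a \<in> multiplicative_part"
    by (auto simp: multiplicative_part_def WR.l_minus weyl_act_minus weyl_act_closed)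
qed (auto simp: multiplicative_part_def weyl_act_one weyl_act_closed)

lemma multiplicative_part_submodule: "submodule multiplicative_part k (weyl k)"
proof -
  have "c \<odot>\<^bsub>weyl k\<^esub> b \<in> multiplicative_part" if c: "c \<in> carrier k" and b: "b \<in> multiplicative_part" for c b
  proof -
    have bc: "b \<in> carrier (weyl k)"
      and bm: "\<And>w v. \<lbrakk>w \<in> carrier (weyl k); v \<in> carrier V\<rbrakk> \<Longrightarrow>
        weyl_act (b \<otimes>\<^bsub>weyl k\<^esub> w) v = weyl_act b (weyl_act w v)"
      using b by (auto simp: multiplicative_part_def)
    have "(c \<odot>\<^bsub>weyl k\<^esub> b) \<otimes>\<^bsub>weyl k\<^esub> w = c \<odot>\<^bsub>weyl k\<^esub> (b \<otimes>\<^bsub>weyl k\<^esub> w)" if "w \<in> carrier (weyl k)" for w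
      using that c bc by (simp add: weyl_smult WR.m_assoc pure_in_weyl weyl_int_id)
    then show ?thesis
      using c bc by (simp add: multiplicative_part_def weyl_smult_closed weyl_act_smult bm weyl_act_closed)
  qed
  then show ?thesis
    using multiplicative_part_subring by (simp add: submodule_def submodule_axioms_def subring_def)
qed

lemma multiplicative_part_generators:
  "W.pure mult_x \<one> \<in> multiplicative_part" "m < q \<Longrightarrow> W.pure (divided_deriv m) \<one> \<in> multiplicative_part"
proof -
  show "W.pure mult_x \<one> \<in> multiplicative_part"
    unfolding multiplicative_part_def using act_int_mult_x[of _ id]
    by (auto simp: pure_in_weyl weyl_int_gens act_int_closed act_int_id act_int_mult_x intro!: weyl_act_pure_mult)
  show "W.pure (divided_deriv m) \<one> \<in> multiplicative_part" if "m < q"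
    unfolding multiplicative_part_def
    by (auto simp: pure_in_weyl weyl_int_gens act_int_closed act_int_divided_deriv that
        act_int_divided_deriv_comp intro!: weyl_act_pure_mult)
qed

end

lemma (in weyl_operators)
  assumes q: "q = p ^ r"
  shows weyl_sub_monoid: "Group.monoid (weyl_sub p k r)"
    and weyl_sub_subset: "w \<in> carrier (weyl_sub p k r) \<Longrightarrow> w \<in> carrier (weyl k)"
    and weyl_sub_add: "\<lbrakk>w \<in> carrier (weyl_sub p k r); w' \<in> carrier (weyl_sub p k r)\<rbrakk> \<Longrightarrow>
      w \<oplus>\<^bsub>weyl k\<^esub> w' \<in> carrier (weyl_sub p k r)"
    and weyl_sub_smult: "\<lbrakk>c \<in> carrier k; w \<in> carrier (weyl_sub p k r)\<rbrakk> \<Longrightarrow>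
      c \<odot>\<^bsub>weyl k\<^esub> w \<in> carrier (weyl_sub p k r)"
    and weyl_sub_act: "\<lbrakk>w \<in> carrier (weyl_sub p k r); w' \<in> carrier (weyl k); v \<in> carrier V\<rbrakk> \<Longrightarrow>
      weyl_act (w \<otimes>\<^bsub>weyl k\<^esub> w') v = weyl_act w (weyl_act w' v)"
proof -
  let ?S = "{W.pure mult_x \<one>} \<union> {W.pure (divided_deriv j) \<one> | j. j < p ^ r}"
  have car: "carrier (weyl_sub p k r) = generated_subalgebra k (weyl k) ?S"
    by (simp add: weyl_sub_def)
  have sr: "subring (carrier (weyl k)) (weyl k)" "submodule (carrier (weyl k)) k (weyl k)"
    unfolding weyl_def by (rule W.carrier_subring W.carrier_submodule)+
  have S: "?S \<subseteq> carrier (weyl k)"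
    using weyl_int_gens pure_in_weyl by auto
  note gen = WR.generated_subalgebra_subset[OF sr S] WR.generated_subalgebra_mult[OF sr S]
    WR.generated_subalgebra_add[OF sr S] WR.generated_subalgebra_smult[OF sr S]
    WR.generated_subalgebra_one[OF sr S]
  show sub: "w \<in> carrier (weyl_sub p k r) \<Longrightarrow> w \<in> carrier (weyl k)" for w
    unfolding car using gen(1) by blast
  have car': "weyl_sub p k r = (weyl k)\<lparr>carrier := generated_subalgebra k (weyl k) ?S\<rparr>"
    by (simp add: weyl_sub_def)
  show "Group.monoid (weyl_sub p k r)"
    unfolding car' using gen sub by (intro monoidI) (auto simp: WR.m_assoc subset_iff)
  show "\<lbrakk>w \<in> carrier (weyl_sub p k r); w' \<in> carrier (weyl_sub p k r)\<rbrakk> \<Longrightarrow>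
      w \<oplus>\<^bsub>weyl k\<^esub> w' \<in> carrier (weyl_sub p k r)"
    "\<lbrakk>c \<in> carrier k; w \<in> carrier (weyl_sub p k r)\<rbrakk> \<Longrightarrow>
      c \<odot>\<^bsub>weyl k\<^esub> w \<in> carrier (weyl_sub p k r)"
    unfolding car using gen by auto
  \<comment> \<open>A subalgebra containing the generators contains the subalgebra they generate.
    The bound \<open>j < p ^ r\<close> on the generators is exactly \<open>j < q\<close>.\<close>
  have "generated_subalgebra k (weyl k) ?S \<subseteq> multiplicative_part"
    unfolding generated_subalgebra_def
    using multiplicative_part_subring multiplicative_part_submodule multiplicative_part_generators q
    by (intro Inter_lower) auto
  then show "\<lbrakk>w \<in> carrier (weyl_sub p k r); w' \<in> carrier (weyl k); v \<in> carrier V\<rbrakk> \<Longrightarrow>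
      weyl_act (w \<otimes>\<^bsub>weyl k\<^esub> w') v = weyl_act w (weyl_act w' v)"
    unfolding car multiplicative_part_def by blast
qed

lemma weyl_sub_simps:
  "ring.add (weyl_sub p k r) = ring.add (weyl k)" "monoid.mult (weyl_sub p k r) = monoid.mult (weyl k)"
  "monoid.one (weyl_sub p k r) = monoid.one (weyl k)" "module.smult (weyl_sub p k r) = module.smult (weyl k)"
  by (simp_all add: weyl_sub_def)

section \<open>Representations of monoid algebras and of their quotients\<close>

locale monoid_representation = monoid_alg k M + V: module k V
  for k :: "('k, 'x) ring_scheme" (structure) and M :: "('m, 'y) monoid_scheme"
    and V :: "('k, 'v, 'z) module_scheme" +
  fixes \<theta> :: "'m \<Rightarrow> 'v \<Rightarrow> 'v"
  assumes \<theta>_linear: "u \<in> carrier M \<Longrightarrow> \<theta> u \<in> linear_maps k V V"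
    and \<theta>_mult: "\<lbrakk>u \<in> carrier M; u' \<in> carrier M; v \<in> carrier V\<rbrakk> \<Longrightarrow> \<theta> (u \<otimes>\<^bsub>M\<^esub> u') v = \<theta> u (\<theta> u' v)"
    and \<theta>_one: "v \<in> carrier V \<Longrightarrow> \<theta> \<one>\<^bsub>M\<^esub> v = v"
begin

definition act :: "('m \<Rightarrow> 'k) \<Rightarrow> 'v \<Rightarrow> 'v"
  where "act f v = linear_extension k V (\<lambda>u. \<theta> u v) f"

lemma act_linear_left: "v \<in> carrier V \<Longrightarrow> (\<lambda>f. act f v) \<in> linear_maps k F V"
  unfolding act_def
  by (rule linear_extension_linear[OF V.module_axioms]) (rule linear_maps_closed[OF \<theta>_linear])

lemmas act_left = linear_mapsD[OF act_linear_left]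

lemma act_zero_left: "v \<in> carrier V \<Longrightarrow> act \<zero>\<^bsub>F\<^esub> v = \<zero>\<^bsub>V\<^esub>"
  by (rule linear_maps_zero[OF F_module V.module_axioms act_linear_left])

lemma act_single:
  "\<lbrakk>u \<in> carrier M; c \<in> carrier k; v \<in> carrier V\<rbrakk> \<Longrightarrow> act (single k u c) v = c \<odot>\<^bsub>V\<^esub> \<theta> u v"
  unfolding act_def
  by (intro linear_extension_single[OF V.module_axioms]) (auto intro: linear_maps_closed[OF \<theta>_linear])

lemmas \<theta> = linear_mapsD[OF \<theta>_linear]

lemma act_algebra_module: "algebra_module k F V act"
  unfolding algebra_module_def algebra_module_axioms_def
proof (intro conjI allI impI V.module_axioms)
  fix f v w assume f: "f \<in> carrier F" and v: "v \<in> carrier V" and w: "w \<in> carrier V"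
  show "act f (v \<oplus>\<^bsub>V\<^esub> w) = act f v \<oplus>\<^bsub>V\<^esub> act f w"
    using f by (induction rule: F_induct)
      (use v w in \<open>simp_all add: act_zero_left act_left act_single \<theta> V.smult_r_distr V.M.a_ac\<close>)
next
  fix f c v assume f: "f \<in> carrier F" and c: "c \<in> carrier k" and v: "v \<in> carrier V"
  show "act f (c \<odot>\<^bsub>V\<^esub> v) = c \<odot>\<^bsub>V\<^esub> act f v"
    using f by (induction rule: F_induct)
      (use c v in \<open>simp_all add: act_zero_left act_left act_single \<theta> V.smult_r_distr
        V.smult_assoc1[symmetric] m_comm\<close>)
next
  fix f g v assume f: "f \<in> carrier F" and g: "g \<in> carrier F" and v: "v \<in> carrier V"
  have 1: "act (single k u c \<otimes>\<^bsub>F\<^esub> g) v = c \<odot>\<^bsub>V\<^esub> \<theta> u (act g v)" if "u \<in> carrier M" "c \<in> carrier k" for u c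
    using g
  proof (induction rule: F_induct)
    case zero
    then show ?case
      using that v linear_maps_zero[OF V.module_axioms V.module_axioms \<theta>_linear[OF that(1)]]
      by (simp add: F_r_null act_zero_left)
  next
    case (add g u' c')
    then show ?case using that v
      by (simp add: F_r_distr single_mult F_mult_closed act_left act_single \<theta> \<theta>_mult V.smult_r_distr V.smult_assoc1)
  qed
  show "act (f \<otimes>\<^bsub>F\<^esub> g) v = act f (act g v)"
    using f
  proof (induction rule: F_induct)
    case zero
    then show ?case using g v by (simp add: F_l_null act_zero_left act_left)
  next
    case (add f u c)
    then show ?case using g v by (simp add: F_l_distr F_mult_closed act_left 1 act_single)
  qed
qed (auto simp: act_left F_simps(4) act_single \<theta>_one)

end

text \<open>The elements acting by zero form a two-sided ideal. It contains \<open>S\<close>, hence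
  the ideal generated by \<open>S\<close>, and no description of that ideal is needed.\<close>

lemma quotient_representation:
  assumes "assoc_algebra k B" "algebra_module k B V act" "S \<subseteq> carrier B"
    and "\<And>s v. \<lbrakk>s \<in> S; v \<in> carrier V\<rbrakk> \<Longrightarrow> act s v = \<zero>\<^bsub>V\<^esub>"
  shows "\<exists>act. algebra_module k (quotient_algebra B (Idl\<^bsub>B\<^esub> S)) V act"
proof -
  interpret B: assoc_algebra k B by fact
  interpret V: algebra_module k B V act by fact
  define I where "I = Idl\<^bsub>B\<^esub> S"
  have I: "ideal I B" unfolding I_def by (rule B.A.genideal_ideal) fact
  interpret I: ideal I B by fact
  interpret Q: module_with_submodule k B I by (rule B.ideal_module_with_submodule) fact
  have lin: "(\<lambda>b. act b v) \<in> linear_maps k B V" if "v \<in> carrier V" for v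
    using that by (intro linear_mapsI) (auto simp: V.act_closed V.add_act V.smult_act)
  have z: "act \<zero>\<^bsub>B\<^esub> v = \<zero>\<^bsub>V\<^esub>" if "v \<in> carrier V" for v
    using linear_maps_zero[OF B.module_axioms V.module_axioms lin[OF that]] .
  have rz: "act b \<zero>\<^bsub>V\<^esub> = \<zero>\<^bsub>V\<^esub>" if "b \<in> carrier B" for b
    using V.act_add[OF that V.M.zero_closed V.M.zero_closed] V.act_closed[OF that V.M.zero_closed]
    by (simp add: V.M.add.l_cancel_one')
  have "ideal {b \<in> carrier B. \<forall>v\<in>carrier V. act b v = \<zero>\<^bsub>V\<^esub>} B"
  proof (rule idealI[OF B.A.ring_axioms])
    show "subgroup {b \<in> carrier B. \<forall>v\<in>carrier V. act b v = \<zero>\<^bsub>V\<^esub>} (add_monoid B)"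
    proof (rule B.M.add.subgroupI)
      fix b assume b: "b \<in> {b \<in> carrier B. \<forall>v\<in>carrier V. act b v = \<zero>\<^bsub>V\<^esub>}"
      have "\<ominus>\<^bsub>V\<^esub> \<zero>\<^bsub>V\<^esub> = \<zero>\<^bsub>V\<^esub>"
        using V.M.minus_equality[of "\<zero>\<^bsub>V\<^esub>" "\<zero>\<^bsub>V\<^esub>"] by simp
      then show "\<ominus>\<^bsub>B\<^esub> b \<in> {b \<in> carrier B. \<forall>v\<in>carrier V. act b v = \<zero>\<^bsub>V\<^esub>}"
        using b linear_maps_minus[OF B.module_axioms V.module_axioms lin] by auto
    next
      show "{b \<in> carrier B. \<forall>v\<in>carrier V. act b v = \<zero>\<^bsub>V\<^esub>} \<noteq> {}" using z by blast
    qed (auto simp: V.add_act)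
  qed (auto simp: V.mult_act V.act_closed rz)
  then have "I \<subseteq> {b \<in> carrier B. \<forall>v\<in>carrier V. act b v = \<zero>\<^bsub>V\<^esub>}"
    unfolding I_def using assms(3,4) by (intro B.A.genideal_minimal) auto
  then have kill: "act b v = \<zero>\<^bsub>V\<^esub>" if "b \<in> I" "v \<in> carrier V" for b v
    using that by blast
  define act' where "act' Y v = act (SOME y. y \<in> Y) v" for Y v
  have act': "act' (I +>\<^bsub>B\<^esub> b) v = act b v" if b: "b \<in> carrier B" and v: "v \<in> carrier V" for b v
  proof -
    define c where "c = (SOME c. c \<in> I +>\<^bsub>B\<^esub> b)"
    have "c \<in> I +>\<^bsub>B\<^esub> b"
      unfolding c_def by (rule someI[of "\<lambda>c. c \<in> I +>\<^bsub>B\<^esub> b", OF I.a_rcos_self[OF b]])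
    then obtain h where h: "h \<in> I" "c = h \<oplus>\<^bsub>B\<^esub> b" by (auto simp: a_r_coset_def')
    then show ?thesis
      using b v I.Icarr[OF h(1)] by (simp add: act'_def c_def[symmetric] V.add_act kill V.act_closed)
  qed
  have one: "\<one>\<^bsub>quotient_algebra B I\<^esub> = I +>\<^bsub>B\<^esub> \<one>\<^bsub>B\<^esub>" by (simp add: quotient_algebra_simps)
  have "algebra_module k (quotient_algebra B I) V act'"
    unfolding algebra_module_def algebra_module_axioms_def
    by (intro conjI allI impI V.module_axioms)
      (auto elim!: Q.quotient_cases simp: Q.coset_simps B.coset_mult[OF I] act' one V.act_closed
        V.act_add V.act_smult V.add_act V.smult_act V.mult_act V.one_act)
  then show ?thesis unfolding I_def by blast
qed

section \<open>Tensor products of commuting representations\<close>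

lemma monoid_product_group:
  assumes "\<And>j. j \<in> I \<Longrightarrow> Group.monoid (B j)"
  shows "Group.monoid (product_group I B)"
proof (rule monoidI)
  fix x y z assume x: "x \<in> carrier (product_group I B)" "y \<in> carrier (product_group I B)" "z \<in> carrier (product_group I B)"
  show "x \<otimes>\<^bsub>product_group I B\<^esub> y \<in> carrier (product_group I B)"
    using x assms by (auto simp: PiE_iff monoid.m_closed)
  show "x \<otimes>\<^bsub>product_group I B\<^esub> y \<otimes>\<^bsub>product_group I B\<^esub> z = x \<otimes>\<^bsub>product_group I B\<^esub> (y \<otimes>\<^bsub>product_group I B\<^esub> z)"
    using x assms by (auto simp: PiE_iff monoid.m_assoc intro!: restrict_ext)
next
  show "\<one>\<^bsub>product_group I B\<^esub> \<in> carrier (product_group I B)"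
    using assms by (auto simp: monoid.one_closed)
next
  fix x assume x: "x \<in> carrier (product_group I B)"
  show "\<one>\<^bsub>product_group I B\<^esub> \<otimes>\<^bsub>product_group I B\<^esub> x = x" "x \<otimes>\<^bsub>product_group I B\<^esub> \<one>\<^bsub>product_group I B\<^esub> = x"
    using x assms by (auto simp: PiE_iff fun_eq_iff extensional_def monoid.l_one monoid.r_one restrict_def)
qed

text \<open>The indices form a list because a pure tensor acts as a composition, for which an order
  must be fixed; commutation across distinct indices makes products of pure tensors act
  correctly.\<close>

locale commuting_weyl_operators = V: module k V
  for k :: "('k, 'x) ring_scheme" (structure) and V :: "('k, 'v, 'z) module_scheme" +
  fixes p :: nat and js :: "'i list" and e :: "'i \<Rightarrow> nat"
    and xop :: "'i \<Rightarrow> 'v \<Rightarrow> 'v" and D :: "'i \<Rightarrow> nat \<Rightarrow> 'v \<Rightarrow> 'v"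
  assumes weyl_operators: "j \<in> set js \<Longrightarrow> weyl_operators k V (p ^ e j) (xop j) (D j)"
    and distinct: "distinct js"
    and x_x: "\<lbrakk>j \<in> set js; l \<in> set js; j \<noteq> l; v \<in> carrier V\<rbrakk> \<Longrightarrow> xop j (xop l v) = xop l (xop j v)"
    and x_D: "\<lbrakk>j \<in> set js; l \<in> set js; j \<noteq> l; v \<in> carrier V\<rbrakk> \<Longrightarrow> xop j (D l m v) = D l m (xop j v)"
    and D_D: "\<lbrakk>j \<in> set js; l \<in> set js; j \<noteq> l; v \<in> carrier V\<rbrakk> \<Longrightarrow> D j m (D l m' v) = D l m' (D j m v)"
begin

definition factor_act where "factor_act j = weyl_operators.weyl_act k V (p ^ e j) (xop j) (D j)"

lemma factor_act_linear:
  assumes "j \<in> set js" "w \<in> carrier (weyl k)"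
  shows "factor_act j w \<in> linear_maps k V V"
  unfolding factor_act_def by (rule weyl_operators.weyl_act_linear[OF weyl_operators]) fact+

text \<open>\<open>weyl_act_commutes\<close> is applied twice: the generators of factor
  \<open>l\<close> commute with those of factor \<open>j\<close>, hence with all of factor
  \<open>j\<close>; hence every element of factor \<open>j\<close> commutes with all of factor
  \<open>l\<close>.\<close>

lemma factor_act_commute:
  assumes j: "j \<in> set js" and l: "l \<in> set js" and jl: "j \<noteq> l" and w: "w \<in> carrier (weyl k)"
    and w': "w' \<in> carrier (weyl k)" and v: "v \<in> carrier V"
  shows "factor_act j w (factor_act l w' v) = factor_act l w' (factor_act j w v)"
proof -
  interpret J: weyl_operators k V "p ^ e j" "xop j" "D j" by (rule weyl_operators[OF j])
  interpret L: weyl_operators k V "p ^ e l" "xop l" "D l" by (rule weyl_operators[OF l])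
  show ?thesis
    unfolding factor_act_def
  proof (rule L.weyl_act_commutes[OF J.weyl_act_linear[OF w] _ _ v w'])
    show "J.weyl_act w (xop l v) = xop l (J.weyl_act w v)" if "v \<in> carrier V" for v
      using j l jl that w
      by (intro J.weyl_act_commutes[OF L.X_linear, symmetric]) (auto simp: x_x x_D)
    show "J.weyl_act w (D l m v) = D l m (J.weyl_act w v)" if "v \<in> carrier V" for m v
      using j l jl that w
      by (intro J.weyl_act_commutes[OF L.D_linear, symmetric]) (auto simp: x_D D_D)
  qed
qed

definition iterated_act where "iterated_act ls b v = foldr (\<lambda>j. factor_act j (b j)) ls v"

lemma iterated_act_simps:
  "iterated_act [] b v = v" "iterated_act (j # ls) b v = factor_act j (b j) (iterated_act ls b v)"
  by (simp_all add: iterated_act_def)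

lemma iterated_act_linear:
  assumes "set ls \<subseteq> set js" "\<And>j. j \<in> set ls \<Longrightarrow> b j \<in> carrier (weyl k)"
  shows "iterated_act ls b \<in> linear_maps k V V"
  using assms
proof (induction ls)
  case Nil
  have "iterated_act [] b = (\<lambda>v. v)" by (simp add: iterated_act_simps fun_eq_iff)
  then show ?case by (simp add: linear_maps_id)
next
  case (Cons j ls)
  have "iterated_act (j # ls) b = (\<lambda>v. factor_act j (b j) (iterated_act ls b v))"
    by (simp add: iterated_act_simps fun_eq_iff)
  then show ?case
    using Cons factor_act_linear[of j "b j"] by (simp add: linear_maps_comp)
qed

lemma iterated_act_commute:
  assumes "set ls \<subseteq> set js" "l \<in> set js" "l \<notin> set ls" "\<And>j. j \<in> set ls \<Longrightarrow> b j \<in> carrier (weyl k)"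
    "w \<in> carrier (weyl k)" "v \<in> carrier V"
  shows "factor_act l w (iterated_act ls b v) = iterated_act ls b (factor_act l w v)"
  using assms
proof (induction ls)
  case (Cons j ls)
  have "iterated_act ls b v \<in> carrier V"
    using Cons.prems by (intro linear_maps_closed[OF iterated_act_linear]) auto
  then show ?case
    using Cons by (simp add: iterated_act_simps factor_act_commute)
qed (simp add: iterated_act_simps)

abbreviation "B j \<equiv> weyl_sub p k (e j)"
abbreviation "M \<equiv> product_group (set js) B"

lemma B_weyl: "\<lbrakk>j \<in> set js; w \<in> carrier (B j)\<rbrakk> \<Longrightarrow> w \<in> carrier (weyl k)"
  by (rule weyl_operators.weyl_sub_subset[OF weyl_operators refl])

lemma M_weyl: "\<lbrakk>b \<in> carrier M; j \<in> set js\<rbrakk> \<Longrightarrow> b j \<in> carrier (weyl k)"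
  by (rule B_weyl) auto

lemma iterated_act_mult:
  assumes "set ls \<subseteq> set js" "distinct ls" "b \<in> carrier M" "b' \<in> carrier M" "v \<in> carrier V"
  shows "iterated_act ls (b \<otimes>\<^bsub>M\<^esub> b') v = iterated_act ls b (iterated_act ls b' v)"
  using assms(1,2)
proof (induction ls)
  case (Cons j ls)
  have j: "j \<in> set js" using Cons.prems by simp
  have lin: "iterated_act ls b \<in> linear_maps k V V" "iterated_act ls b' \<in> linear_maps k V V"
    using Cons.prems assms(3,4) M_weyl by (auto intro!: iterated_act_linear)
  note cl = linear_maps_closed[OF lin(1)] linear_maps_closed[OF lin(2)]
    linear_maps_closed[OF factor_act_linear[OF j M_weyl[OF assms(4) j]]]
  have IH: "iterated_act ls (b \<otimes>\<^bsub>M\<^esub> b') v = iterated_act ls b (iterated_act ls b' v)"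
    by (rule Cons.IH) (use Cons.prems in auto)
  have "(b \<otimes>\<^bsub>M\<^esub> b') j = b j \<otimes>\<^bsub>weyl k\<^esub> b' j"
    using j by (simp add: weyl_sub_simps)
  then have "iterated_act (j # ls) (b \<otimes>\<^bsub>M\<^esub> b') v =
      factor_act j (b j \<otimes>\<^bsub>weyl k\<^esub> b' j) (iterated_act ls b (iterated_act ls b' v))"
    by (simp only: iterated_act_simps IH)
  also have "\<dots> = factor_act j (b j) (factor_act j (b' j) (iterated_act ls b (iterated_act ls b' v)))"
    unfolding factor_act_def using j assms(3-5) M_weyl[OF assms(4) j] cl
    by (intro weyl_operators.weyl_sub_act[OF weyl_operators refl]) auto
  \<comment> \<open>The action of \<open>b' j\<close> slides past that of \<open>b\<close> on the
    remaining indices, among which \<open>j\<close> does not occur.\<close>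
  also have "\<dots> = factor_act j (b j) (iterated_act ls b (factor_act j (b' j) (iterated_act ls b' v)))"
    using Cons.prems assms(3-5) M_weyl cl by (subst iterated_act_commute) auto
  finally show ?case by (simp only: iterated_act_simps)
qed (simp add: iterated_act_simps)

lemma iterated_act_one:
  assumes "set ls \<subseteq> set js" "v \<in> carrier V"
  shows "iterated_act ls \<one>\<^bsub>M\<^esub> v = v"
  using assms(1)
proof (induction ls)
  case (Cons j ls)
  then show ?case
    using assms(2) weyl_operators.weyl_act_one[OF weyl_operators]
    by (simp add: iterated_act_simps weyl_sub_simps factor_act_def)
qed (simp add: iterated_act_simps)

lemma iterated_act_cong:
  "(\<And>j. j \<in> set ls \<Longrightarrow> b j = b' j) \<Longrightarrow> iterated_act ls b v = iterated_act ls b' v"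
  unfolding iterated_act_def by (intro foldr_cong) auto

text \<open>Multilinearity in the slot \<open>l\<close>, which is what makes the tensor relations
  act by zero. Distinctness ensures that the slot is met only once along the list.\<close>

lemma iterated_act_update:
  assumes "set ls \<subseteq> set js" "distinct ls" "l \<in> set ls" "b \<in> carrier M" "v \<in> carrier V"
    and w: "w \<in> carrier (weyl k)" "w' \<in> carrier (weyl k)" and c: "c \<in> carrier k"
  shows "iterated_act ls (b(l := w \<oplus>\<^bsub>weyl k\<^esub> w')) v =
      iterated_act ls (b(l := w)) v \<oplus>\<^bsub>V\<^esub> iterated_act ls (b(l := w')) v" (is ?add)
    and "iterated_act ls (b(l := c \<odot>\<^bsub>weyl k\<^esub> w)) v = c \<odot>\<^bsub>V\<^esub> iterated_act ls (b(l := w)) v" (is ?smult)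
proof -
  have "?add \<and> ?smult"
    using assms(1-3)
  proof (induction ls)
    case (Cons j ls)
    have j: "j \<in> set js" using Cons.prems by simp
    interpret J: weyl_operators k V "p ^ e j" "xop j" "D j" by (rule weyl_operators[OF j])
    have bw: "b j' \<in> carrier (weyl k)" if "j' \<in> set js" for j' using M_weyl assms(4) that by blast
    have cl: "iterated_act ls (b(l := y)) v \<in> carrier V" if "y \<in> carrier (weyl k)" for y
      using that Cons.prems bw assms(5) by (intro linear_maps_closed[OF iterated_act_linear]) auto
    show ?case
    proof (cases "j = l")
      case True
      have eq: "iterated_act ls (b(l := y)) v = iterated_act ls b v" for y
        using True Cons.prems by (intro iterated_act_cong) auto
      have "iterated_act ls b v \<in> carrier V" using cl[OF w(1)] by (simp only: eq)
      then show ?thesis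
        unfolding iterated_act_simps eq factor_act_def using True[symmetric] w c
        by (simp add: J.weyl_act_add J.weyl_act_smult)
    next
      case False
      have IH: "iterated_act ls (b(l := w \<oplus>\<^bsub>weyl k\<^esub> w')) v = iterated_act ls (b(l := w)) v \<oplus>\<^bsub>V\<^esub> iterated_act ls (b(l := w')) v"
        "iterated_act ls (b(l := c \<odot>\<^bsub>weyl k\<^esub> w)) v = c \<odot>\<^bsub>V\<^esub> iterated_act ls (b(l := w)) v"
        by (rule Cons.IH[THEN conjunct1] Cons.IH[THEN conjunct2]; use False Cons.prems in auto)+
      have bj: "(b(l := y)) j = b j" for y using False by simp
      note lin = linear_mapsD[OF factor_act_linear[OF j bw[OF j]]]
      show ?thesis
        unfolding iterated_act_simps IH bj lin(2)[OF cl[OF w(1)] cl[OF w(2)]] lin(3)[OF c cl[OF w(1)]] by simp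
    qed
  qed simp
  then show ?add and ?smult
    by auto
qed

text \<open>Composing the factors represents the product monoid of the \<open>B j\<close>, hence its
  monoid algebra; the multilinear relations act by zero, so the representation descends to the
  tensor product.\<close>

theorem tensor_module: "\<exists>act. algebra_module k (tensor_algebra k (set js) B) V act"
proof -
  have mon: "Group.monoid M"
    by (rule monoid_product_group) (rule weyl_operators.weyl_sub_monoid[OF weyl_operators refl])
  interpret rep: monoid_representation k M V "iterated_act js"
    using mon M_weyl
    by (auto simp: monoid_representation_def monoid_alg_def V.R.is_cring V.module_axioms
        monoid_representation_axioms_def iterated_act_linear iterated_act_mult[OF subset_refl distinct]
        iterated_act_one[OF subset_refl] simp del: carrier_product_group mult_product_group one_product_group)
  interpret FA: assoc_algebra k rep.F by (rule rep.F_assoc_algebra)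
  have upd: "b(j := w) \<in> carrier M" if "b \<in> carrier M" "j \<in> set js" "w \<in> carrier (B j)" for b j w
    using that by (auto simp: PiE_iff extensional_def)
  have Badd: "w \<oplus>\<^bsub>B j\<^esub> w' \<in> carrier (B j)" if "j \<in> set js" "w \<in> carrier (B j)" "w' \<in> carrier (B j)" for j w w'
    using weyl_operators.weyl_sub_add[OF weyl_operators[OF that(1)] refl that(2,3)] by (simp add: weyl_sub_simps)
  have Bsmult: "c \<odot>\<^bsub>B j\<^esub> w \<in> carrier (B j)" if "j \<in> set js" "c \<in> carrier k" "w \<in> carrier (B j)" for j c w
    using weyl_operators.weyl_sub_smult[OF weyl_operators[OF that(1)] refl that(2,3)] by (simp add: weyl_sub_simps)
  have basis: "basis_elem k b \<in> carrier rep.F" if "b \<in> carrier M" for b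
    unfolding basis_elem_single using that by (rule rep.single_closed) simp
  have act_basis: "rep.act (basis_elem k b) v = iterated_act js b v" if "b \<in> carrier M" "v \<in> carrier V" for b v
    unfolding basis_elem_single using that M_weyl linear_maps_closed[OF rep.\<theta>_linear]
    by (subst rep.act_single) auto
  have diff: "rep.act (f \<ominus>\<^bsub>rep.F\<^esub> g) v = \<zero>\<^bsub>V\<^esub>"
    if "f \<in> carrier rep.F" "g \<in> carrier rep.F" "v \<in> carrier V" "rep.act f v = rep.act g v" for f g v
    using linear_maps_diff[OF FA.module_axioms V.module_axioms rep.act_linear_left[OF that(3)] that(1,2)] that
      rep.act_left(1)[OF that(3) that(2)] by (simp add: a_minus_def V.M.r_neg)
  have upd_act: "iterated_act js (b(j := w \<oplus>\<^bsub>B j\<^esub> w')) v = iterated_act js (b(j := w)) v \<oplus>\<^bsub>V\<^esub> iterated_act js (b(j := w')) v"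
      "iterated_act js (b(j := c \<odot>\<^bsub>B j\<^esub> w)) v = c \<odot>\<^bsub>V\<^esub> iterated_act js (b(j := w)) v"
    if "b \<in> carrier M" "j \<in> set js" "w \<in> carrier (B j)" "w' \<in> carrier (B j)" "v \<in> carrier V" "c \<in> carrier k"
    for b j w w' v c
    using iterated_act_update[OF subset_refl distinct that(2,1,5) B_weyl[OF that(2,3)] B_weyl[OF that(2,4)] that(6)]
    by (simp_all add: weyl_sub_simps)
  have "\<exists>act. algebra_module k (quotient_algebra rep.F (Idl\<^bsub>rep.F\<^esub> (multilinear_relations k (set js) B))) V act"
  proof (rule quotient_representation[OF rep.F_assoc_algebra rep.act_algebra_module])
    show "multilinear_relations k (set js) B \<subseteq> carrier rep.F"
      unfolding multilinear_relations_def Let_def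
      by (auto intro!: FA.M.minus_closed FA.M.a_closed FA.smult_closed basis upd Badd Bsmult simp del: carrier_product_group)
    fix s v assume s: "s \<in> multilinear_relations k (set js) B" and v: "v \<in> carrier V"
    from s consider
        b j w w' where "b \<in> carrier M" "j \<in> set js" "w \<in> carrier (B j)" "w' \<in> carrier (B j)"
          "s = basis_elem k (b(j := w \<oplus>\<^bsub>B j\<^esub> w')) \<ominus>\<^bsub>rep.F\<^esub> (basis_elem k (b(j := w)) \<oplus>\<^bsub>rep.F\<^esub> basis_elem k (b(j := w')))"
      | b j w c where "b \<in> carrier M" "j \<in> set js" "w \<in> carrier (B j)" "c \<in> carrier k"
          "s = basis_elem k (b(j := c \<odot>\<^bsub>B j\<^esub> w)) \<ominus>\<^bsub>rep.F\<^esub> c \<odot>\<^bsub>rep.F\<^esub> basis_elem k (b(j := w))"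
      unfolding multilinear_relations_def Let_def by blast
    then show "rep.act s v = \<zero>\<^bsub>V\<^esub>"
    proof cases
      case 1
      then show ?thesis
        using v upd_act(1)[OF 1(1-4) v, of \<zero>]
        by (auto intro!: diff simp: basis upd Badd rep.act_left act_basis simp del: carrier_product_group)
    next
      case 2
      then show ?thesis
        using v upd_act(2)[OF 2(1-3,3) v 2(4)]
        by (auto intro!: diff simp: basis upd Bsmult rep.act_left act_basis simp del: carrier_product_group)
    qed
  qed
  then show ?thesis by (simp add: tensor_algebra_def Let_def)
qed

end

section \<open>The lower central series\<close>

lemma submodule_finsum:
  assumes "module k M" "submodule W k M" "finite S" "\<And>s. s \<in> S \<Longrightarrow> g s \<in> W"
  shows "finsum M g S \<in> W"
proof -
  interpret M: module k M by fact
  interpret W: submodule W k M by fact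
  have sub: "W \<subseteq> carrier M" using W.subset by simp
  show ?thesis
    using assms(3,4)
  proof (induction S rule: finite_induct)
    case empty
    then show ?case using W.one_closed by simp
  next
    case (insert a S)
    then show ?case
      using sub W.m_closed by (subst M.finsum_insert) (auto simp: Pi_iff subset_iff)
  qed
qed

context module
begin

lemma linear_span_submodule:
  assumes "S \<subseteq> carrier M"
  shows "submodule (linear_span R M S) R M"
proof -
  let ?V = "{V. submodule V R M \<and> S \<subseteq> V}"
  have "subgroup (\<Inter>?V) (add_monoid M)"
    using assms carrier_is_submodule
    by (intro M.add.subgroups_Inter) (auto simp: submodule_def)
  then show ?thesis
    unfolding linear_span_def submodule_def submodule_axioms_def by blast
qed

lemma linear_span_superset: "S \<subseteq> linear_span R M S"
  unfolding linear_span_def by blast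

lemma linear_span_minimal: "\<lbrakk>submodule W R M; S \<subseteq> W\<rbrakk> \<Longrightarrow> linear_span R M S \<subseteq> W"
  unfolding linear_span_def by blast

text \<open>Lets inclusions of spans be checked on generators: if \<open>T\<close> maps the
  generators into \<open>W\<close>, it maps their span into \<open>W\<close>.\<close>

lemma submodule_vimage:
  assumes "T \<in> linear_maps R M M" "submodule W R M"
  shows "submodule {x \<in> carrier M. T x \<in> W} R M"
proof -
  interpret W: submodule W R M by fact
  note T = linear_mapsD[OF assms(1)] linear_maps_zero[OF module_axioms module_axioms assms(1)]
    linear_maps_minus[OF module_axioms module_axioms assms(1)]
  have neg: "\<ominus>\<^bsub>M\<^esub> w \<in> W" if "w \<in> W" for w
    using W.m_inv_closed[OF that] by (simp add: a_inv_def)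
  show ?thesis
    using W.one_closed W.m_closed by (intro submoduleI) (auto simp: T neg)
qed

end

section \<open>Commutators, the series L_i and the ideals M_i\<close>

context assoc_algebra
begin

definition comm :: "'a \<Rightarrow> 'a \<Rightarrow> 'a"
  where "comm a b = a \<otimes> b \<ominus> b \<otimes> a"

lemma comm_closed [simp, intro]: "\<lbrakk>a \<in> carrier A; b \<in> carrier A\<rbrakk> \<Longrightarrow> comm a b \<in> carrier A"
  by (simp add: comm_def)

abbreviation "L \<equiv> lower_central k A"
abbreviation "MI \<equiv> lcs_ideal k A"

lemma L_Suc_Suc: "L (Suc (Suc i)) = linear_span k A {comm a l | a l. a \<in> carrier A \<and> l \<in> L (Suc i)}"
  by (simp add: comm_def)

lemma L_submodule: "submodule (L (Suc i)) k A"
proof (induction i)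
  case 0
  then show ?case by (simp add: carrier_is_submodule)
next
  case (Suc i)
  then show ?case
    unfolding L_Suc_Suc using submoduleE(1)[OF Suc.IH] by (intro linear_span_submodule) auto
qed

lemma L_closed: "l \<in> L (Suc i) \<Longrightarrow> l \<in> carrier A"
  using submoduleE(1)[OF L_submodule] by blast

lemma comm_mult_left:
  "\<lbrakk>a \<in> carrier A; b \<in> carrier A; c \<in> carrier A\<rbrakk> \<Longrightarrow>
    comm (a \<otimes> b) c = a \<otimes> comm b c \<oplus> comm a c \<otimes> b"
  unfolding comm_def by algebra

lemma comm_mult_right:
  "\<lbrakk>a \<in> carrier A; b \<in> carrier A; c \<in> carrier A\<rbrakk> \<Longrightarrow>
    comm c (a \<otimes> b) = comm c a \<otimes> b \<oplus> a \<otimes> comm c b"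
  unfolding comm_def by algebra

lemma comm_add_left:
  "\<lbrakk>a \<in> carrier A; b \<in> carrier A; c \<in> carrier A\<rbrakk> \<Longrightarrow> comm (a \<oplus> b) c = comm a c \<oplus> comm b c"
  unfolding comm_def by algebra

lemma comm_L: "\<lbrakk>a \<in> carrier A; l \<in> L (Suc i)\<rbrakk> \<Longrightarrow> comm a l \<in> L (Suc (Suc i))"
  unfolding L_Suc_Suc by (rule subsetD[OF linear_span_superset]) blast

lemma comm_swap: "\<lbrakk>a \<in> carrier A; b \<in> carrier A\<rbrakk> \<Longrightarrow> comm a b = \<ominus> comm b a"
  unfolding comm_def by algebra

lemma comm_L': "\<lbrakk>a \<in> carrier A; l \<in> L (Suc i)\<rbrakk> \<Longrightarrow> comm l a \<in> L (Suc (Suc i))"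
  using submoduleE(3)[OF L_submodule comm_L[of a l i]] by (subst comm_swap) (auto simp: L_closed)

lemma L_decreasing: "L (Suc (Suc i)) \<subseteq> L (Suc i)"
proof (induction i)
  case 0
  show ?case using submoduleE(1)[OF L_submodule[of "Suc 0"]] by (simp only: lower_central.simps(2))
next
  case (Suc i)
  have "{comm a l | a l. a \<in> carrier A \<and> l \<in> L (Suc (Suc i))} \<subseteq> L (Suc (Suc i))"
    using Suc.IH comm_L by blast
  then show ?case
    unfolding L_Suc_Suc[of "Suc i"] by (rule linear_span_minimal[OF L_submodule])
qed

lemma MI_ideal: "ideal (MI (Suc i)) A"
  unfolding lcs_ideal_def using L_closed by (intro A.genideal_ideal) blast

lemma L_MI: "l \<in> L (Suc i) \<Longrightarrow> l \<in> MI (Suc i)"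
  unfolding lcs_ideal_def using A.genideal_self[of "L (Suc i)"] L_closed by blast

lemma MI_minimal: "\<lbrakk>ideal I A; L (Suc i) \<subseteq> I\<rbrakk> \<Longrightarrow> MI (Suc i) \<subseteq> I"
  unfolding lcs_ideal_def by (rule A.genideal_minimal)

lemma MI_decreasing: "MI (Suc (Suc i)) \<subseteq> MI (Suc i)"
  using L_decreasing L_MI by (intro MI_minimal MI_ideal) blast

lemma MI_closed: "x \<in> MI (Suc i) \<Longrightarrow> x \<in> carrier A"
  using ideal.Icarr[OF MI_ideal] .

lemma MI_zero: "\<zero> \<in> MI (Suc i)"
  by (rule additive_subgroup.zero_closed[OF ideal.axioms(1)[OF MI_ideal]])

lemma MI_add: "\<lbrakk>x \<in> MI (Suc i); y \<in> MI (Suc i)\<rbrakk> \<Longrightarrow> x \<oplus> y \<in> MI (Suc i)"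
  by (rule additive_subgroup.a_closed[OF ideal.axioms(1)[OF MI_ideal]])

lemma MI_minus: "x \<in> MI (Suc i) \<Longrightarrow> \<ominus> x \<in> MI (Suc i)"
  by (rule additive_subgroup.a_inv_closed[OF ideal.axioms(1)[OF MI_ideal]])

lemma MI_diff: "\<lbrakk>x \<in> MI (Suc i); y \<in> MI (Suc i)\<rbrakk> \<Longrightarrow> x \<ominus> y \<in> MI (Suc i)"
  by (simp add: a_minus_def MI_add MI_minus)

lemma MI_mult: "\<lbrakk>x \<in> MI (Suc i); a \<in> carrier A\<rbrakk> \<Longrightarrow> a \<otimes> x \<in> MI (Suc i)"
  "\<lbrakk>x \<in> MI (Suc i); a \<in> carrier A\<rbrakk> \<Longrightarrow> x \<otimes> a \<in> MI (Suc i)"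
  by (rule ideal.I_l_closed[OF MI_ideal] ideal.I_r_closed[OF MI_ideal]; assumption)+

text \<open>For \<open>l \<in> L\<^sub>i\<close> the derivation \<open>\<delta> = [l, -]\<close> has central values modulo \<open>M\<^sub>i\<^sub>+\<^sub>2\<close>, so expanding
  \<open>[\<delta>(ab), c]\<close> shows that \<open>\<delta>(a) [b, c]\<close> is alternating in \<open>a, b, c\<close>.\<close>

lemma triple_alternating:
  assumes l: "l \<in> L (Suc i)" and a: "a \<in> carrier A" and b: "b \<in> carrier A" and c: "c \<in> carrier A"
  shows "comm l a \<otimes> comm b c \<oplus> comm l b \<otimes> comm a c \<in> MI (Suc (Suc (Suc i)))"
proof -
  let ?M = "MI (Suc (Suc (Suc i)))"
  have lc: "l \<in> carrier A" using l by (rule L_closed)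
  have central: "comm (comm l x) y \<in> ?M" if "x \<in> carrier A" "y \<in> carrier A" for x y
    using that l by (intro L_MI comm_L') auto
  let ?p = "comm l a \<otimes> comm b c" and ?q = "comm l b \<otimes> comm a c"
    and ?r = "comm (comm l a) c \<otimes> b" and ?s = "a \<otimes> comm (comm l b) c"
    and ?t = "comm a c \<otimes> comm l b"
  have cl: "?p \<in> carrier A" "?q \<in> carrier A" "?r \<in> carrier A" "?s \<in> carrier A" "?t \<in> carrier A"
    using lc a b c by simp_all
  have "comm (comm l (a \<otimes> b)) c = (?p \<oplus> ?r) \<oplus> (?s \<oplus> ?t)"
    using lc a b c by (simp add: comm_mult_right comm_add_left comm_mult_left)
  \<comment> \<open>Reversing the factors of \<open>?t\<close> to obtain \<open>?q\<close> costs a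
    commutator that lies in \<open>?M\<close> as well.\<close>
  moreover have "comm (comm l b) (comm a c) = ?q \<ominus> ?t"
    by (simp add: comm_def[of "comm l b"])
  \<comment> \<open>Stated for arbitrary elements, so that normalisation treats the five products as
    atoms instead of expanding the commutators.\<close>
  moreover have "p \<oplus> q = (((p \<oplus> r) \<oplus> (s \<oplus> t) \<ominus> r) \<ominus> s) \<oplus> (q \<ominus> t)"
    if "p \<in> carrier A" "q \<in> carrier A" "r \<in> carrier A" "s \<in> carrier A" "t \<in> carrier A" for p q r s t
    using that by algebra
  ultimately have "?p \<oplus> ?q =
      (comm (comm l (a \<otimes> b)) c \<ominus> comm (comm l a) c \<otimes> b)
      \<ominus> a \<otimes> comm (comm l b) c \<oplus> comm (comm l b) (comm a c)"
    using cl by metis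
  also have "\<dots> \<in> ?M"
    using a b c central[of "a \<otimes> b" c] central[OF b comm_closed[OF a c]]
      MI_mult(2)[OF central[OF a c] b] MI_mult(1)[OF central[OF b c] a]
    by (simp add: MI_add MI_diff)
  finally show ?thesis .
qed

text \<open>Write \<open>e\<close> for [c,d]. Two alternations, first exchanging a with b and then b
  with \<open>e\<close>, turn the product into a multiple of [l,e] modulo the ideal. By the Jacobi
  identity [l,e] = [[l,c],d] + [c,[l,d]], which lies two steps below \<open>l\<close> in the
  series.\<close>

lemma triple_comm_mult_comm:
  assumes l: "l \<in> L (Suc i)" and a: "a \<in> carrier A" and b: "b \<in> carrier A"
    and c: "c \<in> carrier A" and d: "d \<in> carrier A"
  shows "comm l a \<otimes> comm b (comm c d) \<in> MI (Suc (Suc (Suc i)))"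
proof -
  let ?M = "MI (Suc (Suc (Suc i)))" and ?e = "comm c d"
  have lc: "l \<in> carrier A" using l by (rule L_closed)
  have e: "?e \<in> carrier A" using c d by simp
  have "comm l ?e = comm (comm l c) d \<oplus> comm c (comm l d)"
    using lc c d unfolding comm_def by algebra
  also have "\<dots> \<in> ?M"
    using l c d by (intro MI_add L_MI comm_L' comm_L) auto
  finally have le: "comm l ?e \<otimes> comm b a \<in> ?M"
    using a b by (intro MI_mult(2)) auto
  have "comm l a \<otimes> comm b ?e = (comm l a \<otimes> comm b ?e \<oplus> comm l b \<otimes> comm a ?e)
      \<oplus> ((comm l b \<otimes> comm ?e a \<oplus> comm l ?e \<otimes> comm b a) \<ominus> comm l ?e \<otimes> comm b a)"
  proof -
    have "comm l b \<otimes> comm a ?e = \<ominus> (comm l b \<otimes> comm ?e a)"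
      using lc a b e by (subst comm_swap[of a]) (simp_all add: A.r_minus)
    then show ?thesis
      using comm_closed[OF lc a] comm_closed[OF b e] comm_closed[OF lc b] comm_closed[OF e a]
        comm_closed[OF lc e] comm_closed[OF b a]
      by (simp add: a_minus_def M.a_ac M.r_neg M.r_neg1 M.r_neg2 M.minus_add)
  qed
  also have "\<dots> \<in> ?M"
    using a b e l le by (intro MI_add MI_diff triple_alternating) auto
  finally show ?thesis .
qed

text \<open>For \<open>i = 0\<close> the double commutator already lies in M_2. Otherwise
  \<open>L (Suc i)\<close> is spanned by commutators [a,l'] with l' one step higher in the series,
  and \<open>triple_comm_mult_comm\<close> applies to l'.\<close>

lemma comm_comm_mult_L:
  assumes l: "l \<in> L (Suc i)" and b: "b \<in> carrier A" and c: "c \<in> carrier A" and d: "d \<in> carrier A"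
  shows "comm b (comm c d) \<otimes> l \<in> MI (Suc (Suc i)) \<and> l \<otimes> comm b (comm c d) \<in> MI (Suc (Suc i))"
proof (cases i)
  case 0
  have "comm b (comm c d) \<in> MI (Suc (Suc i))"
    unfolding 0 using b c d by (intro L_MI comm_L) auto
  then show ?thesis using L_closed[OF l] by (simp add: MI_mult)
next
  case i: (Suc i')
  let ?M = "MI (Suc (Suc i))" and ?u = "comm b (comm c d)"
  have u: "?u \<in> carrier A" using b c d by simp
  have sm: "submodule ?M k A" by (rule ideal_submodule[OF MI_ideal])
  have lin: "(\<lambda>x. ?u \<otimes> x) \<in> linear_maps k A A" "(\<lambda>x. x \<otimes> ?u) \<in> linear_maps k A A"
    using u by (auto intro!: linear_mapsI simp: A.r_distr A.l_distr smult_mult_right smult_mult_left)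
  have gen: "?u \<otimes> comm a l' \<in> ?M" "comm a l' \<otimes> ?u \<in> ?M"
    if a: "a \<in> carrier A" and l': "l' \<in> L (Suc i')" for a l'
  proof -
    have l'c: "l' \<in> carrier A" using l' by (rule L_closed)
    have "comm l' a \<otimes> ?u \<in> ?M"
      unfolding i using l' a b c d by (rule triple_comm_mult_comm)
    moreover have "comm a l' \<otimes> ?u = \<ominus> (comm l' a \<otimes> ?u)"
      using a l'c u by (subst comm_swap[of a]) (simp_all add: A.l_minus)
    ultimately show 1: "comm a l' \<otimes> ?u \<in> ?M" by (simp add: MI_minus)
    \<comment> \<open>The two orders of multiplication differ by a commutator with an element of
      \<open>L (Suc i)\<close>, so one order follows from the other.\<close>
    have "comm ?u (comm a l') \<in> ?M"
      unfolding i using u a l' by (intro L_MI comm_L) auto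
    moreover have "?u \<otimes> comm a l' = comm ?u (comm a l') \<oplus> comm a l' \<otimes> ?u"
      unfolding comm_def[of ?u] using u comm_closed[OF a l'c] by algebra
    ultimately show "?u \<otimes> comm a l' \<in> ?M" using 1 by (simp add: MI_add)
  qed
  have "L (Suc (Suc i')) \<subseteq> {x \<in> carrier A. ?u \<otimes> x \<in> ?M}"
    unfolding L_Suc_Suc using gen L_closed by (intro linear_span_minimal submodule_vimage[OF lin(1) sm]) auto
  moreover have "L (Suc (Suc i')) \<subseteq> {x \<in> carrier A. x \<otimes> ?u \<in> ?M}"
    unfolding L_Suc_Suc using gen L_closed by (intro linear_span_minimal submodule_vimage[OF lin(2) sm]) auto
  ultimately show ?thesis using l unfolding i by auto
qed

text \<open>Extends a property from L_i to M_i: the elements of M_i having it are shown to form an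
  ideal. Negatives come from multiplication by \<open>\<ominus> \<one>\<close>.\<close>

lemma ideal_subset_idealI:
  assumes "ideal I A" "\<zero> \<in> K" "\<And>x. x \<in> K \<Longrightarrow> x \<in> I"
    and "\<And>x y. \<lbrakk>x \<in> K; y \<in> K\<rbrakk> \<Longrightarrow> x \<oplus> y \<in> K"
    and "\<And>x a. \<lbrakk>x \<in> K; a \<in> carrier A\<rbrakk> \<Longrightarrow> a \<otimes> x \<in> K" "\<And>x a. \<lbrakk>x \<in> K; a \<in> carrier A\<rbrakk> \<Longrightarrow> x \<otimes> a \<in> K"
  shows "ideal K A"
proof (rule idealI[OF A.ring_axioms])
  have sub: "K \<subseteq> carrier A" using assms(3) ideal.Icarr[OF assms(1)] by blast
  show "subgroup K (add_monoid A)"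
  proof (rule M.add.subgroupI)
    fix x assume x: "x \<in> K"
    have "(\<ominus> \<one>) \<otimes> x \<in> K" using x by (intro assms(5)) auto
    then show "\<ominus> x \<in> K" using x sub by (auto simp: A.l_minus)
  qed (use assms sub in auto)
qed (use assms in auto)

text \<open>This is the case \<open>M\<^sub>3 M\<^sub>i \<subseteq> M\<^sub>i\<^sub>+\<^sub>1\<close> of Latyshev's theorem \<open>M\<^sub>i M\<^sub>j \<subseteq> M\<^sub>i\<^sub>+\<^sub>j\<^sub>-\<^sub>2\<close>.\<close>

lemma comm_comm_mult_MI:
  assumes v: "v \<in> MI (Suc i)" and b: "b \<in> carrier A" and c: "c \<in> carrier A" and d: "d \<in> carrier A"
  shows "comm b (comm c d) \<otimes> v \<in> MI (Suc (Suc i)) \<and> v \<otimes> comm b (comm c d) \<in> MI (Suc (Suc i))"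
proof -
  let ?M = "MI (Suc (Suc i))"
  \<comment> \<open>All \<open>b\<close>, \<open>c\<close>, \<open>d\<close> are quantified because
    moving u = [b,[c,d]] past \<open>a\<close> produces [a,u], which has the same shape with entries
    a, b, [c,d].\<close>
  let ?P = "\<lambda>v. \<forall>b\<in>carrier A. \<forall>c\<in>carrier A. \<forall>d\<in>carrier A.
    comm b (comm c d) \<otimes> v \<in> ?M \<and> v \<otimes> comm b (comm c d) \<in> ?M"
  have "ideal {v \<in> MI (Suc i). ?P v} A"
  proof (rule ideal_subset_idealI[OF MI_ideal])
    show "\<zero> \<in> {v \<in> MI (Suc i). ?P v}" by (simp add: MI_zero)
    fix x y assume "x \<in> {v \<in> MI (Suc i). ?P v}" "y \<in> {v \<in> MI (Suc i). ?P v}"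
    then show "x \<oplus> y \<in> {v \<in> MI (Suc i). ?P v}"
      by (auto simp: MI_add A.l_distr A.r_distr MI_closed)
  next
    fix x a assume x: "x \<in> {v \<in> MI (Suc i). ?P v}" and a: "a \<in> carrier A"
    have xc: "x \<in> carrier A" using x MI_closed by blast
    have "comm b (comm c d) \<otimes> (a \<otimes> x) \<in> ?M \<and> (x \<otimes> a) \<otimes> comm b (comm c d) \<in> ?M"
      if b: "b \<in> carrier A" and c: "c \<in> carrier A" and d: "d \<in> carrier A" for b c d
    proof -
      let ?u = "comm b (comm c d)"
      have u: "?u \<in> carrier A" using b c d by simp
      have e: "comm c d \<in> carrier A" using c d by simp
      have "?u \<otimes> x \<in> ?M" "x \<otimes> ?u \<in> ?M" "comm a ?u \<otimes> x \<in> ?M" "x \<otimes> comm a ?u \<in> ?M"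
        using x a b c d e by auto
      moreover have "?u \<otimes> (a \<otimes> x) = a \<otimes> (?u \<otimes> x) \<ominus> comm a ?u \<otimes> x"
        "(x \<otimes> a) \<otimes> ?u = (x \<otimes> ?u) \<otimes> a \<oplus> x \<otimes> comm a ?u"
        unfolding comm_def[of a] using u a xc by algebra+
      ultimately show ?thesis using a by (auto intro: MI_add MI_diff MI_mult)
    qed
    then show "a \<otimes> x \<in> {v \<in> MI (Suc i). ?P v}" "x \<otimes> a \<in> {v \<in> MI (Suc i). ?P v}"
      using x a xc by (auto simp: MI_mult A.m_assoc[symmetric]) (auto simp: MI_mult A.m_assoc)
  qed auto
  moreover have "L (Suc i) \<subseteq> {v \<in> MI (Suc i). ?P v}"
    using L_MI comm_comm_mult_L by blast
  ultimately show ?thesis using MI_minimal v b c d by blast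
qed

text \<open>With e = [c,d], the Leibniz rule gives [e,ax] = a[e,x] - [a,e]x. The last term is a
  double commutator times an element of M_i, which \<open>comm_comm_mult_MI\<close> controls; on L_i
  itself the claim is the definition of the next term.\<close>

lemma comm_comm_MI:
  assumes v: "v \<in> MI (Suc i)" and c: "c \<in> carrier A" and d: "d \<in> carrier A"
  shows "comm (comm c d) v \<in> MI (Suc (Suc i))"
proof -
  let ?M = "MI (Suc (Suc i))" and ?e = "comm c d"
  have e: "?e \<in> carrier A" using c d by simp
  have "ideal {v \<in> MI (Suc i). comm ?e v \<in> ?M} A"
  proof (rule ideal_subset_idealI[OF MI_ideal])
    show "\<zero> \<in> {v \<in> MI (Suc i). comm ?e v \<in> ?M}"
      using e by (simp add: comm_def[of ?e] a_minus_def M.r_neg MI_zero)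
    fix x y assume xy: "x \<in> {v \<in> MI (Suc i). comm ?e v \<in> ?M}" "y \<in> {v \<in> MI (Suc i). comm ?e v \<in> ?M}"
    have "x \<in> carrier A" "y \<in> carrier A" using xy MI_closed by auto
    then have "comm ?e (x \<oplus> y) = comm ?e x \<oplus> comm ?e y"
      unfolding comm_def[of ?e] using e by algebra
    then show "x \<oplus> y \<in> {v \<in> MI (Suc i). comm ?e v \<in> ?M}"
      using xy by (auto simp: MI_add)
  next
    fix x a assume x: "x \<in> {v \<in> MI (Suc i). comm ?e v \<in> ?M}" and a: "a \<in> carrier A"
    have xc: "x \<in> carrier A" using x MI_closed by blast
    have ae: "comm a ?e \<otimes> x \<in> ?M" "x \<otimes> comm a ?e \<in> ?M"
      using comm_comm_mult_MI[of x i a c d] x a c d by auto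
    have "comm ?e (a \<otimes> x) = a \<otimes> comm ?e x \<ominus> comm a ?e \<otimes> x"
      "comm ?e (x \<otimes> a) = comm ?e x \<otimes> a \<ominus> x \<otimes> comm a ?e"
      unfolding comm_def[of ?e] comm_def[of a] using e a xc by algebra+
    then show "a \<otimes> x \<in> {v \<in> MI (Suc i). comm ?e v \<in> ?M}" "x \<otimes> a \<in> {v \<in> MI (Suc i). comm ?e v \<in> ?M}"
      using x a ae by (auto simp: MI_diff MI_mult)
  qed auto
  moreover have "L (Suc i) \<subseteq> {v \<in> MI (Suc i). comm ?e v \<in> ?M}"
    using L_MI comm_L e by blast
  ultimately show ?thesis using MI_minimal v by blast
qed

end

section \<open>Higher derivations\<close>

text \<open>A Hasse-Schmidt derivation of finite length: for \<open>q > 0\<close> it says that a ->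
  sum of d_m(a) t^m is an algebra homomorphism into A[t]/(t^q) lifting the identity. The product
  rule is imposed only below \<open>q\<close>.\<close>

locale higher_derivation = assoc_algebra k A
  for k :: "('k, 'x) ring_scheme" and A :: "('k, 'a, 'y) module_scheme" (structure) +
  fixes q :: nat and d :: "nat \<Rightarrow> 'a \<Rightarrow> 'a"
  assumes d_linear: "d m \<in> linear_maps k A A"
    and d_0: "a \<in> carrier A \<Longrightarrow> d 0 a = a"
    and d_mult: "\<lbrakk>m < q; a \<in> carrier A; b \<in> carrier A\<rbrakk> \<Longrightarrow>
      d m (a \<otimes> b) = (\<Oplus>s\<in>{..m}. d s a \<otimes> d (m - s) b)"
begin

lemmas d_D = linear_mapsD[OF d_linear]
lemmas d_zero = linear_maps_zero[OF module_axioms module_axioms d_linear]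
lemmas d_diff = linear_maps_diff[OF module_axioms module_axioms d_linear]

lemma finsum_reverse:
  assumes "\<And>s. s \<le> m \<Longrightarrow> g s \<in> carrier A"
  shows "(\<Oplus>s\<in>{..m}. g s) = (\<Oplus>s\<in>{..m::nat}. g (m - s))"
proof -
  have "(\<lambda>s. m - s) ` {..m} = {..m}"
  proof (intro equalityI subsetI)
    fix y assume "y \<in> {..m}"
    then show "y \<in> (\<lambda>s. m - s) ` {..m}" by (intro image_eqI[of _ _ "m - y"]) auto
  qed auto
  moreover have "inj_on (\<lambda>s. m - s) {..m}"
    by (auto simp: inj_on_def)
  ultimately show ?thesis
    using M.finsum_reindex[of g "\<lambda>s. m - s" "{..m}"] assms by auto
qed

lemma d_comm:
  assumes m: "m < q" and a: "a \<in> carrier A" and b: "b \<in> carrier A"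
  shows "d m (comm a b) = (\<Oplus>s\<in>{..m}. comm (d s a) (d (m - s) b))"
proof -
  \<comment> \<open>Reversing the summation makes the terms of \<open>b \<otimes> a\<close> match
    those of \<open>a \<otimes> b\<close> one by one.\<close>
  have "d m (b \<otimes> a) = (\<Oplus>s\<in>{..m}. d (m - s) b \<otimes> d (m - (m - s)) a)"
    using a b by (simp add: d_mult[OF m b a] finsum_reverse[of m "\<lambda>s. d s b \<otimes> d (m - s) a"] d_D)
  also have "\<dots> = (\<Oplus>s\<in>{..m}. d (m - s) b \<otimes> d s a)"
    using a b by (intro M.finsum_cong') (auto simp: d_D)
  finally have ba: "d m (b \<otimes> a) = (\<Oplus>s\<in>{..m}. d (m - s) b \<otimes> d s a)" .
  have neg: "(\<lambda>v. \<ominus> v) \<in> linear_maps k A A"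
    by (auto intro!: linear_mapsI simp: M.minus_add smult_r_minus)
  have "(\<Oplus>s\<in>{..m}. comm (d s a) (d (m - s) b)) = (\<Oplus>s\<in>{..m}. d s a \<otimes> d (m - s) b)
      \<oplus> (\<Oplus>s\<in>{..m}. \<ominus> (d (m - s) b \<otimes> d s a))"
    using a b unfolding comm_def a_minus_def by (intro M.finsum_addf) (auto simp: d_D)
  also have "(\<Oplus>s\<in>{..m}. \<ominus> (d (m - s) b \<otimes> d s a)) = \<ominus> d m (b \<otimes> a)"
    unfolding ba using a b
    by (intro linear_maps_finsum[OF module_axioms module_axioms neg, symmetric]) (auto simp: d_D)
  finally show ?thesis
    using a b m by (simp add: comm_def d_diff d_mult a_minus_def[symmetric])
qed

text \<open>By \<open>d_comm\<close>, d_m [a,l] is a sum of commutators [d_s a, d_(m-s) l]. All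
  orders up to \<open>m\<close> occur on \<open>l\<close>, so the induction keeps \<open>m\<close>
  arbitrary.\<close>

lemma d_L:
  assumes "l \<in> L (Suc i)" "m < q"
  shows "d m l \<in> L (Suc i)"
  using assms
proof (induction i arbitrary: l m)
  case 0
  then show ?case by (simp add: d_D)
next
  case (Suc i)
  have "L (Suc (Suc i)) \<subseteq> {x \<in> carrier A. d m x \<in> L (Suc (Suc i))}"
    unfolding L_Suc_Suc[of i]
  proof (intro linear_span_minimal submodule_vimage[OF d_linear])
    show "submodule (linear_span k A {comm a l | a l. a \<in> carrier A \<and> l \<in> L (Suc i)}) k A"
      using L_submodule[of "Suc i"] unfolding L_Suc_Suc .
    show "{comm a l | a l. a \<in> carrier A \<and> l \<in> L (Suc i)} \<subseteq>
      {x \<in> carrier A. d m x \<in> linear_span k A {comm a l | a l. a \<in> carrier A \<and> l \<in> L (Suc i)}}"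
    proof clarify
      fix a l assume a: "a \<in> carrier A" and l: "l \<in> L (Suc i)"
      have "d m (comm a l) \<in> L (Suc (Suc i))"
        unfolding d_comm[OF Suc.prems(2) a L_closed[OF l]] using a l Suc.IH Suc.prems(2)
        by (intro submodule_finsum[OF module_axioms L_submodule] comm_L) (auto simp: d_D)
      then show "comm a l \<in> carrier A \<and>
          d m (comm a l) \<in> linear_span k A {comm a l | a l. a \<in> carrier A \<and> l \<in> L (Suc i)}"
        unfolding L_Suc_Suc using a L_closed[OF l] by simp
    qed
  qed
  then show ?case using Suc.prems(1) by blast
qed

text \<open>The product rule for d_m involves all lower orders, so the subset shown to be an ideal
  asks for stability under every d_m with \<open>m < q\<close> simultaneously.\<close>

lemma d_ideal:
  assumes S: "S \<subseteq> carrier A" and dS: "\<And>m s. \<lbrakk>m < q; s \<in> S\<rbrakk> \<Longrightarrow> d m s \<in> Idl S"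
    and x: "x \<in> Idl S" and m: "m < q"
  shows "d m x \<in> Idl S"
proof -
  let ?I = "Idl S"
  have I: "ideal ?I A" by (rule A.genideal_ideal[OF S])
  interpret I: ideal ?I A by fact
  have sm: "submodule ?I k A" by (rule ideal_submodule[OF I])
  have "ideal {x \<in> ?I. \<forall>m<q. d m x \<in> ?I} A"
  proof (rule ideal_subset_idealI[OF I])
    fix x a assume x: "x \<in> {x \<in> ?I. \<forall>m<q. d m x \<in> ?I}" and a: "a \<in> carrier A"
    have xc: "x \<in> carrier A" using x I.Icarr by blast
    have "d m (a \<otimes> x) \<in> ?I" if m: "m < q" for m
      unfolding d_mult[OF m a xc] using x a m
      by (intro submodule_finsum[OF module_axioms sm] I.I_l_closed) (auto simp: d_D)
    moreover have "d m (x \<otimes> a) \<in> ?I" if m: "m < q" for m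
      unfolding d_mult[OF m xc a] using x a m
      by (intro submodule_finsum[OF module_axioms sm] I.I_r_closed) (auto simp: d_D)
    ultimately show "a \<otimes> x \<in> {x \<in> ?I. \<forall>m<q. d m x \<in> ?I}" "x \<otimes> a \<in> {x \<in> ?I. \<forall>m<q. d m x \<in> ?I}"
      using x a I.I_l_closed I.I_r_closed by auto
  qed (auto simp: d_zero d_D I.Icarr)
  moreover have "S \<subseteq> {x \<in> ?I. \<forall>m<q. d m x \<in> ?I}"
    using dS A.genideal_self[OF S] by blast
  ultimately have "?I \<subseteq> {x \<in> ?I. \<forall>m<q. d m x \<in> ?I}"
    by (rule A.genideal_minimal)
  then show ?thesis using x m by blast
qed

lemma d_MI: "\<lbrakk>v \<in> MI (Suc i); m < q\<rbrakk> \<Longrightarrow> d m v \<in> MI (Suc i)"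
  unfolding lcs_ideal_def
proof (rule d_ideal)
  show "L (Suc i) \<subseteq> carrier A" using L_closed by blast
  show "\<And>m s. \<lbrakk>m < q; s \<in> L (Suc i)\<rbrakk> \<Longrightarrow> d m s \<in> Idl (L (Suc i))"
    using d_L L_MI unfolding lcs_ideal_def by blast
qed

text \<open>To be applied to a generator, whose shift has terms of degree 0 and 1 in t only; just
  two terms of the product rule survive.\<close>

lemma d_mult_primitive:
  assumes y: "y \<in> carrier A" and y1: "d 1 y = y1" "y1 \<in> carrier A" and y2: "\<And>m. 2 \<le> m \<Longrightarrow> m < q \<Longrightarrow> d m y = \<zero>"
    and a: "a \<in> carrier A" and m: "Suc m < q"
  shows "d (Suc m) (y \<otimes> a) = y \<otimes> d (Suc m) a \<oplus> y1 \<otimes> d m a"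
    and "d (Suc m) (a \<otimes> y) = d (Suc m) a \<otimes> y \<oplus> d m a \<otimes> y1"
proof -
  have g: "(\<Oplus>s\<in>{..Suc m}. g s) = g 0 \<oplus> g 1"
    if "g 0 \<in> carrier A" "g 1 \<in> carrier A" "\<And>s. 2 \<le> s \<Longrightarrow> s \<le> Suc m \<Longrightarrow> g s = \<zero>" for g
  proof -
    have "(\<Oplus>s\<in>{..Suc m}. g s) = (\<Oplus>s\<in>{0, 1}. g s)"
      using that by (intro M.finsum_superset[symmetric]) auto
    then show ?thesis using that by simp
  qed
  show "d (Suc m) (y \<otimes> a) = y \<otimes> d (Suc m) a \<oplus> y1 \<otimes> d m a"
    unfolding d_mult[OF m y a] using y a y1 y2 m by (subst g) (auto simp: d_D d_0)
  have "d (Suc m) (a \<otimes> y) = (\<Oplus>s\<in>{..Suc m}. d (Suc m - s) a \<otimes> d (Suc m - (Suc m - s)) y)"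
    unfolding d_mult[OF m a y] by (rule finsum_reverse) (use a y in \<open>simp add: d_D\<close>)
  also have "\<dots> = d (Suc m) a \<otimes> y \<oplus> d m a \<otimes> y1"
    using y a y1 y2 m by (subst g) (auto simp: d_D d_0)
  finally show "d (Suc m) (a \<otimes> y) = d (Suc m) a \<otimes> y \<oplus> d m a \<otimes> y1" .
qed

end

text \<open>An algebra with elements \<open>x\<^sub>j\<close> and divided partial derivatives \<open>d j m = \<partial>\<^sub>j\<^sup>m / m!\<close> truncated at
  \<open>m = p\<^bsup>e j\<^esup>\<close>.\<close>

locale hasse_algebra = assoc_algebra k A
  for k :: "('k, 'x) ring_scheme" and A :: "('k, 'a, 'y) module_scheme" (structure) +
  fixes p :: nat and js :: "'i list" and e :: "'i \<Rightarrow> nat" and x :: "'i \<Rightarrow> 'a"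
    and d :: "'i \<Rightarrow> nat \<Rightarrow> 'a \<Rightarrow> 'a" and half :: 'k
  assumes p_pos: "p > 0" and distinct: "distinct js"
    and half: "half \<in> carrier k" "half \<oplus>\<^bsub>k\<^esub> half = \<one>\<^bsub>k\<^esub>"
    and x_closed: "j \<in> set js \<Longrightarrow> x j \<in> carrier A"
    and hd: "j \<in> set js \<Longrightarrow> higher_derivation k A (p ^ e j) (d j)"
    and d_ge: "\<lbrakk>j \<in> set js; p ^ e j \<le> m; a \<in> carrier A\<rbrakk> \<Longrightarrow> d j m a = \<zero>"
    and d_x_1: "\<lbrakk>j \<in> set js; l \<in> set js; 1 < p ^ e j\<rbrakk> \<Longrightarrow> d j 1 (x l) = (if j = l then \<one> else \<zero>)"
    and d_x_2: "\<lbrakk>j \<in> set js; l \<in> set js; 2 \<le> m; m < p ^ e j\<rbrakk> \<Longrightarrow> d j m (x l) = \<zero>"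
    and d_d: "\<lbrakk>j \<in> set js; m < p ^ e j; s < p ^ e j; a \<in> carrier A\<rbrakk> \<Longrightarrow>
      d j m (d j s a) = of_int (int ((m + s) choose s)) \<odot> d j (m + s) a"
    and d_d_commute: "\<lbrakk>j \<in> set js; l \<in> set js; j \<noteq> l; a \<in> carrier A\<rbrakk> \<Longrightarrow> d j m (d l s a) = d l s (d j m a)"
begin

definition sym :: "'i \<Rightarrow> 'a \<Rightarrow> 'a"
  where "sym j a = half \<odot> (x j \<otimes> a \<oplus> a \<otimes> x j)"

lemma sym_linear: "j \<in> set js \<Longrightarrow> sym j \<in> linear_maps k A A"
  using half(1)
  by (intro linear_mapsI)
    (simp_all add: sym_def x_closed A.l_distr A.r_distr smult_r_distr M.a_ac smult_mult_left
      smult_mult_right smult_assoc1[symmetric] R.m_comm)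

lemma half_double: "a \<in> carrier A \<Longrightarrow> half \<odot> (a \<oplus> a) = a"
  using half by (simp add: smult_r_distr smult_l_distr[symmetric])

lemma d_sym:
  assumes "j \<in> set js" "l \<in> set js" "Suc m < p ^ e j" "a \<in> carrier A"
  shows "d j (Suc m) (sym l a) = sym l (d j (Suc m) a) \<oplus> (if j = l then d j m a else \<zero>)"
proof -
  interpret D: higher_derivation k A "p ^ e j" "d j" by (rule hd[OF assms(1)])
  \<comment> \<open>\<open>y\<close> is the first derivative of \<open>x l\<close>, so both cases
    are treated together. The left and the right product each contribute one term in
    \<open>y\<close>, and the factor one half turns them into a single \<open>d j m a\<close> when
    \<open>j = l\<close>.\<close>
  define y where "y = (if j = l then \<one> else \<zero>)"
  have yc: "y \<in> carrier A" by (simp add: y_def)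
  note p = D.d_mult_primitive[OF x_closed[OF assms(2)] _ yc _ assms(4,3)]
  have y1: "d j 1 (x l) = y" unfolding y_def using assms by (intro d_x_1) auto
  have ya: "half \<odot> (y \<otimes> b \<oplus> b \<otimes> y) = (if j = l then b else \<zero>)" if "b \<in> carrier A" for b
    using that half by (simp add: y_def half_double)
  have "d j (Suc m) (sym l a) = half \<odot> ((x l \<otimes> d j (Suc m) a \<oplus> y \<otimes> d j m a) \<oplus>
      (d j (Suc m) a \<otimes> x l \<oplus> d j m a \<otimes> y))"
    using assms half x_closed[OF assms(2)] p[OF y1 d_x_2[OF assms(1,2)]] by (simp add: sym_def D.d_D)
  also have "\<dots> = half \<odot> ((x l \<otimes> d j (Suc m) a \<oplus> d j (Suc m) a \<otimes> x l) \<oplus>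
      (y \<otimes> d j m a \<oplus> d j m a \<otimes> y))"
    using assms x_closed[OF assms(2)] yc by (simp add: D.d_D M.a_ac)
  also have "\<dots> = sym l (d j (Suc m) a) \<oplus> (if j = l then d j m a else \<zero>)"
    using assms half(1) x_closed[OF assms(2)] yc ya[of "d j m a"]
    by (subst smult_r_distr) (simp_all add: sym_def D.d_D)
  finally show ?thesis .
qed

lemma sym_d_commute:
  assumes "j \<in> set js" "l \<in> set js" "j \<noteq> l" "a \<in> carrier A"
  shows "sym l (d j m a) = d j m (sym l a)"
proof -
  interpret D: higher_derivation k A "p ^ e j" "d j" by (rule hd[OF assms(1)])
  have sc: "sym l b \<in> carrier A" if "b \<in> carrier A" for b
    using linear_maps_closed[OF sym_linear[OF assms(2)] that] .
  consider "m = 0" | m' where "m = Suc m'" "m < p ^ e j" | "p ^ e j \<le> m"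
    by (metis not_less not0_implies_Suc)
  then show ?thesis
  proof cases
    case 1
    then show ?thesis using assms sc by (simp add: D.d_0)
  next
    case 2
    then show ?thesis using assms sc by (simp add: d_sym D.d_D)
  next
    case 3
    then show ?thesis
      using assms sc linear_maps_zero[OF module_axioms module_axioms sym_linear[OF assms(2)]] by (simp add: d_ge)
  qed
qed

text \<open>The symmetrised multiplications commute up to a double commutator, which \<open>M\<^sub>3 M\<^sub>i \<subseteq> M\<^sub>i\<^sub>+\<^sub>1\<close>
  makes vanish on \<open>N\<^sub>i\<close>; plain left multiplications do not commute there for even \<open>i\<close>.\<close>

lemma sym_sym:
  assumes "j \<in> set js" "l \<in> set js" "a \<in> carrier A"
  shows "sym j (sym l a) \<ominus> sym l (sym j a) = (half \<otimes>\<^bsub>k\<^esub> half) \<odot> comm (comm (x j) (x l)) a"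
proof -
  have xj: "x j \<in> carrier A" and xl: "x l \<in> carrier A" using assms x_closed by auto
  have double: "sym j (sym l a) = (half \<otimes>\<^bsub>k\<^esub> half) \<odot>
      (x j \<otimes> (x l \<otimes> a \<oplus> a \<otimes> x l) \<oplus> (x l \<otimes> a \<oplus> a \<otimes> x l) \<otimes> x j)"
    if "x j \<in> carrier A" "x l \<in> carrier A" for j l
    using that assms(3) half(1)
    by (simp add: sym_def smult_mult_left smult_mult_right smult_r_distr[symmetric] smult_assoc1)
  have "x j \<otimes> (x l \<otimes> a \<oplus> a \<otimes> x l) \<oplus> (x l \<otimes> a \<oplus> a \<otimes> x l) \<otimes> x j
      \<ominus> (x l \<otimes> (x j \<otimes> a \<oplus> a \<otimes> x j) \<oplus> (x j \<otimes> a \<oplus> a \<otimes> x j) \<otimes> x l)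
      = comm (comm (x j) (x l)) a"
    using xj xl assms(3) unfolding comm_def by algebra
  then show ?thesis
    using xj xl assms(3) half(1)
    by (simp add: double[OF xj xl] double[OF xl xj] a_minus_def smult_r_minus[symmetric] smult_r_distr[symmetric]
        comm_closed)
qed

lemma submodule_of_MI:
  "module_with_submodule k (A\<lparr>carrier := MI (Suc i)\<rparr>) (MI (Suc (Suc i)))"
proof -
  have sm: "submodule (MI (Suc i)) k A" for i by (rule ideal_submodule[OF MI_ideal])
  interpret N: module k "A\<lparr>carrier := MI (Suc i)\<rparr>"
    by (rule submodule.submodule_is_module[OF sm module_axioms])
  have "module k (A\<lparr>carrier := MI (Suc (Suc i))\<rparr>)"
    by (rule submodule.submodule_is_module[OF sm module_axioms])
  then have "submodule (MI (Suc (Suc i))) k (A\<lparr>carrier := MI (Suc i)\<rparr>)"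
    using MI_decreasing by (intro N.module_incl_imp_submodule) auto
  then show ?thesis by (simp add: module_with_submodule_def N.module_axioms)
qed

lemma lcs_quotient_operators:
  fixes i defines "N \<equiv> A\<lparr>carrier := MI (Suc i)\<rparr>" and "J \<equiv> MI (Suc (Suc i))"
  shows "commuting_weyl_operators k (lcs_quotient k A (Suc i)) p js e
    (\<lambda>j. induced_map N J (sym j)) (\<lambda>j m. induced_map N J (d j m))"
proof -
  let ?V = "lcs_quotient k A (Suc i)"
  have V: "?V = quotient_algebra N J" by (simp add: lcs_quotient_def N_def J_def)
  interpret Q: module_with_submodule k N J unfolding N_def J_def by (rule submodule_of_MI)
  interpret VM: module k ?V unfolding V by (rule Q.quotient_module)
  have N_simps: "carrier N = MI (Suc i)" "ring.add N = ring.add A" "ring.zero N = ring.zero A"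
    "module.smult N = module.smult A"
    by (simp_all add: N_def)
  have vc: "v \<in> carrier A" if "v \<in> carrier N" for v using that MI_closed by (simp add: N_simps)
  have linN: "T \<in> linear_maps k N N" if "T \<in> linear_maps k A A" "\<And>v. v \<in> MI (Suc i) \<Longrightarrow> T v \<in> MI (Suc i)" for T
    using that MI_closed by (auto simp: linear_maps_def N_simps)
  have sym_MI: "sym j v \<in> MI (Suc i)" if "j \<in> set js" "v \<in> MI (Suc i)" for j v i
    using that half(1) x_closed submodule.smult_closed[OF ideal_submodule[OF MI_ideal]]
    by (auto simp: sym_def MI_add MI_mult)
  have d_MI: "d j m v \<in> MI (Suc i)" if j: "j \<in> set js" and v: "v \<in> MI (Suc i)" for j m v i
  proof (cases "m < p ^ e j")
    case True
    then show ?thesis using higher_derivation.d_MI[OF hd[OF j] v] by simp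
  next
    case False
    then show ?thesis using v by (simp add: d_ge[OF j] MI_closed MI_zero)
  qed
  have symN: "sym j \<in> linear_maps k N N" "\<And>v. v \<in> J \<Longrightarrow> sym j v \<in> J" if "j \<in> set js" for j
    using that sym_linear sym_MI unfolding J_def by (auto intro!: linN)
  have dN: "d j m \<in> linear_maps k N N" "\<And>v. v \<in> J \<Longrightarrow> d j m v \<in> J" if "j \<in> set js" for j m
    using that higher_derivation.d_linear[OF hd] d_MI unfolding J_def by (auto intro!: linN)
  note ind = Q.induced_map_coset[OF symN] Q.induced_map_coset[OF dN]
  have cl: "sym j v \<in> carrier N" "d j m v \<in> carrier N" if "j \<in> set js" "v \<in> carrier N" for j m v
    using that sym_MI d_MI by (simp_all add: N_simps)
  have coset_zero: "\<zero>\<^bsub>?V\<^esub> = J +>\<^bsub>N\<^esub> \<zero>" unfolding V by (simp add: Q.coset_zero N_simps)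
  have coset_add: "(J +>\<^bsub>N\<^esub> a) \<oplus>\<^bsub>?V\<^esub> (J +>\<^bsub>N\<^esub> b) = J +>\<^bsub>N\<^esub> (a \<oplus> b)" if "a \<in> carrier N" "b \<in> carrier N" for a b
    unfolding V using that by (simp add: Q.coset_add N_simps)
  have coset_smult: "c \<odot>\<^bsub>?V\<^esub> (J +>\<^bsub>N\<^esub> a) = J +>\<^bsub>N\<^esub> (c \<odot> a)" if "c \<in> carrier k" "a \<in> carrier N" for c a
    unfolding V using that by (simp add: Q.coset_smult N_simps)
  show ?thesis
  proof (rule commuting_weyl_operators.intro[OF VM.module_axioms commuting_weyl_operators_axioms.intro], goal_cases)
    case (1 j)
    interpret D: higher_derivation k A "p ^ e j" "d j" by (rule hd[OF 1])
    show ?case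
    proof (rule weyl_operators.intro[OF VM.module_axioms weyl_operators_axioms.intro], goal_cases)
      case 1
      then show ?case using p_pos by simp
    next
      case 2
      then show ?case unfolding V by (rule Q.induced_map_linear[OF symN[OF \<open>j \<in> set js\<close>]])
    next
      case (3 m)
      then show ?case unfolding V by (rule Q.induced_map_linear[OF dN[OF \<open>j \<in> set js\<close>]])
    next
      case (4 v)
      then show ?case unfolding V using \<open>j \<in> set js\<close>
        by (elim Q.quotient_cases) (simp add: ind D.d_0 vc)
    next
      case (5 m v)
      then obtain a where a: "a \<in> carrier N" "v = J +>\<^bsub>N\<^esub> a" unfolding V by (elim Q.quotient_cases)
      show ?case using a 5 \<open>j \<in> set js\<close> by (simp add: ind d_ge vc coset_zero)
    next
      case (6 m v)
      then obtain a where a: "a \<in> carrier N" "v = J +>\<^bsub>N\<^esub> a" unfolding V by (elim Q.quotient_cases)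
      show ?case using a 6 \<open>j \<in> set js\<close> by (simp add: ind cl coset_add d_sym vc)
    next
      case (7 m s v)
      then obtain a where a: "a \<in> carrier N" "v = J +>\<^bsub>N\<^esub> a" unfolding V by (elim Q.quotient_cases)
      show ?case using a 7 \<open>j \<in> set js\<close> by (simp add: ind cl coset_smult d_d vc)
    qed
  next
    case 2
    then show ?case by (rule distinct)
  next
    case (3 j l v)
    then obtain a where a: "a \<in> carrier N" "v = J +>\<^bsub>N\<^esub> a" unfolding V by (elim Q.quotient_cases)
    \<comment> \<open>The only relation that uses passage to the quotient; all the others hold in
      \<open>A\<close> already.\<close>
    have "sym j (sym l a) \<ominus> sym l (sym j a) \<in> J"
      using 3 a half(1) comm_comm_MI[of a i "x j" "x l"] x_closed
        submodule.smult_closed[OF ideal_submodule[OF MI_ideal], of "half \<otimes>\<^bsub>k\<^esub> half" _ "Suc i"]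
      by (simp add: sym_sym vc N_simps J_def)
    \<comment> \<open>\<open>\<ominus>\<close> is defined as an inverse inside the carrier, and the
      carrier of \<open>N\<close> is smaller than that of \<open>A\<close>, so the two negations
      have to be identified.\<close>
    moreover have "sym j (sym l a) \<ominus>\<^bsub>N\<^esub> sym l (sym j a) = sym j (sym l a) \<ominus> sym l (sym j a)"
    proof -
      have sl: "sym l (sym j a) \<in> carrier N" using 3 a cl by simp
      have "\<ominus>\<^bsub>N\<^esub> sym l (sym j a) = \<ominus> sym l (sym j a)"
        by (rule Q.M.minus_equality) (use sl in \<open>auto simp: N_simps MI_minus MI_closed M.l_neg\<close>)
      then show ?thesis by (simp add: a_minus_def N_simps)
    qed
    ultimately show ?case
      using 3 a by (simp add: ind cl Q.coset_eq_iff)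
  next
    case (4 j l v m)
    then obtain a where a: "a \<in> carrier N" "v = J +>\<^bsub>N\<^esub> a" unfolding V by (elim Q.quotient_cases)
    show ?case using a 4 by (simp add: ind cl sym_d_commute vc)
  next
    case (5 j l v m s)
    then obtain a where a: "a \<in> carrier N" "v = J +>\<^bsub>N\<^esub> a" unfolding V by (elim Q.quotient_cases)
    show ?case using a 5 by (simp add: ind cl d_d_commute vc)
  qed
qed

end

section \<open>Hasse derivatives of free algebras\<close>

lemma monoid_free_monoid: "Group.monoid (free_monoid S)"
  by (rule monoidI) (auto simp: free_monoid_def)

locale free_alg = R: cring k
  for k :: "('k, 'x) ring_scheme" and S :: "'s set" and F :: "('k, 's list \<Rightarrow> 'k) module" (structure) +
  assumes F_def: "F = free_algebra k S"
begin

sublocale MA: monoid_alg k "free_monoid S"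
  by (simp add: monoid_alg_def R.is_cring monoid_free_monoid)

lemma F_eq: "F = MA.F"
  by (simp add: F_def free_algebra_def)

sublocale F: assoc_algebra k F
  unfolding F_eq by (rule MA.F_assoc_algebra)

abbreviation "word \<equiv> basis_elem k"

lemma word_closed [simp, intro]: "w \<in> lists S \<Longrightarrow> word w \<in> carrier F"
  unfolding F_eq basis_elem_single by (intro MA.single_closed) (auto simp: free_monoid_def)

lemma word_Nil: "word [] = \<one>"
  unfolding F_eq basis_elem_single by (simp add: MA.F_simps(4)) (simp add: free_monoid_def)

lemma word_Cons:
  assumes "a \<in> S" "w \<in> lists S"
  shows "word (a # w) = generator k a \<otimes> word w"
  using assms MA.single_mult[of "[a]" w "\<one>\<^bsub>k\<^esub>" "\<one>\<^bsub>k\<^esub>"]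
  unfolding F_eq basis_elem_single by (simp add: free_monoid_def)

lemma gen_closed [simp, intro]: "a \<in> S \<Longrightarrow> generator k a \<in> carrier F"
  by simp

lemma words_eqI:
  assumes "module k N" "G \<in> linear_maps k F N" "H \<in> linear_maps k F N"
    and "\<And>w. w \<in> lists S \<Longrightarrow> G (word w) = H (word w)" "f \<in> carrier F"
  shows "G f = H f"
  using MA.linear_eqI[OF assms(1)] assms(2-5) unfolding F_eq by (auto simp: free_monoid_def)

lemma mult_linear:
  assumes "g \<in> carrier F"
  shows "(\<lambda>f. g \<otimes> f) \<in> linear_maps k F F" "(\<lambda>f. f \<otimes> g) \<in> linear_maps k F F"
  using assms by (auto intro!: linear_mapsI simp: F.A.r_distr F.A.l_distr F.smult_mult_right F.smult_mult_left)

text \<open>The coefficient of t^m in the word after x_j is replaced by x_j + t with t central: the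
  first letter contributes itself or, if it is \<open>j\<close>, a factor t.\<close>

primrec hasse_word :: "'s \<Rightarrow> 's list \<Rightarrow> nat \<Rightarrow> 's list \<Rightarrow> 'k"
  where
    "hasse_word j [] = (\<lambda>m. if m = 0 then \<one> else \<zero>)"
  | "hasse_word j (a # w) = (\<lambda>m. generator k a \<otimes> hasse_word j w m \<oplus>
      (if a = j \<and> m > 0 then hasse_word j w (m - 1) else \<zero>))"

definition hasse :: "'s \<Rightarrow> nat \<Rightarrow> ('s list \<Rightarrow> 'k) \<Rightarrow> 's list \<Rightarrow> 'k"
  where "hasse j m = linear_extension k F (\<lambda>w. hasse_word j w m)"

lemma hasse_word_closed: "w \<in> lists S \<Longrightarrow> hasse_word j w m \<in> carrier F"
  by (induction w arbitrary: m) auto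

lemma hasse_linear: "hasse j m \<in> linear_maps k F F"
  using MA.linear_extension_linear[OF F.module_axioms, of "\<lambda>w. hasse_word j w m"] hasse_word_closed
  unfolding hasse_def F_eq[symmetric] by (simp add: free_monoid_def)

lemmas hasse_D = linear_mapsD[OF hasse_linear]
lemmas hasse_zero = linear_maps_zero[OF F.module_axioms F.module_axioms hasse_linear]

lemma hasse_word: "w \<in> lists S \<Longrightarrow> hasse j m (word w) = hasse_word j w m"
  unfolding hasse_def basis_elem_single
  by (subst MA.linear_extension_single[OF F.module_axioms]) (auto simp: hasse_word_closed)

lemma hasse_one: "hasse j m \<one> = (if m = 0 then \<one> else \<zero>)"
  using hasse_word[of "[]" j m] by (simp add: word_Nil)

text \<open>Extends the recursion from words to arbitrary \<open>g\<close> by linearity, so that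
  later inductions need not mention \<open>hasse_word\<close>.\<close>

lemma hasse_gen_mult:
  assumes a: "a \<in> S" and g: "g \<in> carrier F"
  shows "hasse j m (generator k a \<otimes> g) = generator k a \<otimes> hasse j m g \<oplus>
      (if a = j \<and> m > 0 then hasse j (m - 1) g else \<zero>)"
proof (rule words_eqI[OF F.module_axioms _ _ _ g])
  show "(\<lambda>g. hasse j m (generator k a \<otimes> g)) \<in> linear_maps k F F"
    by (rule linear_maps_comp[OF hasse_linear mult_linear(1)]) (use a in auto)
  show "(\<lambda>g. generator k a \<otimes> hasse j m g \<oplus> (if a = j \<and> m > 0 then hasse j (m - 1) g else \<zero>))
      \<in> linear_maps k F F"
    by (rule F.linear_maps_plus[OF linear_maps_comp[OF mult_linear(1) hasse_linear]])
      (use a hasse_linear F.linear_maps_const_zero in \<open>auto, cases "a = j \<and> m > 0", auto\<close>)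
  fix w assume w: "w \<in> lists S"
  show "hasse j m (generator k a \<otimes> word w) = generator k a \<otimes> hasse j m (word w) \<oplus>
      (if a = j \<and> m > 0 then hasse j (m - 1) (word w) else \<zero>)"
    using a w hasse_word[of "a # w" j m] by (simp add: word_Cons[symmetric] hasse_word)
qed

lemma word_induct [consumes 1, case_names Nil Cons]:
  assumes "w \<in> lists S" "P \<one>"
    and "\<And>a g. \<lbrakk>a \<in> S; g \<in> carrier F; P g\<rbrakk> \<Longrightarrow> P (generator k a \<otimes> g)"
  shows "P (word w)"
  using assms(1)
proof (induction w)
  case Nil
  then show ?case using assms(2) by (simp add: word_Nil)
next
  case (Cons a w)
  then have "P (generator k a \<otimes> word w)" by (intro assms(3)) auto
  then show ?case using Cons by (subst word_Cons) auto
qed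

lemma hasse_0: "f \<in> carrier F \<Longrightarrow> hasse j 0 f = f"
proof (rule words_eqI[OF F.module_axioms hasse_linear linear_maps_id])
  fix w assume "w \<in> lists S"
  then show "hasse j 0 (word w) = word w"
    by (induction rule: word_induct) (simp_all add: hasse_one hasse_gen_mult)
qed

lemma hasse_mult:
  assumes f: "f \<in> carrier F" and g: "g \<in> carrier F"
  shows "hasse j m (f \<otimes> g) = (\<Oplus>s\<in>{..m}. hasse j s f \<otimes> hasse j (m - s) g)"
proof (rule words_eqI[OF F.module_axioms _ _ _ f])
  show "(\<lambda>f. hasse j m (f \<otimes> g)) \<in> linear_maps k F F"
    by (rule linear_maps_comp[OF hasse_linear mult_linear(2)[OF g]])
  show "(\<lambda>f. \<Oplus>s\<in>{..m}. hasse j s f \<otimes> hasse j (m - s) g) \<in> linear_maps k F F"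
    by (intro F.linear_maps_finsum_pointwise linear_maps_comp[OF mult_linear(2) hasse_linear])
      (use g in \<open>auto simp: hasse_D\<close>)
  fix w assume "w \<in> lists S"
  then show "hasse j m (word w \<otimes> g) = (\<Oplus>s\<in>{..m}. hasse j s (word w) \<otimes> hasse j (m - s) g)"
  proof (induction arbitrary: m rule: word_induct)
    case Nil
    have "(\<Oplus>s\<in>{..m}. hasse j s \<one> \<otimes> hasse j (m - s) g) = hasse j 0 \<one> \<otimes> hasse j (m - 0) g"
      using g by (intro F.M.finsum_single) (auto simp: hasse_one hasse_D)
    then show ?case using g by (simp add: hasse_one hasse_D)
  next
    case (Cons a h)
    let ?x = "generator k a"
    \<comment> \<open>The part of \<open>hasse j s (?x \<otimes> h)\<close> in which the first
      letter contributes the factor t.\<close>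
    define \<epsilon> where "\<epsilon> s = (if a = j \<and> s > 0 then hasse j (s - 1) h else \<zero>)" for s
    have \<epsilon>: "\<epsilon> s \<in> carrier F" for s using Cons by (simp add: \<epsilon>_def hasse_D)
    have x: "?x \<in> carrier F" using Cons by simp
    have "(\<Oplus>s\<in>{..m}. hasse j s (?x \<otimes> h) \<otimes> hasse j (m - s) g) =
        (\<Oplus>s\<in>{..m}. ?x \<otimes> (hasse j s h \<otimes> hasse j (m - s) g) \<oplus> \<epsilon> s \<otimes> hasse j (m - s) g)"
      using Cons x g \<epsilon>
      by (intro F.M.finsum_cong')
        (auto simp: hasse_gen_mult[OF Cons(1,2)] \<epsilon>_def[symmetric] hasse_D F.A.l_distr F.A.m_assoc)
    also have "\<dots> = (\<Oplus>s\<in>{..m}. ?x \<otimes> (hasse j s h \<otimes> hasse j (m - s) g)) \<oplus>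
        (\<Oplus>s\<in>{..m}. \<epsilon> s \<otimes> hasse j (m - s) g)"
      using Cons x g \<epsilon> by (intro F.M.finsum_addf) (auto simp: hasse_D)
    also have "(\<Oplus>s\<in>{..m}. ?x \<otimes> (hasse j s h \<otimes> hasse j (m - s) g)) = ?x \<otimes> hasse j m (h \<otimes> g)"
      unfolding Cons.IH using Cons x g
      by (intro linear_maps_finsum[OF F.module_axioms F.module_axioms mult_linear(1)[OF x], symmetric])
        (auto simp: hasse_D)
    also have "(\<Oplus>s\<in>{..m}. \<epsilon> s \<otimes> hasse j (m - s) g) =
        (if a = j \<and> m > 0 then hasse j (m - 1) (h \<otimes> g) else \<zero>)"
    proof (cases "a = j \<and> m > 0")
      case True
      then obtain m' where m: "m = Suc m'" by (cases m) auto
      \<comment> \<open>\<open>\<epsilon> 0\<close> vanishes, so splitting off \<open>s = 0\<close>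
        and shifting the index gives the product rule of order \<open>m - 1\<close> for
        \<open>h\<close>.\<close>
      have "(\<Oplus>s\<in>{..m}. \<epsilon> s \<otimes> hasse j (m - s) g) =
          (\<Oplus>s\<in>{..m'}. \<epsilon> (Suc s) \<otimes> hasse j (m - Suc s) g) \<oplus> \<epsilon> 0 \<otimes> hasse j (m - 0) g"
        unfolding m using g \<epsilon> by (intro F.M.finsum_Suc2) (auto simp: hasse_D)
      also have "\<dots> = (\<Oplus>s\<in>{..m'}. hasse j s h \<otimes> hasse j (m' - s) g)"
        using True g Cons by (simp add: \<epsilon>_def m hasse_D)
      finally show ?thesis using True by (simp add: Cons.IH m)
    next
      case False
      then show ?thesis
        using g by (subst F.M.add.finprod_one_eqI) (auto simp: \<epsilon>_def hasse_D)
    qed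
    finally show ?case
      using Cons x g by (simp add: F.A.m_assoc hasse_gen_mult)
  qed
qed

sublocale H: higher_derivation k F q "hasse j" for q j
  by unfold_locales (auto simp: hasse_linear hasse_0 hasse_mult)

text \<open>The shift by t followed by the shift by u is the shift by t + u, which explains the
  binomial coefficient. On words the inductive step is Pascal's rule.\<close>

lemma hasse_hasse:
  assumes "f \<in> carrier F"
  shows "hasse j m (hasse j s f) = R.of_int (int ((m + s) choose s)) \<odot> hasse j (m + s) f"
proof (rule words_eqI[OF F.module_axioms linear_maps_comp[OF hasse_linear hasse_linear]
      F.linear_maps_scale[OF hasse_linear R.of_int_closed] _ assms])
  fix w assume "w \<in> lists S"
  then show "hasse j m (hasse j s (word w)) = R.of_int (int ((m + s) choose s)) \<odot> hasse j (m + s) (word w)"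
  proof (induction arbitrary: m s rule: word_induct)
    case Nil
    then show ?case by (auto simp: hasse_one hasse_zero)
  next
    case (Cons a g)
    let ?c = "\<lambda>n. R.of_int (int n)"
    have pascal: "?c ((m' + s) choose s) \<odot> v \<oplus> ?c ((Suc m' + s') choose s') \<odot> v =
        ?c ((Suc m' + s) choose s) \<odot> v"
      if "s = Suc s'" "v \<in> carrier F" for m' s' v
      using that by (simp add: F.smult_l_distr[symmetric] R.of_int_add[symmetric] add.commute)
    note D = hasse_D F.smult_mult_right F.smult_r_distr
    show ?case
    proof (cases "a = j")
      case False
      then show ?thesis using Cons by (simp add: hasse_gen_mult D hasse_zero)
    next
      case True
      consider "m = 0" | "s = 0" | m' s' where "m = Suc m'" "s = Suc s'"
        by (cases m; cases s) auto
      then show ?thesis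
      proof cases
        case 1
        then show ?thesis using Cons by (simp add: hasse_0 hasse_D)
      next
        case 2
        then show ?thesis using Cons by (simp add: hasse_0 hasse_D)
      next
        case 3
        have "hasse j m (hasse j s (generator k a \<otimes> g)) =
            generator k a \<otimes> hasse j m (hasse j s g) \<oplus> hasse j m' (hasse j s g) \<oplus> hasse j m (hasse j s' g)"
          using Cons(1,2) True 3 by (simp add: hasse_gen_mult D)
        also have "\<dots> = generator k a \<otimes> (?c ((m + s) choose s) \<odot> hasse j (m + s) g) \<oplus>
            (?c ((m' + s) choose s) \<odot> hasse j (m' + s) g \<oplus> ?c ((Suc m' + s') choose s') \<odot> hasse j (m' + s) g)"
          using Cons 3 by (simp add: Cons.IH F.M.a_assoc D)
        also have "\<dots> = ?c ((m + s) choose s) \<odot> hasse j (m + s) (generator k a \<otimes> g)"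
          using Cons(1,2) True 3 pascal[OF 3(2) hasse_D(1)[OF Cons(2)], of m' j "m' + s"]
          by (simp add: hasse_gen_mult D)
        finally show ?thesis .
      qed
    qed
  qed
qed

lemma hasse_commute:
  assumes "f \<in> carrier F" "j \<noteq> l"
  shows "hasse j m (hasse l s f) = hasse l s (hasse j m f)"
proof (rule words_eqI[OF F.module_axioms linear_maps_comp[OF hasse_linear hasse_linear]
      linear_maps_comp[OF hasse_linear hasse_linear] _ assms(1)])
  fix w assume "w \<in> lists S"
  then show "hasse j m (hasse l s (word w)) = hasse l s (hasse j m (word w))"
  proof (induction arbitrary: m s rule: word_induct)
    case Nil
    then show ?case by (auto simp: hasse_one hasse_zero)
  next
    case (Cons a g)
    then show ?case
      using assms(2) by (auto simp: hasse_gen_mult hasse_D hasse_zero Cons.IH)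
  qed
qed

lemma hasse_generator:
  assumes "a \<in> S"
  shows "hasse j 1 (generator k a) = (if j = a then \<one> else \<zero>)"
    and "2 \<le> m \<Longrightarrow> hasse j m (generator k a) = \<zero>"
  using assms hasse_gen_mult[of a "\<one>" j] by (auto simp: hasse_one)

text \<open>For \<open>a = j\<close> these are the coefficients in the binomial expansion of (x +
  t)^s with t central; for other generators the shift is trivial.\<close>

lemma hasse_power:
  assumes a: "a \<in> S"
  shows "hasse j m (generator k a [^] s) = (if a = j
      then R.of_int (int (s choose m)) \<odot> generator k a [^] (s - m)
      else if m = 0 then generator k a [^] s else \<zero>)"
proof (induction s arbitrary: m)
  case 0
  then show ?case by (cases m) (auto simp: hasse_one)
next
  case (Suc s)
  let ?x = "generator k a"
  have x: "?x \<in> carrier F" using a by simp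
  have pow: "?x [^] Suc s = ?x \<otimes> ?x [^] s" for s :: nat
    using x by (rule F.A.nat_pow_Suc2)
  show ?case
  proof (cases "a = j \<and> m > 0")
    case False
    then consider "m = 0" | "m > 0" "a \<noteq> j" by blast
    then show ?thesis
    proof cases
      case 1
      have "?x [^] Suc s \<in> carrier F" using x by (rule F.A.nat_pow_closed)
      from hasse_0[OF this] F.smult_one[OF this] show ?thesis
        unfolding 1 binomial_n_0 of_nat_1 R.of_int_1 diff_zero by auto
    next
      case 2
      then show ?thesis unfolding pow using a by (simp add: hasse_gen_mult Suc.IH)
    qed
  next
    case True
    then obtain m' where m: "m = Suc m'" by (cases m) auto
    have IH: "hasse j l (?x [^] s) = R.of_int (int (s choose l)) \<odot> ?x [^] (s - l)" for l
      using Suc.IH True by simp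
    have xs: "?x [^] l \<in> carrier F" for l :: nat
      using x by simp
    have "hasse j m (?x [^] Suc s) = R.of_int (int (s choose m)) \<odot> (?x \<otimes> ?x [^] (s - m)) \<oplus>
        R.of_int (int (s choose m')) \<odot> ?x [^] (s - m')"
      unfolding pow hasse_gen_mult[OF a xs] IH using True m x xs by (simp add: F.smult_mult_right)
    also have "R.of_int (int (s choose m)) \<odot> (?x \<otimes> ?x [^] (s - m)) =
        R.of_int (int (s choose m)) \<odot> ?x [^] (s - m')"
    \<comment> \<open>For \<open>m > s\<close> the exponent \<open>s - m\<close> is truncated to 0
      and the powers need not agree, but the binomial coefficient vanishes.\<close>
    proof (cases "m \<le> s")
      case True
      then have "s - m' = Suc (s - m)" using m by simp
      then show ?thesis by (simp only: pow)
    next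
      case False
      then show ?thesis using x xs by (simp add: binomial_eq_0)
    qed
    also have "\<dots> \<oplus> R.of_int (int (s choose m')) \<odot> ?x [^] (s - m') =
        R.of_int (int (Suc s choose m)) \<odot> ?x [^] (Suc s - m)"
      using xs by (simp add: m F.smult_l_distr[symmetric] R.of_int_add[symmetric] add.commute)
    finally show ?thesis using True by simp
  qed
qed

end

section \<open>Binomial coefficients modulo a prime\<close>

text \<open>With q = p^r one has m C(q, m) = q C(q-1, m-1). Were C(q, m) prime to p, then q would
  divide m, which is smaller.\<close>

lemma prime_dvd_choose_prime_power:
  assumes p: "Factorial_Ring.prime (p :: nat)" and m: "0 < m" "m < p ^ r"
  shows "p dvd (p ^ r choose m)"
proof (rule ccontr)
  assume "\<not> p dvd (p ^ r choose m)"
  then have "coprime (p ^ r) (p ^ r choose m)"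
    using p by (simp add: prime_imp_coprime)
  moreover have "m * (p ^ r choose m) = p ^ r * ((p ^ r - 1) choose (m - 1))"
    using m by (intro times_binomial_minus1_eq) auto
  ultimately have "p ^ r dvd m"
    by (metis coprime_dvd_mult_left_iff dvd_triv_left)
  then show False using m by (simp add: nat_dvd_not_less)
qed

text \<open>Write q = p^r, m + s = q + t with t < s, and expand by Vandermonde. The term l = 0
  contains C(t, s) = 0, and every other term contains C(q, l) with 0 < l < q.\<close>

lemma prime_dvd_choose_add:
  assumes p: "Factorial_Ring.prime (p :: nat)" and m: "m < p ^ r" "s < p ^ r" "p ^ r \<le> m + s"
  shows "p dvd ((m + s) choose s)"
proof -
  define t where "t = m + s - p ^ r"
  have t: "m + s = p ^ r + t" "t < s" using m by (auto simp: t_def)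
  have "(m + s) choose s = (\<Sum>l\<le>s. (p ^ r choose l) * (t choose (s - l)))"
    unfolding t(1) by (rule vandermonde[symmetric])
  also have "p dvd \<dots>"
  proof (rule dvd_sum)
    fix l assume "l \<in> {..s}"
    then show "p dvd (p ^ r choose l) * (t choose (s - l))"
      using t(2) m(2) prime_dvd_choose_prime_power[OF p, of l r] by (cases "l = 0") (auto simp: binomial_eq_0)
  qed
  finally show ?thesis .
qed

section \<open>Quotients of free algebras\<close>

context free_alg
begin

text \<open>The elements killed by all orders strictly between 0 and \<open>p ^ e j\<close> form a
  subalgebra: each term of the product rule has a factor of positive order. The powers of the
  generators belong to it, by divisibility of binomials for \<open>l = j\<close> and trivially for
  \<open>l \<noteq> j\<close>.\<close>

lemma hasse_vanishes:
  assumes g: "g \<in> generated_subalgebra k F {generator k l [^] (p ^ e l) | l. l \<in> S}"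
    and p: "Factorial_Ring.prime p" and char: "R.of_int (int p) = \<zero>\<^bsub>k\<^esub>" and m: "0 < m" "m < p ^ e j"
  shows "hasse j m g = \<zero>"
proof -
  let ?Z = "{g \<in> carrier F. \<forall>m. 0 < m \<and> m < p ^ e j \<longrightarrow> hasse j m g = \<zero>}"
  have mult: "g \<otimes> h \<in> ?Z" if "g \<in> ?Z" "h \<in> ?Z" for g h
  proof -
    have "hasse j m (g \<otimes> h) = \<zero>" if m: "0 < m" "m < p ^ e j" for m
    proof -
      have "hasse j s g \<otimes> hasse j (m - s) h = \<zero>" if "s \<le> m" for s
        using that m \<open>g \<in> ?Z\<close> \<open>h \<in> ?Z\<close> by (cases "s = 0") (auto simp: hasse_D)
      then show ?thesis
        using that \<open>g \<in> ?Z\<close> \<open>h \<in> ?Z\<close> by (subst hasse_mult) (auto intro!: F.M.add.finprod_one_eqI)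
    qed
    then show ?thesis using that by auto
  qed
  have sub: "subring ?Z F"
  proof (rule F.A.subringI)
    show "\<And>h. h \<in> ?Z \<Longrightarrow> \<ominus> h \<in> ?Z"
      using linear_maps_minus[OF F.module_axioms F.module_axioms hasse_linear] by auto
  qed (use mult in \<open>auto simp: hasse_one hasse_D\<close>)
  moreover have "submodule ?Z k F"
    using sub by (auto simp: submodule_def submodule_axioms_def subring_def hasse_D)
  moreover have "{generator k l [^] (p ^ e l) | l. l \<in> S} \<subseteq> ?Z"
  proof clarify
    fix l assume l: "l \<in> S"
    have "R.of_int (int (p ^ e l choose m)) = \<zero>\<^bsub>k\<^esub>" if m: "0 < m" "m < p ^ e l" for m
    proof -
      obtain c where "p ^ e l choose m = p * c"
        using prime_dvd_choose_prime_power[OF p m] by (auto elim: dvdE)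
      then show ?thesis by (simp add: R.of_int_mult char)
    qed
    then show "generator k l [^] (p ^ e l) \<in> carrier F \<and>
        (\<forall>m. 0 < m \<and> m < p ^ e j \<longrightarrow> hasse j m (generator k l [^] (p ^ e l)) = \<zero>)"
      using l by (auto simp: hasse_power)
  qed
  ultimately have "generated_subalgebra k F {generator k l [^] (p ^ e l) | l. l \<in> S} \<subseteq> ?Z"
    unfolding generated_subalgebra_def by (intro Inter_lower) blast
  then show ?thesis using g m by blast
qed

text \<open>From order q = p^(e j) on, \<open>hasse j\<close> need not preserve the ideal: it sends
  x_j^q to 1 in order q. There the operator is set to zero, and the rule for compositions survives
  because of the characteristic.\<close>

lemma quotient_hasse_algebra:
  fixes T :: "('s list \<Rightarrow> 'k) set"
  defines "I \<equiv> Idl T"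
  assumes p: "Factorial_Ring.prime p" and char: "R.of_int (int p) = \<zero>\<^bsub>k\<^esub>"
    and T: "T \<subseteq> generated_subalgebra k F {generator k l [^] (p ^ e l) | l. l \<in> S}"
    and js: "distinct js" "set js = S"
    and half: "half \<in> carrier k" "half \<oplus>\<^bsub>k\<^esub> half = \<one>\<^bsub>k\<^esub>"
  shows "hasse_algebra k (quotient_algebra F I) p js e (\<lambda>j. I +> generator k j)
    (\<lambda>j m Y. if m < p ^ e j then induced_map F I (hasse j m) Y else \<zero>\<^bsub>quotient_algebra F I\<^esub>) half"
proof -
  let ?A = "quotient_algebra F I"
  have p_pos: "p > 0" using p by (simp add: prime_gt_0_nat)
  have "{generator k l [^] (p ^ e l) | l. l \<in> S} \<subseteq> carrier F" by auto
  then have T_closed: "T \<subseteq> carrier F"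
    using T F.A.generated_subalgebra_subset[OF F.A.carrier_is_subring F.carrier_is_submodule] by blast
  have I: "ideal I F" unfolding I_def by (rule F.A.genideal_ideal[OF T_closed])
  interpret I: ideal I F by (rule I)
  interpret Q: module_with_submodule k F I by (rule F.ideal_module_with_submodule[OF I])
  interpret A: assoc_algebra k ?A by (rule F.quotient_assoc_algebra[OF I])
  have hasse_I: "hasse j m g \<in> I" if "m < p ^ e j" "g \<in> I" for j m g
    unfolding I_def
  proof (rule H.d_ideal[OF T_closed _ _ that(1)])
    fix m s assume ms: "m < p ^ e j" "s \<in> T"
    have "\<zero> \<in> Idl T"
      using additive_subgroup.zero_closed[OF ideal.axioms(1)[OF I]] unfolding I_def .
    moreover have "s \<in> carrier F" "s \<in> Idl T"
      using ms T_closed F.A.genideal_self[OF T_closed] by auto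
    ultimately show "hasse j m s \<in> Idl T"
      using ms T hasse_vanishes[OF _ p char, of s e m j]
      by (cases "m = 0") (auto simp: hasse_0)
  qed (use that I_def in simp)
  let ?d = "\<lambda>j m Y. if m < p ^ e j then induced_map F I (hasse j m) Y else \<zero>\<^bsub>?A\<^esub>"
  have d: "?d j m (I +> g) = I +> (if m < p ^ e j then hasse j m g else \<zero>)"
    if "g \<in> carrier F" for j m g
    using Q.induced_map_coset[OF hasse_linear _ that] hasse_I by (auto simp: Q.coset_zero)
  have d_linear: "?d j m \<in> linear_maps k ?A ?A" for j m
    using Q.induced_map_linear[OF hasse_linear] hasse_I A.linear_maps_const_zero
    by (cases "m < p ^ e j") auto
  have coset_linear: "(\<lambda>g. I +> g) \<in> linear_maps k F ?A"
    by (rule linear_mapsI) (simp_all add: Q.coset_simps)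
  have one: "\<one>\<^bsub>?A\<^esub> = I +> \<one>" by (simp add: quotient_algebra_simps)
  have hd: "higher_derivation k ?A (p ^ e j) (?d j)" for j
  proof (rule higher_derivation.intro[OF A.assoc_algebra_axioms higher_derivation_axioms.intro[OF d_linear]], goal_cases)
    case (1 a)
    then obtain g where "g \<in> carrier F" "a = I +> g" by (rule Q.quotient_cases)
    then show ?case by (simp only: d) (simp add: hasse_0 p_pos)
  next
    case (2 m a b)
    obtain g where g: "g \<in> carrier F" "a = I +> g" using 2(2) by (rule Q.quotient_cases)
    obtain h where h: "h \<in> carrier F" "b = I +> h" using 2(3) by (rule Q.quotient_cases)
    have "?d j m (a \<otimes>\<^bsub>?A\<^esub> b) = I +> (\<Oplus>s\<in>{..m}. hasse j s g \<otimes> hasse j (m - s) h)"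
      unfolding g h F.coset_mult[OF I g(1) h(1)] d[OF F.A.m_closed[OF g(1) h(1)]]
      using 2(1) by (simp add: hasse_mult g h)
    also have "\<dots> = (\<Oplus>\<^bsub>?A\<^esub>s\<in>{..m}. I +> (hasse j s g \<otimes> hasse j (m - s) h))"
      using g h by (intro linear_maps_finsum[OF F.module_axioms A.module_axioms coset_linear]) (auto simp: hasse_D)
    also have "\<dots> = (\<Oplus>\<^bsub>?A\<^esub>s\<in>{..m}. ?d j s a \<otimes>\<^bsub>?A\<^esub> ?d j (m - s) b)"
    proof (intro A.M.finsum_cong' refl)
      fix s assume s: "s \<in> {..m}"
      have "s < p ^ e j" "m - s < p ^ e j" using s 2(1) by auto
      then show "I +> (hasse j s g \<otimes> hasse j (m - s) h) = ?d j s a \<otimes>\<^bsub>?A\<^esub> ?d j (m - s) b"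
        unfolding g(2) h(2) d[OF g(1)] d[OF h(1)] using g h by (simp add: F.coset_mult[OF I] hasse_D)
    next
      show "(\<lambda>s. ?d j s a \<otimes>\<^bsub>?A\<^esub> ?d j (m - s) b) \<in> {..m} \<rightarrow> carrier ?A"
        using 2(2,3) linear_maps_closed[OF d_linear] by blast
    qed
    finally show ?case .
  qed
  show ?thesis
  proof (rule hasse_algebra.intro[OF A.assoc_algebra_axioms hasse_algebra_axioms.intro], goal_cases)
    case (5 j)
    then show ?case using js by (simp add: Q.coset_in_quotient)
  next
    case (6 j)
    show ?case by (rule hd)
  next
    \<comment> \<open>For \<open>e j = 0\<close> the operator of order 1 is already truncated to
      zero, hence the guard \<open>1 < p ^ e j\<close>.\<close>
    case (8 j l)
    then have jl: "l \<in> S" "1 < p ^ e j" using js by auto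
    then show ?case
      unfolding d[OF gen_closed[OF jl(1)]] by (simp only: hasse_generator(1)) (simp add: one Q.coset_zero)
  next
    case (9 j l m)
    then have "l \<in> S" "2 \<le> m" using js by auto
    then show ?case
      unfolding d[OF gen_closed[OF \<open>l \<in> S\<close>]] by (simp add: hasse_generator(2) Q.coset_zero)
  next
    case (10 j m s a)
    obtain g where g: "g \<in> carrier F" "a = I +> g" using 10(4) by (rule Q.quotient_cases)
    \<comment> \<open>When \<open>m + s\<close> reaches the truncation order, the truncated operator
      on the right is zero, so the coefficient on the left must vanish in \<open>k\<close>.\<close>
    have "R.of_int (int ((m + s) choose s)) = \<zero>\<^bsub>k\<^esub>" if ms: "\<not> m + s < p ^ e j"
    proof -
      obtain c where "(m + s) choose s = p * c"
        using prime_dvd_choose_add[OF p 10(2,3)] ms by (auto elim: dvdE)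
      then show ?thesis by (simp add: R.of_int_mult char)
    qed
    moreover have "?d j m (?d j s a) = I +> hasse j m (hasse j s g)"
      unfolding g(2) d[OF g(1)] using 10(2,3) g(1) by (simp add: Q.induced_map_coset[OF hasse_linear] hasse_I hasse_D)
    ultimately show ?case
      unfolding g(2) d[OF g(1)] using g(1)
      by (auto simp: hasse_hasse Q.coset_smult hasse_D)
  next
    case (11 j l a m s)
    obtain g where g: "g \<in> carrier F" "a = I +> g" using 11(4) by (rule Q.quotient_cases)
    have dd: "?d j m (?d l s (I +> g)) = I +>
        (if m < p ^ e j \<and> s < p ^ e l then hasse j m (hasse l s g) else \<zero>)" for j l m s
      unfolding d[OF g(1)] using g(1) by (subst d) (auto simp: hasse_D hasse_zero)
    show ?case
      unfolding g(2) dd using 11(3) g(1) hasse_commute by auto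
  qed (use p_pos js half in auto)
qed

end

theorem theorem2p9:
  fixes p n m i :: nat
    and k :: "('k, 'x) ring_scheme"
    and e :: "nat \<Rightarrow> nat"
    and f :: "nat \<Rightarrow> nat list \<Rightarrow> 'k"
    and F :: "('k, nat list \<Rightarrow> 'k) module"
    and A :: "('k, (nat list \<Rightarrow> 'k) set) module"
  assumes "Factorial_Ring.prime p" and "p > 2"
    and "algebraically_closed k" and "group.ord (add_monoid k) \<one>\<^bsub>k\<^esub> = p"
    and "n \<ge> 1"
    and "F = free_algebra k {1..n}"
    and "\<And>l. l \<in> {1..m} \<Longrightarrow>
      f l \<in> generated_subalgebra k F {generator k j [^]\<^bsub>F\<^esub> (p ^ e j) | j. j \<in> {1..n}}"
    and "A = quotient_algebra F (Idl\<^bsub>F\<^esub> (f ` {1..m}))"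
    and "i \<ge> 1"
  shows "\<exists>act. algebra_module k (tensor_algebra k {1..n} (\<lambda>j. weyl_sub p k (e j)))
    (lcs_quotient k A i) act"
proof -
  interpret k: algebraically_closed k by fact
  interpret free_alg k "{1..n}" F by unfold_locales fact
  have ord: "k.add.ord \<one>\<^bsub>k\<^esub> = p" by fact
  have pow: "(s :: nat) \<noteq> 0 \<Longrightarrow> [s] \<cdot>\<^bsub>k\<^esub> \<one>\<^bsub>k\<^esub> = \<zero>\<^bsub>k\<^esub> \<longleftrightarrow> p dvd s" for s
    using k.add.pow_eq_id[of "\<one>\<^bsub>k\<^esub>" s] ord by simp
  have char: "k.of_int (int p) = \<zero>\<^bsub>k\<^esub>"
    using pow[of p] \<open>p > 2\<close> by (simp add: k.of_int_def add_pow_int_ge)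
  \<comment> \<open>Invertibility of 2 is what the symmetrised multiplication needs.\<close>
  have two: "\<one>\<^bsub>k\<^esub> \<oplus>\<^bsub>k\<^esub> \<one>\<^bsub>k\<^esub> \<noteq> \<zero>\<^bsub>k\<^esub>"
  proof -
    have "\<not> p dvd 2" using \<open>p > 2\<close> by (auto dest: dvd_imp_le)
    then show ?thesis using pow[of 2] by (simp add: numeral_2_eq_2)
  qed
  define half where "half = inv\<^bsub>k\<^esub> (\<one>\<^bsub>k\<^esub> \<oplus>\<^bsub>k\<^esub> \<one>\<^bsub>k\<^esub>)"
  have unit: "\<one>\<^bsub>k\<^esub> \<oplus>\<^bsub>k\<^esub> \<one>\<^bsub>k\<^esub> \<in> Units k"
    using two by (simp add: k.field_Units)
  then have half: "half \<in> carrier k" by (simp add: half_def)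
  moreover have "half \<oplus>\<^bsub>k\<^esub> half = half \<otimes>\<^bsub>k\<^esub> (\<one>\<^bsub>k\<^esub> \<oplus>\<^bsub>k\<^esub> \<one>\<^bsub>k\<^esub>)"
    using half by (simp add: k.r_distr)
  then have "half \<oplus>\<^bsub>k\<^esub> half = \<one>\<^bsub>k\<^esub>"
    using unit by (simp add: half_def)
  ultimately interpret hasse_algebra k A p "[1..<Suc n]" e
    "\<lambda>j. Idl\<^bsub>F\<^esub> (f ` {1..m}) +>\<^bsub>F\<^esub> generator k j"
    "\<lambda>j s Y. if s < p ^ e j then induced_map F (Idl\<^bsub>F\<^esub> (f ` {1..m})) (hasse j s) Y else \<zero>\<^bsub>A\<^esub>" half
    unfolding \<open>A = _\<close>
    by (intro quotient_hasse_algebra \<open>Factorial_Ring.prime p\<close> char)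
      (use assms(7) in \<open>auto simp: atLeastLessThanSuc_atLeastAtMost simp del: upt_Suc\<close>)
  obtain i' where i': "i = Suc i'" using \<open>i \<ge> 1\<close> by (cases i) auto
  have js: "set [1..<Suc n] = {1..n}" by (simp add: atLeastLessThanSuc_atLeastAtMost del: upt_Suc)
  show ?thesis
    using commuting_weyl_operators.tensor_module[OF lcs_quotient_operators[of i']]
    unfolding i' js .
qed

end
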